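(* Let $P^*(\mathbf{t})$ be the multivariate Laurent polynomial $$P^*(\mathbf{t}):=\sum_{\alpha\in\mathcal{M}(\mathbf{Q})\cap\mathcal{C}}p(\alpha)\,\mathbf{t}^{\alpha}.$$ Then the Poincaré series $P(\mathbf{t})$ associated with $\widehat{H}(\mathbf{Q})$ satisfies $$P(\mathbf{t})=\Big(\sum_{\eta\in\Theta(\mathbf{Q})}\mathbf{t}^{\eta}\Big)\cdot P^*(\mathbf{t}).$$
   Context: Let $\mathbb{F}$ be a finite field and $\mathcal{X}$ a projective, non-singular, geometrically irreducible algebraic curve over $\mathbb{F}$ with function field $\mathbb{F}(\mathcal{X})$. Let $m\geq 2$ and let $\mathbf{Q}=(Q_1,\ldots,Q_m)$ be an $m$-tuple of pairwise distinct $\mathbb{F}$-rational points of $\mathcal{X}$. Standing assumption: $\#\mathbb{F}\geq m$. Put $I=\{1,\ldots,m\}$. Let $R_{\mathbf{Q}}$ be the ring of functions of $\mathcal{X}$ that are regular outside $\{Q_1,\ldots,Q_m\}$. For $f\in R_{\mathbf{Q}}\setminus\{0\}$ put $\rho_{\mathbf{Q}}(f)=(-v_{Q_1}(f),\ldots,-v_{Q_m}(f))\in\mathbb{Z}^m$. The generalized Weierstrass semigroup is $\widehat{H}(\mathbf{Q})=\{\rho_{\mathbf{Q}}(f): f\in R_{\mathbf{Q}}\setminus\{0\}\}\subseteq\mathbb{Z}^m$. For $\alpha\in\mathbb{Z}^m$, put $\nabla_i(\alpha)=\{\beta\in\widehat{H}(\mathbf{Q}):\beta_i=\alpha_i,\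 \beta_j<\alpha_j\ \forall j\neq i\}$. An element $\alpha\in\widehat{H}(\mathbf{Q})$ is maximal if $\bigcup_{i=1}^m\nabla_i(\alpha)=\emptyset$; $\mathcal{M}(\mathbf{Q})$ is the set of maximal elements. For $\alpha\in\mathbb{Z}^m$, $\ell(\alpha)$ is the $\mathbb{F}$-dimension of the Riemann-Roch space of $\sum_i\alpha_iQ_i$. For $J\subseteq I$, $\mathbf{1}_J\in\mathbb{Z}^m$ has $j$-th coordinate $1$ if $j\in J$ and $0$ otherwise; $\mathbf{1}=\mathbf{1}_I$, $\mathbf{e}_i=\mathbf{1}_{\{i\}}$. Put $d_i(\beta)=\ell(\beta)-\ell(\beta-\mathbf{e}_i)$. Write $\mathbf{t}^\alpha=t_1^{\alpha_1}\cdots t_m^{\alpha_m}$. The Poincaré series associated with $\widehat{H}(\mathbf{Q})$ is the formal series $P(\mathbf{t})=\sum_{\alpha\in\mathbb{Z}^m}p(\alpha)\mathbf{t}^\alpha$ with $$p(\alpha)=(-1)^{m-1}\sum_{J\subseteq I\setminus\{i\}}(-1)^{\#J}d_i(\alpha-\mathbf{1}+\mathbf{1}_J+\mathbf{e}_i),$$ which does not depend on the choice of $i\in I$. A formal series means a $\mathbb{Z}$-valued function on $\mathbb{Z}^m$ written $\sum_{\alpha\in\mathbb{Z}^m}s(\alpha)\mathbf{t}^\alpha$; formal series form a module over the ring of Laurent polynomials in $t_1,\ldots,t_m$ over $\mathbb{Z}$ via the usual multiplication rule. For $i=1,\ldots,m-1$, let $a_i$ be the smallest positive integer $t$ such that $t(Q_i-Q_{i+1})$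 is a principal divisor on $\mathcal{X}$, and let $\eta^i\in\mathbb{Z}^m$ be the tuple with $i$-th coordinate $a_i$, $(i+1)$-th coordinate $-a_i$, and all other coordinates $0$. $\Theta(\mathbf{Q})$ is the subgroup of $\mathbb{Z}^m$ generated by $\eta^1,\ldots,\eta^{m-1}$, and $\mathcal{C}=\{\alpha\in\mathbb{Z}^m: 0\leq\alpha_i<a_i\text{ for }i=1,\ldots,m-1\}$. *)

theory Defs
  imports
    "HOL-Library.Poly_Mapping"
    "HOL-Algebra.Algebraic_Closure_Type"
    "HOL-Computational_Algebra.Group_Closure"
begin

section \<open>Forms and projective algebraic sets\<close>

type_synonym 'a mpoly = "(nat \<Rightarrow>\<^sub>0 nat) \<Rightarrow>\<^sub>0 'a"

text \<open>Evaluation at the vector \<open>v\<close>, the coefficients being transported along \<open>\<phi>\<close>.\<close>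

definition mpoly_eval ::
  "('a::zero \<Rightarrow> 'b::comm_ring_1) \<Rightarrow> (nat \<Rightarrow> 'b) \<Rightarrow> 'a mpoly \<Rightarrow> 'b" where
  "mpoly_eval \<phi> v f =
     (\<Sum>u\<in>Poly_Mapping.keys f. \<phi> (Poly_Mapping.lookup f u) * (\<Prod>i\<in>Poly_Mapping.keys u. v i ^ Poly_Mapping.lookup u i))"

text \<open>Homogeneous polynomials of degree \<open>d\<close> in \<open>X\<^sub>0, \<dots>, X\<^sub>n\<close>; the zero polynomial is a form
  of every degree.\<close>

definition is_form :: "nat \<Rightarrow> nat \<Rightarrow> 'a::zero mpoly \<Rightarrow> bool" where
  "is_form n d f \<longleftrightarrow>
     (\<forall>u\<in>Poly_Mapping.keys f.
        Poly_Mapping.keys u \<subseteq> {..n} \<and> (\<Sum>i\<in>Poly_Mapping.keys u. Poly_Mapping.lookup u i) = d)"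

text \<open>A point of projective \<open>n\<close>-space is the set of all its homogeneous coordinate vectors;
  a vector \<open>(v\<^sub>0, \<dots>, v\<^sub>n)\<close> is a function that vanishes beyond \<open>n\<close>.\<close>

type_synonym 'b ppoint = "(nat \<Rightarrow> 'b) set"

definition proj_space :: "nat \<Rightarrow> 'b::field ppoint set" where
  "proj_space n =
     {v. (\<exists>i. v i \<noteq> 0) \<and> (\<forall>i>n. v i = 0)} // {(v, w). \<exists>c. c \<noteq> 0 \<and> w = (\<lambda>i. c * v i)}"

definition vanishes_at :: "('a::zero \<Rightarrow> 'b::comm_ring_1) \<Rightarrow> 'a mpoly \<Rightarrow> 'b ppoint \<Rightarrow> bool" where
  "vanishes_at \<phi> f P \<longleftrightarrow> (\<forall>v\<in>P. mpoly_eval \<phi> v f = 0)"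

definition zero_locus :: "nat \<Rightarrow> ('a::zero \<Rightarrow> 'b::field) \<Rightarrow> 'a mpoly set \<Rightarrow> 'b ppoint set" where
  "zero_locus n \<phi> S = {P \<in> proj_space n. \<forall>f\<in>S. vanishes_at \<phi> f P}"

definition zariski_closed :: "nat \<Rightarrow> 'b::field ppoint set \<Rightarrow> bool" where
  "zariski_closed n A \<longleftrightarrow> (\<exists>S. (\<forall>f\<in>S. \<exists>d. is_form n d f) \<and> A = zero_locus n id S)"

definition zariski_irreducible :: "nat \<Rightarrow> 'b::field ppoint set \<Rightarrow> bool" where
  "zariski_irreducible n V \<longleftrightarrow>
     V \<noteq> {} \<and>
     (\<forall>A B. zariski_closed n A \<longrightarrow> zariski_closed n B \<longrightarrow> V \<subseteq> A \<union> B \<longrightarrow> V \<subseteq> A \<or> V \<subseteq> B)"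


section \<open>Curves over a finite field\<close>

text \<open>
  The base field \<open>\<bbbF>\<close> is the type \<open>'a\<close>, its algebraic closure is \<open>'a alg_closure\<close>, and the function
  field \<open>\<bbbF>(\<X>)\<close> is the type \<open>'k\<close>. The curve is cut out in projective space of dimension \<open>ambient\<close>
  by the forms in \<open>equations\<close>, which have coefficients in \<open>\<bbbF>\<close>. The remaining components describe
  how \<open>'k\<close> is the function field: \<open>const\<close> is the embedding of the constants, and the class of
  \<open>f / g\<close>, for forms \<open>f\<close>, \<open>g\<close> of the same degree with \<open>g\<close> not identically zero on the curve,
  is \<open>f(x) / g(x)\<close> where \<open>x = coord\<close>.
\<close>

record (overloaded) ('a, 'k) curve =
  ambient :: nat
  equations :: "'a::zero mpoly set"
  const :: "'a \<Rightarrow> 'k"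
  coord :: "nat \<Rightarrow> 'k"

text \<open>All geometric points. A closed point of the scheme over \<open>\<bbbF>\<close> is a Galois orbit of these,
  and all notions below are constant on Galois orbits.\<close>

definition points :: "('a::field, 'k) curve \<Rightarrow> 'a alg_closure ppoint set" where
  "points C = zero_locus (ambient C) to_ac (equations C)"

definition rational_point :: "'a::field alg_closure ppoint \<Rightarrow> bool" where
  "rational_point P \<longleftrightarrow> (\<exists>v\<in>P. \<forall>i. v i \<in> range to_ac)"

text \<open>The value in \<open>'k\<close> of a form at the generic point.\<close>

definition gen_val :: "('a::field, 'k::field) curve \<Rightarrow> 'a mpoly \<Rightarrow> 'k" where
  "gen_val C f = mpoly_eval (const C) (coord C) f"

text \<open>
  The second conjunct says that \<open>f / g \<mapsto> f(x) / g(x)\<close> is well defined and injective on the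
  homogeneous degree-zero fractions of \<open>\<bbbF>[X\<^sub>0, \<dots>, X\<^sub>n] / I(\<X>)\<close>, the third that it is onto;
  so the map is an isomorphism from the function field of the curve onto \<open>'k\<close>.
\<close>

definition is_function_field :: "('a::field, 'k::field) curve \<Rightarrow> bool" where
  "is_function_field C \<longleftrightarrow>
     (const C 1 = 1 \<and>
      (\<forall>a b. const C (a + b) = const C a + const C b) \<and>
      (\<forall>a b. const C (a * b) = const C a * const C b)) \<and>
     (\<forall>d f. is_form (ambient C) d f \<longrightarrow>
        (gen_val C f = 0 \<longleftrightarrow> (\<forall>P\<in>points C. vanishes_at to_ac f P))) \<and>
     (\<forall>h. \<exists>d f g. is_form (ambient C) d f \<and> is_form (ambient C) d g \<and> gen_val C g \<noteq> 0 \<and>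
        h = gen_val C f / gen_val C g)"

definition transcendental_over :: "('a::field \<Rightarrow> 'k::field) \<Rightarrow> 'k \<Rightarrow> bool" where
  "transcendental_over \<iota> t \<longleftrightarrow> (\<forall>p::'a poly. p \<noteq> 0 \<longrightarrow> poly (map_poly \<iota> p) t \<noteq> 0)"

text \<open>For \<open>t\<close> transcendental: \<open>h\<close> is algebraic over \<open>\<bbbF>(t)\<close>. Denominators have been cleared, so the
  coefficients lie in \<open>\<bbbF>[t]\<close>.\<close>

definition algebraic_over_gen :: "('a::field \<Rightarrow> 'k::field) \<Rightarrow> 'k \<Rightarrow> 'k \<Rightarrow> bool" where
  "algebraic_over_gen \<iota> t h \<longleftrightarrow>
     (\<exists>p::'a poly poly. p \<noteq> 0 \<and> poly (map_poly (\<lambda>c. poly (map_poly \<iota> c) t) p) h = 0)"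

text \<open>The dimension of the curve is the transcendence degree of its function field.\<close>

definition dimension_one :: "('a::field, 'k::field) curve \<Rightarrow> bool" where
  "dimension_one C \<longleftrightarrow>
     (\<exists>t. transcendental_over (const C) t \<and> (\<forall>h. algebraic_over_gen (const C) t h))"

definition local_ring :: "('a::field, 'k::field) curve \<Rightarrow> 'a alg_closure ppoint \<Rightarrow> 'k set" where
  "local_ring C P =
     {gen_val C f / gen_val C g | d f g.
        is_form (ambient C) d f \<and> is_form (ambient C) d g \<and> \<not> vanishes_at to_ac g P}"

definition max_ideal :: "('a::field, 'k::field) curve \<Rightarrow> 'a alg_closure ppoint \<Rightarrow> 'k set" where
  "max_ideal C P =
     {gen_val C f / gen_val C g | d f g.
        is_form (ambient C) d f \<and> is_form (ambient C) d g \<and> \<not> vanishes_at to_ac g P \<and>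
        vanishes_at to_ac f P}"

definition uniformizer :: "('a::field, 'k::field) curve \<Rightarrow> 'a alg_closure ppoint \<Rightarrow> 'k \<Rightarrow> bool" where
  "uniformizer C P t \<longleftrightarrow> max_ideal C P = {t * h | h. h \<in> local_ring C P}"

text \<open>Regular local ring of dimension one: the maximal ideal is generated by one element. As finite
  fields are perfect, it makes no difference that the local rings are taken over \<open>\<bbbF>\<close>.\<close>

definition nonsingular :: "('a::field, 'k::field) curve \<Rightarrow> bool" where
  "nonsingular C \<longleftrightarrow> (\<forall>P\<in>points C. \<exists>t. uniformizer C P t)"

text \<open>Projective, non-singular, geometrically irreducible algebraic curves.\<close>

definition nonsingular_projective_curve :: "('a::field, 'k::field) curve \<Rightarrow> bool" where
  "nonsingular_projective_curve C \<longleftrightarrow>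
     (\<forall>f\<in>equations C. \<exists>d. is_form (ambient C) d f) \<and>
     zariski_irreducible (ambient C) (points C) \<and>
     is_function_field C \<and>
     dimension_one C \<and>
     nonsingular C"

text \<open>The valuation at \<open>P\<close>; it is meaningful for nonzero arguments only.\<close>

definition val_at :: "('a::field, 'k::field) curve \<Rightarrow> 'a alg_closure ppoint \<Rightarrow> 'k \<Rightarrow> int" where
  "val_at C P f =
     (THE k. \<exists>t u. uniformizer C P t \<and> u \<in> local_ring C P \<and> inverse u \<in> local_ring C P \<and>
        u \<noteq> 0 \<and> f = u * t powi k)"

type_synonym 'a divisor = "'a alg_closure ppoint \<Rightarrow>\<^sub>0 int"

definition principal_divisor :: "('a::field, 'k::field) curve \<Rightarrow> 'a divisor \<Rightarrow> bool" where
  "principal_divisor C D \<longleftrightarrow>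
     Poly_Mapping.keys D \<subseteq> points C \<and> (\<exists>f. f \<noteq> 0 \<and> (\<forall>P\<in>points C. Poly_Mapping.lookup D P = val_at C P f))"

definition riemann_roch_space :: "('a::field, 'k::field) curve \<Rightarrow> 'a divisor \<Rightarrow> 'k set" where
  "riemann_roch_space C D =
     {f. f = 0 \<or> (\<forall>P\<in>points C. val_at C P f + Poly_Mapping.lookup D P \<ge> 0)}"


section \<open>Generalized Weierstrass semigroups\<close>

text \<open>The group \<open>\<int>\<^sup>m\<close>, with coordinates indexed by \<open>1, \<dots>, m\<close>. A tuple \<open>Q\<close> of \<open>m\<close> points is a
  function on \<open>nat\<close> of which only the values at \<open>1, \<dots>, m\<close> matter.\<close>

type_synonym ituple = "nat \<Rightarrow>\<^sub>0 int"

definition Zm :: "nat \<Rightarrow> ituple set" where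
  "Zm m = {\<alpha>. Poly_Mapping.keys \<alpha> \<subseteq> {1..m}}"

definition ones :: "nat set \<Rightarrow> ituple" where
  "ones J = (\<Sum>j\<in>J. Poly_Mapping.single j 1)"

definition regular_outside ::
  "('a::field, 'k::field) curve \<Rightarrow> nat \<Rightarrow> (nat \<Rightarrow> 'a alg_closure ppoint) \<Rightarrow> 'k set" where
  "regular_outside C m Q = {f. \<forall>P\<in>points C - Q ` {1..m}. f \<in> local_ring C P}"

definition rho ::
  "('a::field, 'k::field) curve \<Rightarrow> nat \<Rightarrow> (nat \<Rightarrow> 'a alg_closure ppoint) \<Rightarrow> 'k \<Rightarrow> ituple" where
  "rho C m Q f = (\<Sum>i\<in>{1..m}. Poly_Mapping.single i (- val_at C (Q i) f))"

definition weierstrass_semigroup ::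
  "('a::field, 'k::field) curve \<Rightarrow> nat \<Rightarrow> (nat \<Rightarrow> 'a alg_closure ppoint) \<Rightarrow> ituple set" where
  "weierstrass_semigroup C m Q = rho C m Q ` (regular_outside C m Q - {0})"

definition nabla ::
  "('a::field, 'k::field) curve \<Rightarrow> nat \<Rightarrow> (nat \<Rightarrow> 'a alg_closure ppoint) \<Rightarrow>
   nat \<Rightarrow> ituple \<Rightarrow> ituple set" where
  "nabla C m Q i \<alpha> =
     {\<beta> \<in> weierstrass_semigroup C m Q.
        Poly_Mapping.lookup \<beta> i = Poly_Mapping.lookup \<alpha> i \<and> (\<forall>j\<in>{1..m} - {i}. Poly_Mapping.lookup \<beta> j < Poly_Mapping.lookup \<alpha> j)}"

definition maximal_elements ::
  "('a::field, 'k::field) curve \<Rightarrow> nat \<Rightarrow> (nat \<Rightarrow> 'a alg_closure ppoint) \<Rightarrow> ituple set" where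
  "maximal_elements C m Q =
     {\<alpha> \<in> weierstrass_semigroup C m Q. (\<Union>i\<in>{1..m}. nabla C m Q i \<alpha>) = {}}"

definition ell ::
  "('a::field, 'k::field) curve \<Rightarrow> nat \<Rightarrow> (nat \<Rightarrow> 'a alg_closure ppoint) \<Rightarrow> ituple \<Rightarrow> nat" where
  "ell C m Q \<alpha> =
     vector_space.dim (\<lambda>c f. const C c * f)
       (riemann_roch_space C (\<Sum>i\<in>{1..m}. Poly_Mapping.single (Q i) (Poly_Mapping.lookup \<alpha> i)))"

definition ell_diff ::
  "('a::field, 'k::field) curve \<Rightarrow> nat \<Rightarrow> (nat \<Rightarrow> 'a alg_closure ppoint) \<Rightarrow>
   nat \<Rightarrow> ituple \<Rightarrow> int" where
  "ell_diff C m Q i \<beta> = int (ell C m Q \<beta>) - int (ell C m Q (\<beta> - ones {i}))"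


section \<open>The Poincare series\<close>

text \<open>Laurent polynomials in \<open>t\<^sub>1, \<dots>, t\<^sub>m\<close> are elements of the group ring of the additive group
  of integer tuples. Formal series are functions vanishing outside \<open>Zm m\<close>.\<close>

type_synonym laurent_poly = "ituple \<Rightarrow>\<^sub>0 int"
type_synonym formal_series = "ituple \<Rightarrow> int"

definition series_times :: "formal_series \<Rightarrow> laurent_poly \<Rightarrow> formal_series" where
  "series_times s q = (\<lambda>\<gamma>. \<Sum>\<beta>\<in>Poly_Mapping.keys q. s (\<gamma> - \<beta>) * Poly_Mapping.lookup q \<beta>)"

text \<open>The auxiliary index \<open>i\<close> is the one whose choice does not affect the coefficients.\<close>

definition poincare_coeff ::
  "('a::field, 'k::field) curve \<Rightarrow> nat \<Rightarrow> (nat \<Rightarrow> 'a alg_closure ppoint) \<Rightarrow>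
   nat \<Rightarrow> ituple \<Rightarrow> int" where
  "poincare_coeff C m Q i \<alpha> =
     (-1) ^ (m - 1) *
     (\<Sum>J\<in>Pow ({1..m} - {i}). (-1) ^ card J *
        ell_diff C m Q i (\<alpha> - ones {1..m} + ones J + ones {i}))"

definition poincare_series ::
  "('a::field, 'k::field) curve \<Rightarrow> nat \<Rightarrow> (nat \<Rightarrow> 'a alg_closure ppoint) \<Rightarrow>
   nat \<Rightarrow> formal_series" where
  "poincare_series C m Q i = (\<lambda>\<alpha>. if \<alpha> \<in> Zm m then poincare_coeff C m Q i \<alpha> else 0)"

definition period ::
  "('a::field, 'k::field) curve \<Rightarrow> (nat \<Rightarrow> 'a alg_closure ppoint) \<Rightarrow> nat \<Rightarrow> nat" where
  "period C Q i =
     (LEAST t. 0 < t \<and>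
        principal_divisor C
          (Poly_Mapping.single (Q i) (int t) - Poly_Mapping.single (Q (i + 1)) (int t)))"

definition eta ::
  "('a::field, 'k::field) curve \<Rightarrow> (nat \<Rightarrow> 'a alg_closure ppoint) \<Rightarrow> nat \<Rightarrow> ituple" where
  "eta C Q i =
     Poly_Mapping.single i (int (period C Q i)) -
     Poly_Mapping.single (i + 1) (int (period C Q i))"

definition Theta ::
  "('a::field, 'k::field) curve \<Rightarrow> nat \<Rightarrow> (nat \<Rightarrow> 'a alg_closure ppoint) \<Rightarrow> ituple set" where
  "Theta C m Q = group_closure (eta C Q ` {1..m - 1})"

definition fund_region ::
  "('a::field, 'k::field) curve \<Rightarrow> nat \<Rightarrow> (nat \<Rightarrow> 'a alg_closure ppoint) \<Rightarrow> ituple set" where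
  "fund_region C m Q =
     {\<alpha> \<in> Zm m. \<forall>i\<in>{1..m - 1}. 0 \<le> Poly_Mapping.lookup \<alpha> i \<and> Poly_Mapping.lookup \<alpha> i < int (period C Q i)}"

definition theta_series ::
  "('a::field, 'k::field) curve \<Rightarrow> nat \<Rightarrow> (nat \<Rightarrow> 'a alg_closure ppoint) \<Rightarrow> formal_series" where
  "theta_series C m Q = (\<lambda>\<alpha>. if \<alpha> \<in> Theta C m Q then 1 else 0)"

text \<open>A sum over an infinite set would be zero by convention, so this is only meaningful when the
  index set is finite.\<close>

definition poincare_poly ::
  "('a::field, 'k::field) curve \<Rightarrow> nat \<Rightarrow> (nat \<Rightarrow> 'a alg_closure ppoint) \<Rightarrow>
   nat \<Rightarrow> laurent_poly" where
  "poincare_poly C m Q i =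
     (\<Sum>\<alpha>\<in>maximal_elements C m Q \<inter> fund_region C m Q.
        Poly_Mapping.single \<alpha> (poincare_coeff C m Q i \<alpha>))"

end

theory Submission
  imports Defs
begin

text \<open>
  Up to a sign, the coefficient \<open>p(\<alpha>)\<close> is the alternating sum of \<open>\<ell>(\<alpha> - 1 + 1\<^sub>J)\<close> over all
  subsets \<open>J\<close> of the index set (\<open>poincare_coeff_symmetric\<close>). The factorization follows from three
  facts. The coefficients are constant on the cosets of \<open>\<Theta>\<close>, because multiplication by a function
  whose divisor is supported on the marked points shifts the Riemann-Roch spaces
  (\<open>poincare_coeff_Theta\<close>). They vanish off the maximal elements, because otherwise all the
  differences \<open>d\<^sub>i\<close> in the definition are equal for a suitable \<open>i\<close>, and their alternating sum cancels
  (\<open>poincare_coeff_nonzero_maximal\<close>). And every coset of \<open>\<Theta>\<close> in \<open>\<int>\<^sup>m\<close> meets the fundamental region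
  exactly once, so that each coefficient of the product consists of a single term.

  What remains is the geometric input: the valuations at the points are discrete valuations, functions
  that are regular everywhere are constant, the periods exist, and only finitely many maximal elements
  lie in the fundamental region.

  A local ring whose maximal ideal is generated by one element \<open>t\<close> is a discrete valuation ring here,
  since any regular \<open>f\<close> is algebraically dependent on \<open>t\<close> and therefore divides a power of \<open>t\<close>
  (\<open>divides_power_t\<close>). If \<open>f\<close> is transcendental, the homomorphism sending \<open>1 / f\<close> to \<open>0\<close> extends to a
  valuation ring, which dominates the local ring of some point of the projective curve; at that point
  \<open>f\<close> is not regular (\<open>regular_everywhere_algebraic\<close>).

  Everything else rests on Riemann's inequality for divisors supported on rational points
  (\<open>riemann_inequality\<close>). Choose \<open>x\<close> with a simple pole at each of the \<open>m\<close> marked points and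
  let \<open>n\<close> be the degree of the function field over \<open>\<bbbF>(x)\<close>. A basis consisting of functions integral over
  \<open>\<bbbF>[x]\<close>, multiplied by powers of \<open>x\<close>, shows that the functions with poles bounded by \<open>k\<close> times the
  poles of \<open>x\<close> form a space of dimension at least \<open>n k - c\<close>. Removing the poles outside the marked
  points costs at most \<open>n - m\<close> dimensions for each of \<open>k\<close> steps (\<open>pole_reduction_step\<close>), because functions that
  are independent modulo \<open>1 / x\<close> at the poles of \<open>x\<close> are independent over \<open>\<bbbF>(x)\<close>.

  Taking powers of functions, Riemann's inequality shows that nonzero sections exist only in
  nonnegative degree (\<open>deg_nonneg\<close>). The existence of the periods, usually
  deduced from the finiteness of the divisor class group, has a direct proof: there are functions \<open>f\<^sub>k\<close> with poles only at one marked point and zeros of growing order at another, whose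
  remaining zeros have bounded total degree. They all divide one common function, so two of
  them have the same zeros away from the two points, and their quotient is the function required
  (\<open>two_point_principal\<close>).
\<close>

section \<open>Function fields over a finite field of constants\<close>

definition ring_hom_map :: "('r::comm_ring_1 \<Rightarrow> 's::comm_ring_1) \<Rightarrow> bool" where
  "ring_hom_map h \<longleftrightarrow> h 1 = 1 \<and> (\<forall>a b. h (a + b) = h a + h b) \<and> (\<forall>a b. h (a * b) = h a * h b)"

lemma ring_hom_mapD:
  assumes "ring_hom_map h"
  shows "h 1 = 1" "h (a + b) = h a + h b" "h (a * b) = h a * h b" "h 0 = 0" "h (- a) = - h a"
    "h (a - b) = h a - h b"
proof -
  show 1: "h 1 = 1" "h (a + b) = h a + h b" "h (a * b) = h a * h b"
    using assms by (auto simp: ring_hom_map_def)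
  have add: "h (u + v) = h u + h v" for u v using assms by (auto simp: ring_hom_map_def)
  show 0: "h 0 = 0" using add[of 0 0] by simp
  have neg: "h (- u) = - h u" for u using add[of u "- u"] 0 by (simp add: eq_neg_iff_add_eq_0 add.commute)
  show "h (- a) = - h a" by (rule neg)
  show "h (a - b) = h a - h b" using add[of a "- b"] neg[of b] by simp
qed

lemma ring_hom_map_power: "ring_hom_map h \<Longrightarrow> h (a ^ n) = h a ^ n"
  by (induction n) (auto simp: ring_hom_mapD)

lemma ring_hom_map_sum: "ring_hom_map h \<Longrightarrow> h (sum f S) = (\<Sum>i\<in>S. h (f i))"
  by (induction S rule: infinite_finite_induct) (auto simp: ring_hom_mapD)

lemma poly_map_poly_pCons:
  "ring_hom_map h \<Longrightarrow> poly (map_poly h (pCons a p)) x = h a + x * poly (map_poly h p) x"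
  by (subst map_poly_pCons) (auto simp: ring_hom_mapD)

text \<open>
  Evaluation of polynomials inherits the homomorphism laws from the coefficients; applied twice, this covers
  polynomials in two variables.
\<close>

lemma ring_hom_map_poly_eval:
  assumes "ring_hom_map h"
  shows "ring_hom_map (\<lambda>p. poly (map_poly h p) x)"
proof -
  note [simp] = ring_hom_mapD[OF assms] poly_map_poly_pCons[OF assms]
  have add: "poly (map_poly h (p + q)) x = poly (map_poly h p) x + poly (map_poly h q) x" for p q
    by (induction p q rule: poly_induct2) (auto simp: algebra_simps)
  have smult: "poly (map_poly h (smult c q)) x = h c * poly (map_poly h q) x" for c q
    by (induction q) (auto simp: algebra_simps)
  have mult: "poly (map_poly h (p * q)) x = poly (map_poly h p) x * poly (map_poly h q) x" for p q
    by (induction p) (auto simp: algebra_simps mult_pCons_left add smult)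
  show ?thesis using add mult unfolding ring_hom_map_def by (simp add: one_pCons)
qed

lemma poly_map_poly_altdef:
  assumes "ring_hom_map h" "degree p \<le> n"
  shows "poly (map_poly h p) x = (\<Sum>i\<le>n. h (coeff p i) * x ^ i)"
proof -
  have "poly (map_poly h p) x = (\<Sum>i\<le>n. coeff (map_poly h p) i * x ^ i)"
    unfolding poly_altdef using assms order.trans[OF map_poly_degree_leq[of h p] assms(2)]
    by (intro sum.mono_neutral_left) (auto simp: coeff_eq_0 ring_hom_mapD)
  thus ?thesis using assms by (simp add: coeff_map_poly ring_hom_mapD)
qed

locale const_embedding =
  fixes \<iota> :: "'a::{field,finite} \<Rightarrow> 'k::field"
  assumes hom: "ring_hom_map \<iota>"
begin

lemmas iota_simps [simp] = ring_hom_mapD[OF hom]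

lemma iota_eq_0_iff [simp]: "\<iota> c = 0 \<longleftrightarrow> c = 0"
proof
  assume "\<iota> c = 0"
  show "c = 0"
  proof (rule ccontr)
    assume "c \<noteq> 0"
    hence "\<iota> (c * inverse c) = 1" by simp
    thus False using \<open>\<iota> c = 0\<close> by (simp only: iota_simps) simp
  qed
qed auto

sublocale vector_space "\<lambda>c f. \<iota> c * f"
  by unfold_locales (auto simp: algebra_simps)

text \<open>
  The vectors form an indexed family and may coincide, in which case they are linearly related already.
\<close>

lemma linear_relation_if_card_less:
  assumes I: "finite I" and S: "finite S" and wS: "\<And>i. i \<in> I \<Longrightarrow> w i \<in> span S" and less: "card S < card I"
  shows "\<exists>g. (\<exists>i\<in>I. g i \<noteq> 0) \<and> (\<Sum>i\<in>I. \<iota> (g i) * w i) = 0"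
proof (cases "inj_on w I")
  case True
  have "dependent (w ` I)"
  proof (rule ccontr)
    assume "\<not> dependent (w ` I)"
    hence "card (w ` I) \<le> card S" using independent_span_bound[OF S] wS by blast
    thus False using less card_image[OF True] by simp
  qed
  then obtain T u v where T: "finite T" "T \<subseteq> w ` I" "(\<Sum>v\<in>T. \<iota> (u v) * v) = 0" "v \<in> T" "u v \<noteq> 0"
    unfolding dependent_explicit by blast
  define g where "g i = (if w i \<in> T then u (w i) else 0)" for i
  have "(\<Sum>i\<in>I. \<iota> (g i) * w i) = (\<Sum>i\<in>{i\<in>I. w i \<in> T}. \<iota> (u (w i)) * w i)"
    using I by (intro sum.mono_neutral_cong_right) (auto simp: g_def)
  also have "\<dots> = (\<Sum>v\<in>w ` {i\<in>I. w i \<in> T}. \<iota> (u v) * v)"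
    using inj_on_subset[OF True, of "{i\<in>I. w i \<in> T}"] by (subst sum.reindex) auto
  also have "w ` {i\<in>I. w i \<in> T} = T" using T(2) by auto
  finally have "(\<Sum>i\<in>I. \<iota> (g i) * w i) = 0" using T by simp
  moreover have "\<exists>i\<in>I. g i \<noteq> 0" using T(2,4,5) by (auto simp: g_def)
  ultimately show ?thesis by blast
next
  case False
  then obtain i j where ij: "i \<in> I" "j \<in> I" "i \<noteq> j" "w i = w j" by (auto simp: inj_on_def)
  define g :: "_ \<Rightarrow> 'a" where "g k = (if k = i then 1 else if k = j then -1 else 0)" for k
  have "(\<Sum>k\<in>I. \<iota> (g k) * w k) = (\<Sum>k\<in>{i,j}. \<iota> (g k) * w k)"
    using I ij by (intro sum.mono_neutral_right) (auto simp: g_def)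
  also have "\<dots> = 0" using ij by (simp add: g_def)
  finally show ?thesis using ij(1) by (intro exI[of _ g]) (auto simp: g_def)
qed

definition ev :: "'k \<Rightarrow> 'a poly \<Rightarrow> 'k" where "ev x p = poly (map_poly \<iota> p) x"

lemma ev_hom: "ring_hom_map (ev x)"
  unfolding ev_def by (rule ring_hom_map_poly_eval[OF hom])

lemmas ev_simps [simp] = ring_hom_mapD[OF ev_hom]

lemma ev_pCons [simp]: "ev x (pCons c p) = \<iota> c + x * ev x p"
  unfolding ev_def by (rule poly_map_poly_pCons[OF hom])

lemma ev_altdef: "degree p \<le> n \<Longrightarrow> ev x p = (\<Sum>i\<le>n. \<iota> (coeff p i) * x ^ i)"
  unfolding ev_def by (rule poly_map_poly_altdef[OF hom])

lemma ev_monom [simp]: "ev x (monom c n) = \<iota> c * x ^ n"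
  by (induction n) (auto simp: monom_0 monom_Suc)

lemma transcendental_iff: "transcendental_over \<iota> x \<longleftrightarrow> (\<forall>p. ev x p = 0 \<longrightarrow> p = 0)"
  unfolding transcendental_over_def ev_def by blast

lemma transcendental_nonzero:
  assumes "transcendental_over \<iota> x"
  shows "x \<noteq> 0"
proof
  assume "x = 0"
  hence "ev x [:0, 1:] = 0" by simp
  thus False using assms unfolding transcendental_iff by (metis pCons_eq_0_iff zero_neq_one)
qed

lemma algebraic_over_gen_iff:
  "algebraic_over_gen \<iota> x h \<longleftrightarrow> (\<exists>p. p \<noteq> 0 \<and> poly (map_poly (ev x) p) h = 0)"
  unfolding algebraic_over_gen_def ev_def ..

text \<open>
  The elements of the module generated by \<open>U\<close> over \<open>\<bbbF>[x]\<close> whose coefficients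
  have degree at most \<open>N\<close>. Its dimension grows linearly in \<open>N\<close>, with slope at most
  the number of generators, and this drives all the counting arguments below.
\<close>

definition ladder :: "'k \<Rightarrow> 'k set \<Rightarrow> nat \<Rightarrow> 'k set" where
  "ladder x U N = span ((\<lambda>(k, u). x ^ k * u) ` ({..N} \<times> U))"

lemma subspace_ladder: "subspace (ladder x U N)"
  unfolding ladder_def by (rule subspace_span)

lemma ladder_base: "k \<le> N \<Longrightarrow> u \<in> U \<Longrightarrow> x ^ k * u \<in> ladder x U N"
  unfolding ladder_def by (rule span_base) auto

lemma ladder_induct:
  assumes "f \<in> ladder x U N" and "\<And>k u. k \<le> N \<Longrightarrow> u \<in> U \<Longrightarrow> g * (x ^ k * u) \<in> V" and "subspace V"
  shows "g * f \<in> V"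
  using assms(1) unfolding ladder_def
proof (induction rule: span_induct_alt)
  case base
  then show ?case using subspace_0[OF assms(3)] by simp
next
  case (step c y z)
  have "g * y \<in> V" using step(1) assms(2) by auto
  hence "\<iota> c * (g * y) \<in> V" using subspace_scale[OF assms(3)] by blast
  hence "\<iota> c * (g * y) + g * z \<in> V" using subspace_add[OF assms(3)] step(2) by blast
  thus ?case by (simp add: algebra_simps)
qed

lemma ladder_mult_ev:
  assumes "degree C \<le> D" "f \<in> ladder x U N"
  shows "ev x C * f \<in> ladder x U (N + D)"
proof (rule ladder_induct[OF assms(2) _ subspace_ladder])
  fix k u assume ku: "k \<le> N" "u \<in> U"
  have "ev x C * (x ^ k * u) = (\<Sum>i\<le>D. \<iota> (coeff C i) * (x ^ (k + i) * u))"
    by (simp add: ev_altdef[OF assms(1)] sum_distrib_left sum_distrib_right power_add mult_ac)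
  also have "\<dots> \<in> ladder x U (N + D)"
    using ku by (intro subspace_sum[OF subspace_ladder] subspace_scale[OF subspace_ladder] ladder_base) auto
  finally show "ev x C * (x ^ k * u) \<in> ladder x U (N + D)" .
qed

lemma ladder_mult_ev_power:
  assumes "degree C \<le> D" "f \<in> ladder x U N"
  shows "ev x C ^ i * f \<in> ladder x U (N + i * D)"
proof (induction i)
  case (Suc i)
  show ?case using ladder_mult_ev[OF assms(1) Suc] by (simp add: mult_ac add_ac)
qed (use assms in auto)

lemma ladder_mono: "N \<le> N' \<Longrightarrow> ladder x U N \<subseteq> ladder x U N'"
  unfolding ladder_def by (rule span_mono) auto

text \<open>
  A ring generated by finitely many elements algebraic over \<open>\<bbbF>(x)\<close> is, up to denominators,
  a finitely generated module over \<open>\<bbbF>[x]\<close>: the generators are the monomials whose exponents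
  lie below the degrees of the equations. Multiplication by an element of \<open>Z\<close> raises the level of
  the ladder by a constant once the leading coefficients, collected in \<open>C\<close>, have been multiplied
  in.
\<close>

lemma algebraic_generators_ladder:
  assumes x: "transcendental_over \<iota> x" and "finite Z" "\<forall>z\<in>Z. algebraic_over_gen \<iota> x z"
  shows "\<exists>U C D. finite U \<and> 1 \<in> U \<and> C \<noteq> 0 \<and> degree C \<le> D \<and>
     (\<forall>z\<in>Z. \<forall>N. \<forall>f\<in>ladder x U N. ev x C * z * f \<in> ladder x U (N + D))"
  using assms(2,3)
proof (induction Z rule: finite_induct)
  case empty
  show ?case by (rule exI[of _ "{1}"], rule exI[of _ 1], rule exI[of _ 0]) auto
next
  case (insert z Z)
  then obtain U C D where IH: "finite U" "1 \<in> U" "C \<noteq> 0" "degree C \<le> D"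
     "\<And>z N f. z \<in> Z \<Longrightarrow> f \<in> ladder x U N \<Longrightarrow> ev x C * z * f \<in> ladder x U (N + D)"
    by auto
  obtain p where p: "p \<noteq> 0" "poly (map_poly (ev x) p) z = 0"
    using insert.prems by (auto simp: algebraic_over_gen_iff)
  define d where "d = degree p"
  define B where "B = Max ((\<lambda>i. degree (coeff p i)) ` {..d})"
  have B: "degree (coeff p i) \<le> B" if "i \<le> d" for i using that by (auto simp: B_def)
  have rel: "(\<Sum>i\<le>d. ev x (coeff p i) * z ^ i) = 0"
    using p(2) by (subst (asm) poly_map_poly_altdef[OF ev_hom, of p d]) (auto simp: d_def)
  have lc: "ev x (coeff p d) \<noteq> 0" "coeff p d \<noteq> 0"
    using x p(1) unfolding transcendental_iff d_def by auto
  have d0: "d > 0" using rel lc by (cases d) auto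
  define U' where "U' = (\<lambda>(u, i). u * z ^ i) ` (U \<times> {..<d})"
  define C' where "C' = C * coeff p d"
  define D' where "D' = D + B"
  have lift: "z ^ i * f \<in> ladder x U' N" if "f \<in> ladder x U N" "i < d" for f i N
  proof (rule ladder_induct[OF that(1) _ subspace_ladder])
    fix k u assume ku: "k \<le> N" "u \<in> U"
    have "x ^ k * (u * z ^ i) \<in> ladder x U' N" using ku that(2) by (intro ladder_base) (auto simp: U'_def)
    thus "z ^ i * (x ^ k * u) \<in> ladder x U' N" by (simp add: mult_ac)
  qed
  have 1: "ev x C' * z' * f \<in> ladder x U' (N + D')" if z': "z' \<in> Z" and f: "f \<in> ladder x U' N" for z' f N
  proof (rule ladder_induct[OF f _ subspace_ladder])
    fix k v assume "k \<le> N" "v \<in> U'"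
    then obtain u i where u: "u \<in> U" "i < d" "v = u * z ^ i" by (auto simp: U'_def)
    have "ev x C * z' * (x ^ k * u) \<in> ladder x U (N + D)"
      by (rule IH(5)[OF z' ladder_base[OF \<open>k \<le> N\<close> u(1)]])
    hence "ev x (coeff p d) * (z ^ i * (ev x C * z' * (x ^ k * u))) \<in> ladder x U' (N + D + B)"
      by (intro ladder_mult_ev B lift u(2)) auto
    thus "ev x C' * z' * (x ^ k * v) \<in> ladder x U' (N + D')"
      by (simp add: C'_def D'_def u(3) mult_ac add_ac)
  qed
  have 2: "ev x C' * z * f \<in> ladder x U' (N + D')" if f: "f \<in> ladder x U' N" for f N
  proof (rule ladder_induct[OF f _ subspace_ladder])
    fix k v assume "k \<le> N" "v \<in> U'"
    then obtain u i where u: "u \<in> U" "i < d" "v = u * z ^ i" by (auto simp: U'_def)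
    have b: "ev x C * (x ^ k * u) \<in> ladder x U (N + D)"
      by (intro ladder_mult_ev IH(4) ladder_base \<open>k \<le> N\<close> u(1))
    show "ev x C' * z * (x ^ k * v) \<in> ladder x U' (N + D')"
    proof (cases "Suc i < d")
      case True
      have "ev x (coeff p d) * (z ^ Suc i * (ev x C * (x ^ k * u))) \<in> ladder x U' (N + D + B)"
        by (intro ladder_mult_ev B lift True b) auto
      thus ?thesis by (simp add: C'_def D'_def u(3) mult_ac add_ac)
    next
      case False
      hence i: "Suc i = d" using u(2) by simp
      have "(\<Sum>j<d. ev x (coeff p j) * z ^ j) + ev x (coeff p d) * z ^ d = 0"
        using rel by (simp add: lessThan_Suc_atMost[symmetric])
      hence zd: "ev x (coeff p d) * z ^ d = - (\<Sum>j<d. ev x (coeff p j) * z ^ j)"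
        by (simp add: eq_neg_iff_add_eq_0 add.commute)
      have "ev x C' * z * (x ^ k * v) = (ev x (coeff p d) * z ^ Suc i) * (ev x C * (x ^ k * u))"
        by (simp add: C'_def u(3) mult_ac)
      also have "\<dots> = - (\<Sum>j<d. ev x (coeff p j) * (z ^ j * (ev x C * (x ^ k * u))))"
        unfolding i zd by (simp add: sum_distrib_left sum_distrib_right mult_ac)
      also have "\<dots> \<in> ladder x U' (N + D + B)"
        by (intro subspace_neg[OF subspace_ladder] subspace_sum[OF subspace_ladder] ladder_mult_ev B lift b) auto
      finally show ?thesis by (simp add: D'_def add_ac)
    qed
  qed
  have "C' \<noteq> 0" using IH(3) lc(2) by (simp add: C'_def)
  moreover have "degree C' \<le> D'"
    using IH(4) B[of d] degree_mult_le[of C "coeff p d"] by (simp add: C'_def D'_def)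
  moreover have "finite U'" using IH(1) by (simp add: U'_def)
  moreover have "1 \<in> U'" unfolding U'_def using IH(2) d0 by (intro image_eqI[of _ _ "(1, 0)"]) auto
  ultimately show ?case using 1 2 by (intro exI[of _ U'] exI[of _ C'] exI[of _ D']) auto
qed

lemma card_ladder_generators:
  "finite U \<Longrightarrow> finite ((\<lambda>(k, u). x ^ k * u) ` ({..N} \<times> U)) \<and>
     card ((\<lambda>(k, u). x ^ k * u) ` ({..N} \<times> U)) \<le> (N + 1) * card U"
  using card_image_le[of "{..N} \<times> U" "\<lambda>(k, u). x ^ k * u"] by (auto simp: card_cartesian_product)

text \<open>
  Transcendence degree one by counting: after clearing denominators, the monomials \<open>a\<^sup>i
  b\<^sup>j\<close> with \<open>i, j \<le> L\<close> lie in a space whose dimension is linear in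
  \<open>L\<close>, while their number is quadratic.
\<close>

lemma algebraically_dependent_pair:
  assumes t: "transcendental_over \<iota> t" and alg: "\<And>h. algebraic_over_gen \<iota> t h"
  shows "algebraic_over_gen \<iota> a b"
proof -
  have "\<forall>z\<in>{a, b}. algebraic_over_gen \<iota> t z" using alg by blast
  from algebraic_generators_ladder[OF t _ this]
  obtain U C D where U: "finite U" "1 \<in> U" "C \<noteq> 0" "degree C \<le> D"
     "\<And>z N f. z \<in> {a, b} \<Longrightarrow> f \<in> ladder t U N \<Longrightarrow> ev t C * z * f \<in> ladder t U (N + D)"
    by blast
  define c where "c = ev t C"
  have c: "c \<noteq> 0" using t U(3) unfolding c_def transcendental_iff by auto
  have pow: "(c * z) ^ i * f \<in> ladder t U (N + i * D)" if "z \<in> {a, b}" "f \<in> ladder t U N" for z i f N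
  proof (induction i)
    case (Suc i)
    have "c * z * ((c * z) ^ i * f) \<in> ladder t U (N + i * D + D)"
      using U(5)[OF that(1) Suc] by (simp add: c_def)
    thus ?case by (simp add: mult_ac add_ac)
  qed (use that in auto)
  have powc: "c ^ i * f \<in> ladder t U (N + i * D)" if "f \<in> ladder t U N" for i f N
    unfolding c_def by (rule ladder_mult_ev_power[OF U(4) that])
  \<comment> \<open>makes \<open>(L + 1)\<^sup>2\<close> exceed the number \<open>card U (2 L D + 1)\<close> of generators\<close>
  define L where "L = 2 * card U * (D + 1)"
  define w where "w = (\<lambda>(i, j). c ^ (2 * L) * (a ^ i * b ^ j))"
  let ?S = "(\<lambda>(k, u). t ^ k * u) ` ({..2 * L * D} \<times> U)"
  have 1: "1 \<in> ladder t U 0" using ladder_base[of 0 0 1 U t] U(2) by simp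
  have w: "w ij \<in> span ?S" if "ij \<in> {..L} \<times> {..L}" for ij
  proof -
    from that obtain i j where ij: "ij = (i, j)" "i \<le> L" "j \<le> L" by auto
    have "c ^ (2 * L - i - j) * ((c * b) ^ j * ((c * a) ^ i * 1))
       \<in> ladder t U (0 + i * D + j * D + (2 * L - i - j) * D)"
      by (intro powc pow 1) auto
    also have "0 + i * D + j * D + (2 * L - i - j) * D = (i + j + (2 * L - i - j)) * D"
      by (simp only: add_mult_distrib)
    also have "i + j + (2 * L - i - j) = 2 * L" using ij by simp
    also have "c ^ (2 * L - i - j) * ((c * b) ^ j * ((c * a) ^ i * 1)) =
        c ^ (i + j + (2 * L - i - j)) * (a ^ i * b ^ j)"
      by (simp add: power_add power_mult_distrib mult_ac)
    also have "i + j + (2 * L - i - j) = 2 * L" using ij by simp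
    finally show ?thesis by (simp add: w_def ij ladder_def)
  qed
  have "card ?S \<le> (2 * L * D + 1) * card U" using card_ladder_generators[OF U(1)] by blast
  also have "\<dots> < (L + 1) * (L + 1)"
  proof -
    have pos: "card U \<ge> 1" using U(1,2) by (metis One_nat_def Suc_leI card_gt_0_iff empty_iff)
    have "(2 * L * D + 1) * card U = 2 * card U * D * L + card U" by (simp add: algebra_simps)
    also have "\<dots> \<le> L * L + card U"
      by (rule add_right_mono, rule mult_right_mono) (auto simp: L_def)
    also have "card U \<le> L" by (simp add: L_def)
    hence "L * L + card U < (L + 1) * (L + 1)" by (simp add: algebra_simps)
    finally show ?thesis .
  qed
  also have "\<dots> = card ({..L} \<times> {..L})" by (simp add: card_cartesian_product)
  finally have less: "card ?S < card ({..L} \<times> {..L})" .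
  have fin: "finite ({..L} \<times> {..L})" "finite ?S" using U(1) by auto
  have "\<exists>g. (\<exists>i\<in>{..L} \<times> {..L}. g i \<noteq> 0) \<and> (\<Sum>i\<in>{..L} \<times> {..L}. \<iota> (g i) * w i) = 0"
    by (rule linear_relation_if_card_less[OF fin _ less]) (rule w)
  then obtain g where g: "\<exists>ij\<in>{..L} \<times> {..L}. g ij \<noteq> 0" "(\<Sum>ij\<in>{..L} \<times> {..L}. \<iota> (g ij) * w ij) = 0"
    by blast
  define p where "p = (\<Sum>j\<le>L. monom (\<Sum>i\<le>L. monom (g (i, j)) i) j)"
  obtain i0 j0 where ij0: "i0 \<le> L" "j0 \<le> L" "g (i0, j0) \<noteq> 0" using g(1) by auto
  have "coeff (coeff p j0) i0 = g (i0, j0)"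
    using ij0 by (simp add: p_def coeff_sum sum.delta if_distrib cong: if_cong)
  hence "p \<noteq> 0" using ij0 by auto
  moreover have "poly (map_poly (ev a) p) b = 0"
  proof -
    have "poly (map_poly (ev a) p) b = (\<Sum>j\<le>L. poly (map_poly (ev a) (monom (\<Sum>i\<le>L. monom (g (i, j)) i) j)) b)"
      unfolding p_def by (rule ring_hom_map_sum[OF ring_hom_map_poly_eval[OF ev_hom]])
    also have "\<dots> = (\<Sum>j\<le>L. \<Sum>i\<le>L. \<iota> (g (i, j)) * (a ^ i * b ^ j))"
      by (simp add: map_poly_monom poly_monom ring_hom_map_sum[OF ev_hom] sum_distrib_left sum_distrib_right mult_ac)
    also have "\<dots> = (\<Sum>i\<le>L. \<Sum>j\<le>L. \<iota> (g (i, j)) * (a ^ i * b ^ j))" by (rule sum.swap)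
    also have "c ^ (2 * L) * \<dots> = (\<Sum>ij\<in>{..L} \<times> {..L}. \<iota> (g ij) * w ij)"
      by (simp add: sum.cartesian_product' w_def sum_distrib_left mult_ac)
    finally show ?thesis using g(2) c by simp
  qed
  ultimately show ?thesis unfolding algebraic_over_gen_iff by blast
qed

text \<open>
  The \<open>\<bbbF>\<close>-algebra generated by \<open>Z\<close>. Multiplication by a generator is the only
  product in the rules; this makes inductions on the ladder direct.
\<close>

inductive_set generated_algebra :: "'k set \<Rightarrow> 'k set" for Z where
  const: "\<iota> c \<in> generated_algebra Z"
| add: "a \<in> generated_algebra Z \<Longrightarrow> b \<in> generated_algebra Z \<Longrightarrow> a + b \<in> generated_algebra Z"
| mult_gen: "z \<in> Z \<Longrightarrow> a \<in> generated_algebra Z \<Longrightarrow> z * a \<in> generated_algebra Z"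

lemma generated_algebra_mult:
  assumes "a \<in> generated_algebra Z" "b \<in> generated_algebra Z"
  shows "a * b \<in> generated_algebra Z"
  using assms(1)
proof induction
  case (const c)
  from assms(2) show ?case
  proof induction
    case (const d)
    have "\<iota> c * \<iota> d = \<iota> (c * d)" by simp
    then show ?case by (metis generated_algebra.const)
  next
    case (add a b)
    then show ?case by (metis generated_algebra.add distrib_left)
  next
    case (mult_gen z a)
    then show ?case by (metis generated_algebra.mult_gen mult.left_commute)
  qed
next
  case (add a b)
  then show ?case by (metis generated_algebra.add distrib_right)
next
  case (mult_gen z a)
  then show ?case by (metis generated_algebra.mult_gen mult.assoc)
qed

lemma generated_algebra_prod:
  "(\<And>i. i \<in> I \<Longrightarrow> f i \<in> generated_algebra Z) \<Longrightarrow> prod f I \<in> generated_algebra Z"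
proof (induction I rule: infinite_finite_induct)
  case (insert i I)
  then show ?case by (simp add: generated_algebra_mult)
qed (use generated_algebra.const[of 1] in auto)

lemma generated_algebra_sum:
  "(\<And>i. i \<in> I \<Longrightarrow> f i \<in> generated_algebra Z) \<Longrightarrow> sum f I \<in> generated_algebra Z"
proof (induction I rule: infinite_finite_induct)
  case (insert i I)
  then show ?case by (simp add: generated_algebra.add)
qed (use generated_algebra.const[of 0] in auto)

lemma generated_algebra_power:
  "a \<in> generated_algebra Z \<Longrightarrow> a ^ n \<in> generated_algebra Z"
  using generated_algebra_prod[of "{..<n}" "\<lambda>_. a" Z] by simp

text \<open>
  Linear independence over the field \<open>\<bbbF>(x)\<close>, with denominators cleared.
\<close>

definition poly_independent :: "'k \<Rightarrow> 'i set \<Rightarrow> ('i \<Rightarrow> 'k) \<Rightarrow> bool" where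
  "poly_independent x I w \<longleftrightarrow>
     (\<forall>p. (\<Sum>i\<in>I. ev x (p i) * w i) = 0 \<longrightarrow> (\<forall>i\<in>I. p i = 0))"

text \<open>
  The function field has finite degree over \<open>\<bbbF>(x)\<close>. A family independent over
  \<open>\<bbbF>[x]\<close> and multiplied by a common denominator lies in some ladder; as it spans a space
  growing with slope \<open>card Y\<close>, this number is at most the slope of the ladder.
\<close>

lemma rank_bound:
  assumes x: "transcendental_over \<iota> x" and alg: "\<And>h. algebraic_over_gen \<iota> x h"
    and Z: "finite Z" and frac: "\<And>h. \<exists>a\<in>generated_algebra Z. \<exists>b\<in>generated_algebra Z. b \<noteq> 0 \<and> h = a / b"
  shows "\<exists>n. \<forall>Y. finite Y \<and> poly_independent x Y (\<lambda>y. y) \<longrightarrow> card Y \<le> n"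
proof -
  obtain U C D where U: "finite U" "1 \<in> U" "C \<noteq> 0" "degree C \<le> D"
     "\<And>z N f. z \<in> Z \<Longrightarrow> f \<in> ladder x U N \<Longrightarrow> ev x C * z * f \<in> ladder x U (N + D)"
    using algebraic_generators_ladder[OF x Z] alg by auto
  define c where "c = ev x C"
  have c: "c \<noteq> 0" using x U(3) unfolding c_def transcendental_iff by auto
  have powc: "c ^ i * f \<in> ladder x U (N + i * D)" if "f \<in> ladder x U N" for i f N
    unfolding c_def by (rule ladder_mult_ev_power[OF U(4) that])
  have gen: "\<exists>k N. c ^ k * a \<in> ladder x U N" if "a \<in> generated_algebra Z" for a
    using that
  proof induction
    case (const d)
    have "\<iota> d * (x ^ 0 * 1) \<in> ladder x U 0"
      using U(2) by (intro subspace_scale[OF subspace_ladder] ladder_base) auto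
    hence "c ^ 0 * \<iota> d \<in> ladder x U 0" by simp
    then show ?case by blast
  next
    case (add a b)
    then obtain k N k' N' where *: "c ^ k * a \<in> ladder x U N" "c ^ k' * b \<in> ladder x U N'" by blast
    have "c ^ k' * (c ^ k * a) \<in> ladder x U (N + k' * D + (N' + k * D))"
      "c ^ k * (c ^ k' * b) \<in> ladder x U (N + k' * D + (N' + k * D))"
      using powc[OF *(1), of k'] powc[OF *(2), of k]
        ladder_mono[of "N + k' * D" "N + k' * D + (N' + k * D)" x U]
        ladder_mono[of "N' + k * D" "N + k' * D + (N' + k * D)" x U] by auto
    from subspace_add[OF subspace_ladder this]
    have "c ^ (k + k') * (a + b) \<in> ladder x U (N + k' * D + (N' + k * D))"
      by (simp add: power_add algebra_simps)
    then show ?case by blast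
  next
    case (mult_gen z a)
    then obtain k N where "c ^ k * a \<in> ladder x U N" by blast
    from U(5)[OF mult_gen(1) this] have "c ^ Suc k * (z * a) \<in> ladder x U (N + D)"
      by (simp add: c_def mult_ac)
    then show ?case by blast
  qed
  have "card Y \<le> card U" if Y: "finite Y" "poly_independent x Y (\<lambda>y. y)" for Y
  proof (rule ccontr)
    assume big: "\<not> card Y \<le> card U"
    obtain a b where ab: "\<And>y. a y \<in> generated_algebra Z" "\<And>y. b y \<in> generated_algebra Z"
        "\<And>y. b y \<noteq> 0" "\<And>y. y = a y / b y"
      using frac by metis
    define B where "B = prod b Y"
    have B: "B \<noteq> 0" using ab(3) by (simp add: B_def Y(1))
    have "B * y \<in> generated_algebra Z" if "y \<in> Y" for y
    proof -
      have "B * y = prod b (Y - {y}) * a y"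
        using prod.remove[OF Y(1) that, of b] ab(3)[of y] ab(4)[of y] unfolding B_def
        by (metis (no_types, lifting) mult.commute mult.left_commute nonzero_mult_div_cancel_left times_divide_eq_right)
      thus ?thesis using ab by (auto intro!: generated_algebra_mult generated_algebra_prod)
    qed
    hence "\<forall>y\<in>Y. \<exists>k N. c ^ k * (B * y) \<in> ladder x U N" using gen by blast
    then obtain k N where kN: "\<And>y. y \<in> Y \<Longrightarrow> c ^ k y * (B * y) \<in> ladder x U (N y)" by metis
    define K where "K = sum k Y"
    define N0 where "N0 = sum N Y + K * D"
    have N0: "c ^ K * (B * y) \<in> ladder x U N0" if "y \<in> Y" for y
    proof -
      have ky: "k y \<le> K" "N y \<le> sum N Y" using that Y(1) by (auto simp: K_def intro: member_le_sum)
      have "c ^ (K - k y) * (c ^ k y * (B * y)) \<in> ladder x U (N y + (K - k y) * D)"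
        by (rule powc[OF kN[OF that]])
      also have "\<dots> \<subseteq> ladder x U N0" unfolding N0_def
        by (intro ladder_mono add_mono ky mult_right_mono) auto
      also have "c ^ (K - k y) * (c ^ k y * (B * y)) = c ^ K * (B * y)"
        using ky(1) by (simp add: mult.assoc[symmetric] power_add[symmetric])
      finally show ?thesis .
    qed
    \<comment> \<open>with at least \<open>card U + 1\<close> elements in \<open>Y\<close>, this length beats the offset \<open>N0\<close>\<close>
    define L where "L = card U * N0"
    define w where "w = (\<lambda>(y, j). x ^ j * (c ^ K * (B * y)))"
    let ?S = "(\<lambda>(k, u). x ^ k * u) ` ({..N0 + L} \<times> U)"
    have w: "w yj \<in> span ?S" if "yj \<in> Y \<times> {..L}" for yj
    proof -
      from that obtain y j where yj: "yj = (y, j)" "y \<in> Y" "j \<le> L" by auto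
      have "ev x (monom 1 j) * (c ^ K * (B * y)) \<in> ladder x U (N0 + L)"
        using yj by (intro ladder_mult_ev N0) (auto simp: degree_monom_eq)
      thus ?thesis by (simp add: yj w_def ladder_def)
    qed
    have "card ?S \<le> (N0 + L + 1) * card U" using card_ladder_generators[OF U(1)] by blast
    also have "\<dots> < (card U + 1) * (L + 1)" by (simp add: L_def algebra_simps)
    also have "\<dots> \<le> card Y * (L + 1)" using big by (intro mult_right_mono) auto
    also have "\<dots> = card (Y \<times> {..L})" by (simp add: card_cartesian_product)
    finally have less: "card ?S < card (Y \<times> {..L})" .
  have fin: "finite (Y \<times> {..L})" "finite ?S" using U(1) Y(1) by auto
  have "\<exists>g. (\<exists>i\<in>Y \<times> {..L}. g i \<noteq> 0) \<and> (\<Sum>i\<in>Y \<times> {..L}. \<iota> (g i) * w i) = 0"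
    by (rule linear_relation_if_card_less[OF fin _ less]) (rule w)
  then obtain g where g: "\<exists>yj\<in>Y \<times> {..L}. g yj \<noteq> 0" "(\<Sum>yj\<in>Y \<times> {..L}. \<iota> (g yj) * w yj) = 0"
    by blast
    define p where "p y = (\<Sum>j\<le>L. monom (g (y, j)) j)" for y
    have "c ^ K * B * (\<Sum>y\<in>Y. ev x (p y) * y) = (\<Sum>yj\<in>Y \<times> {..L}. \<iota> (g yj) * w yj)"
      by (simp add: sum.cartesian_product' w_def p_def sum_distrib_left sum_distrib_right
          ring_hom_map_sum[OF ev_hom] mult_ac)
    hence "(\<Sum>y\<in>Y. ev x (p y) * y) = 0" using g(2) B c by simp
    hence p0: "p y = 0" if "y \<in> Y" for y using Y(2) that unfolding poly_independent_def by auto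
    obtain y j where yj: "y \<in> Y" "j \<le> L" "g (y, j) \<noteq> 0" using g(1) by auto
    have "coeff (p y) j = g (y, j)" using yj by (simp add: p_def coeff_sum if_distrib cong: if_cong)
    thus False using yj p0 by auto
  qed
  thus ?thesis by blast
qed

end

section \<open>Discrete valuations and approximation\<close>

text \<open>
  A function field of one variable over a finite field with a set \<open>\<V>\<close> of normalized discrete
  valuations, one for each closed point. The last assumption expresses that the curve is complete. A valuation
  is a function on the whole field, and its value at \<open>0\<close> is arbitrary; the assumption
  \<open>val_eqI\<close> prevents two members from differing only there.
\<close>

locale function_field_places = const_embedding \<iota> for \<iota> :: "'a::{field,finite} \<Rightarrow> 'k::field" +
  fixes \<V> :: "('k \<Rightarrow> int) set"
  assumes algebraic_dependence: "algebraic_over_gen \<iota> a b"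
    and finitely_generated:
      "\<exists>Z. finite Z \<and> (\<forall>h. \<exists>a\<in>generated_algebra Z. \<exists>b\<in>generated_algebra Z. b \<noteq> 0 \<and> h = a / b)"
    and val_mult: "v \<in> \<V> \<Longrightarrow> a \<noteq> 0 \<Longrightarrow> b \<noteq> 0 \<Longrightarrow> v (a * b) = v a + v b"
    and val_add: "v \<in> \<V> \<Longrightarrow> a \<noteq> 0 \<Longrightarrow> b \<noteq> 0 \<Longrightarrow> a + b \<noteq> 0 \<Longrightarrow> min (v a) (v b) \<le> v (a + b)"
    and val_const: "v \<in> \<V> \<Longrightarrow> c \<noteq> 0 \<Longrightarrow> v (\<iota> c) = 0"
    and val_uniformizer: "v \<in> \<V> \<Longrightarrow> \<exists>t. t \<noteq> 0 \<and> v t = 1"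
    and val_eqI: "v \<in> \<V> \<Longrightarrow> u \<in> \<V> \<Longrightarrow> (\<And>f. f \<noteq> 0 \<Longrightarrow> v f = u f) \<Longrightarrow> v = u"
    and regular_everywhere: "f \<noteq> 0 \<Longrightarrow> (\<And>v. v \<in> \<V> \<Longrightarrow> 0 \<le> v f) \<Longrightarrow> \<not> transcendental_over \<iota> f"
begin

lemma val_1 [simp]: "v \<in> \<V> \<Longrightarrow> v 1 = 0"
  using val_const[of v 1] by simp

lemma val_minus [simp]: assumes "v \<in> \<V>" shows "v (- a) = v a"
proof (cases "a = 0")
  case False
  have "v (\<iota> (-1) * a) = v a" using val_mult[OF assms, of "\<iota> (-1)" a] val_const[OF assms, of "-1"] False by simp
  thus ?thesis by simp
qed auto

lemma val_inverse: "v \<in> \<V> \<Longrightarrow> a \<noteq> 0 \<Longrightarrow> v (inverse a) = - v a"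
  using val_mult[of v a "inverse a"] by simp

lemma val_divide: "v \<in> \<V> \<Longrightarrow> a \<noteq> 0 \<Longrightarrow> b \<noteq> 0 \<Longrightarrow> v (a / b) = v a - v b"
  by (simp add: field_class.field_divide_inverse val_mult val_inverse)

lemma val_power: "v \<in> \<V> \<Longrightarrow> a \<noteq> 0 \<Longrightarrow> v (a ^ n) = int n * v a"
  by (induction n) (auto simp: val_mult algebra_simps)

text \<open>
  The order of \<open>f\<close> is at least \<open>n\<close>, where \<open>0\<close> has infinite order.
\<close>

definition vge :: "('k \<Rightarrow> int) \<Rightarrow> int \<Rightarrow> 'k \<Rightarrow> bool" where
  "vge v n f \<longleftrightarrow> f = 0 \<or> n \<le> v f"

lemma vge_0 [simp]: "vge v n 0" by (simp add: vge_def)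

lemma vge_mono: "vge v n f \<Longrightarrow> k \<le> n \<Longrightarrow> vge v k f" by (auto simp: vge_def)

lemma vge_self [simp]: "vge v (v f) f" by (simp add: vge_def)

lemma vge_add: "v \<in> \<V> \<Longrightarrow> vge v n a \<Longrightarrow> vge v n b \<Longrightarrow> vge v n (a + b)"
  using val_add[of v a b] unfolding vge_def by (cases "a = 0"; cases "b = 0"; cases "a + b = 0") auto

lemma vge_minus: "v \<in> \<V> \<Longrightarrow> vge v n (- a) = vge v n a"
  by (simp add: vge_def)

lemma vge_diff: "v \<in> \<V> \<Longrightarrow> vge v n a \<Longrightarrow> vge v n b \<Longrightarrow> vge v n (a - b)"
  using vge_add[of v n a "- b"] by (simp add: vge_minus)

lemma vge_mult: "v \<in> \<V> \<Longrightarrow> vge v n a \<Longrightarrow> vge v k b \<Longrightarrow> vge v (n + k) (a * b)"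
  by (cases "a = 0"; cases "b = 0") (auto simp: vge_def val_mult)

lemma vge_const: "v \<in> \<V> \<Longrightarrow> vge v 0 (\<iota> c)"
  by (cases "c = 0") (auto simp: vge_def val_const)

lemma vge_scale: "v \<in> \<V> \<Longrightarrow> vge v n a \<Longrightarrow> vge v n (\<iota> c * a)"
  using vge_mult[of v 0 "\<iota> c" n a] vge_const by simp

lemma vge_sum: "v \<in> \<V> \<Longrightarrow> (\<And>i. i \<in> I \<Longrightarrow> vge v n (f i)) \<Longrightarrow> vge v n (sum f I)"
  by (induction I rule: infinite_finite_induct) (auto intro: vge_add)

lemma vge_0_mult: "v \<in> \<V> \<Longrightarrow> vge v 0 a \<Longrightarrow> vge v 0 b \<Longrightarrow> vge v 0 (a * b)"
  using vge_mult[of v 0 a 0 b] by simp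

lemma vge_mult_cancel: "v \<in> \<V> \<Longrightarrow> a \<noteq> 0 \<Longrightarrow> vge v n (a * b) \<longleftrightarrow> vge v (n - v a) b"
  by (cases "b = 0") (auto simp: vge_def val_mult)

lemma val_add_eq:
  assumes v: "v \<in> \<V>" and a: "a \<noteq> 0" and b: "vge v (v a + 1) b"
  shows "a + b \<noteq> 0" "v (a + b) = v a"
proof -
  show nz: "a + b \<noteq> 0"
  proof
    assume "a + b = 0"
    hence "b = - a" by (simp add: eq_neg_iff_add_eq_0 add.commute)
    thus False using a b v by (auto simp: vge_def)
  qed
  have "v a \<le> v (a + b)" using vge_add[OF v, of "v a" a b] b vge_mono[OF b] nz by (auto simp: vge_def)
  moreover have "vge v (v (a + b)) a \<or> v (a + b) = v a"
  proof (rule ccontr)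
    assume *: "\<not> ?thesis"
    hence "v a < v (a + b)" using \<open>v a \<le> v (a + b)\<close> by simp
    hence "vge v (v a + 1) (a + b)" by (simp add: vge_def)
    from vge_diff[OF v this b] have "vge v (v a + 1) a" by simp
    thus False using a by (simp add: vge_def)
  qed
  ultimately show "v (a + b) = v a" using a by (auto simp: vge_def)
qed

text \<open>
  By the ultrametric inequality a single term of smallest order is not cancelled by the others.
\<close>

lemma isolated_term_vanishes:
  assumes v: "v \<in> \<V>" and I: "finite I" "j \<in> I" and w: "w j \<noteq> 0"
    and small: "\<And>i. i \<in> I \<Longrightarrow> i \<noteq> j \<Longrightarrow> c i = 0 \<or> vge v (v (w j) + 1) (w i)"
    and sum: "vge v (v (w j) + 1) (\<Sum>i\<in>I. \<iota> (c i) * w i)"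
  shows "c j = 0"
proof (rule ccontr)
  assume cj: "c j \<noteq> 0"
  have "(\<Sum>i\<in>I. \<iota> (c i) * w i) = \<iota> (c j) * w j + (\<Sum>i\<in>I - {j}. \<iota> (c i) * w i)"
    by (rule sum.remove[OF I])
  moreover have "vge v (v (w j) + 1) (\<Sum>i\<in>I - {j}. \<iota> (c i) * w i)"
  proof (intro vge_sum v)
    fix i assume "i \<in> I - {j}"
    thus "vge v (v (w j) + 1) (\<iota> (c i) * w i)" using small[of i] vge_scale[OF v] by auto
  qed
  ultimately have "vge v (v (w j) + 1) (\<iota> (c j) * w j)"
    using vge_diff[OF v sum, of "\<Sum>i\<in>I - {j}. \<iota> (c i) * w i"] by simp
  moreover have "v (\<iota> (c j) * w j) = v (w j)" using v cj w by (simp add: val_mult val_const)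
  ultimately show False using cj w by (simp add: vge_def)
qed

lemma transcendental_if_val_neg:
  assumes v: "v \<in> \<V>" and g: "v g < 0"  "g \<noteq> 0"
  shows "transcendental_over \<iota> g"
  unfolding transcendental_iff
proof (intro allI impI, rule ccontr)
  fix p assume p: "ev g p = 0" "p \<noteq> 0"
  define d where "d = degree p"
  have sum: "(\<Sum>i\<in>{..d}. \<iota> (coeff p i) * g ^ i) = 0" using p ev_altdef[of p d g] by (simp add: d_def)
  have "coeff p d = 0"
  proof (rule isolated_term_vanishes[OF v, where w = "\<lambda>i. g ^ i" and I = "{..d}"])
    fix i assume "i \<in> {..d}" "i \<noteq> d"
    hence "int i + 1 \<le> int d" by auto
    hence "int d * v g \<le> (int i + 1) * v g" using g by (intro mult_right_mono_neg) auto
    hence "int d * v g + 1 \<le> int i * v g" using g by (simp add: algebra_simps)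
    thus "coeff p i = 0 \<or> vge v (v (g ^ d) + 1) (g ^ i)" using g v by (simp add: vge_def val_power)
  qed (use g sum in auto)
  thus False using p by (simp add: d_def)
qed

lemma transcendental_if_val_pos:
  assumes v: "v \<in> \<V>" and g: "v g > 0"  "g \<noteq> 0"
  shows "transcendental_over \<iota> g"
  unfolding transcendental_iff
proof (intro allI impI, rule ccontr)
  fix p assume p: "ev g p = 0" "p \<noteq> 0"
  define d where "d = degree p"
  have sum: "(\<Sum>i\<in>{..d}. \<iota> (coeff p i) * g ^ i) = 0" using p ev_altdef[of p d g] by (simp add: d_def)
  define k where "k = (LEAST i. coeff p i \<noteq> 0)"
  have k: "coeff p k \<noteq> 0" unfolding k_def by (rule LeastI[of _ d]) (use p in \<open>auto simp: d_def\<close>)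
  have less: "coeff p i = 0" if "i < k" for i using not_less_Least[of i "\<lambda>i. coeff p i \<noteq> 0"] that by (auto simp: k_def)
  have "coeff p k = 0"
  proof (rule isolated_term_vanishes[OF v, where w = "\<lambda>i. g ^ i" and I = "{..d}"])
    show "k \<in> {..d}" using k by (auto simp: d_def le_degree)
    fix i assume "i \<in> {..d}" "i \<noteq> k"
    hence "coeff p i = 0 \<or> int k + 1 \<le> int i" using less[of i] by fastforce
    moreover have "int k * v g + 1 \<le> int i * v g" if "int k + 1 \<le> int i"
      using mult_right_mono[OF that, of "v g"] g by (simp add: algebra_simps)
    ultimately show "coeff p i = 0 \<or> vge v (v (g ^ k) + 1) (g ^ i)" using g v by (auto simp: vge_def val_power)
  qed (use g sum in auto)
  thus False using k by simp
qed

text \<open>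
  A discrete valuation ring is a maximal proper subring: if the ring of \<open>v\<close> were contained in
  that of \<open>u\<close>, units of \<open>v\<close> would be units of \<open>u\<close>, so \<open>u\<close>
  would be a multiple of \<open>v\<close>, and normalization would force equality.
\<close>

lemma val_separate:
  assumes v: "v \<in> \<V>" and u: "u \<in> \<V>" and ne: "v \<noteq> u"
  shows "\<exists>a. a \<noteq> 0 \<and> 0 \<le> v a \<and> u a < 0"
proof (rule ccontr)
  assume "\<not> ?thesis"
  hence sub: "0 \<le> u a" if "0 \<le> v a" "a \<noteq> 0" for a using that by force
  have unit: "u a = 0" if "v a = 0" "a \<noteq> 0" for a
    using sub[of a] sub[of "inverse a"] that v u by (simp add: val_inverse)
  obtain t where t: "t \<noteq> 0" "v t = 1" using val_uniformizer[OF v] by blast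
  obtain s where s: "s \<noteq> 0" "u s = 1" using val_uniformizer[OF u] by blast
  have nonneg: "u f = v f * u t" if f: "f \<noteq> 0" "v f \<ge> 0" for f
  proof -
    have "v (f / t ^ nat (v f)) = 0" using f t v by (simp add: val_divide val_power)
    hence "u (f / t ^ nat (v f)) = 0" using unit f t by simp
    thus ?thesis using f t u by (simp add: val_divide val_power)
  qed
  have eq: "u f = v f * u t" if f: "f \<noteq> 0" for f
  proof (cases "v f \<ge> 0")
    case False
    thus ?thesis using nonneg[of "inverse f"] f v u by (simp add: val_inverse)
  qed (use nonneg f in auto)
  have "v s * u t = 1" using eq[of s] s by simp
  hence "u t = 1" using sub[of t] t by (simp add: zmult_eq_1_iff)
  hence "v = u" using eq by (intro val_eqI v u) auto
  thus False using ne by simp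
qed

lemma val_separate_strict:
  assumes v: "v \<in> \<V>" and u: "u \<in> \<V>" and ne: "v \<noteq> u"
  shows "\<exists>a. a \<noteq> 0 \<and> 0 < v a \<and> u a < 0"
proof -
  obtain a where a: "a \<noteq> 0" "0 \<le> v a" "u a < 0" using val_separate[OF v u ne] by blast
  obtain b where b: "b \<noteq> 0" "0 \<le> u b" "v b < 0" using val_separate[OF u v] ne by blast
  show ?thesis using a b v u by (intro exI[of _ "a / b"]) (auto simp: val_divide)
qed

text \<open>
  By induction on \<open>V\<close>: if \<open>z\<close> serves \<open>V\<close> but has no pole at the new
  valuation \<open>u\<close>, add to a high power of \<open>z\<close> an element with a zero at
  \<open>v\<close> and a pole at \<open>u\<close>. The power dominates at \<open>V\<close>, the added element
  at \<open>u\<close>.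
\<close>

lemma val_isolate:
  assumes "finite V" "V \<subseteq> \<V>" and v: "v \<in> \<V>" "v \<notin> V"
  shows "\<exists>z. z \<noteq> 0 \<and> 0 < v z \<and> (\<forall>u\<in>V. u z < 0)"
  using assms
proof (induction V rule: finite_induct)
  case empty
  thus ?case using val_uniformizer[OF v(1)] by force
next
  case (insert u V)
  then obtain z where z: "z \<noteq> 0" "0 < v z" "\<And>w. w \<in> V \<Longrightarrow> w z < 0" by auto
  have uV: "u \<in> \<V>" "u \<noteq> v" and sub: "V \<subseteq> \<V>" using insert.prems by auto
  show ?case
  proof (cases "u z < 0")
    case True
    thus ?thesis using z by auto
  next
    case False
    obtain a where a: "a \<noteq> 0" "0 < v a" "u a < 0" using val_separate_strict[OF v(1) uV(1)] uV(2) by metis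
    \<comment> \<open>large enough for \<open>z ^ r\<close> to dominate \<open>a\<close> at all of \<open>V\<close>\<close>
    define r where "r = Suc (nat (\<Sum>w\<in>V. \<bar>w a\<bar>))"
    have nz: "z ^ r \<noteq> 0" using z by simp
    have w: "z ^ r + a \<noteq> 0 \<and> w (z ^ r + a) < 0" if "w \<in> V" for w
    proof -
      have "\<bar>w a\<bar> \<le> (\<Sum>w\<in>V. \<bar>w a\<bar>)" using that insert.hyps(1) by (intro member_le_sum) auto
      moreover have "int r * w z \<le> - int r"
        using mult_left_mono[of "w z" "-1" "int r"] z(3)[OF that] by simp
      moreover have "w (z ^ r) = int r * w z" using that sub z(1) by (intro val_power) auto
      moreover have "int r = 1 + (\<Sum>w\<in>V. \<bar>w a\<bar>)" by (simp add: r_def sum_nonneg)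
      ultimately have "w (z ^ r) + 1 \<le> w a" "w (z ^ r) < 0" by linarith+
      thus ?thesis using val_add_eq[of w "z ^ r" a] that sub nz by (auto simp: vge_def)
    qed
    have "0 \<le> u (z ^ r)" using False z uV by (simp add: val_power)
    hence "vge u (u a + 1) (z ^ r)" using a by (simp add: vge_def)
    from val_add_eq[OF uV(1) a(1) this] have u: "z ^ r + a \<noteq> 0" "u (z ^ r + a) < 0"
      using a by (auto simp: add.commute)
    have "r > 0" by (simp add: r_def)
    hence "0 < v (z ^ r)" using z v by (simp add: val_power)
    hence "vge v 1 (z ^ r + a)" using a by (intro vge_add v) (auto simp: vge_def)
    hence "0 < v (z ^ r + a)" using u by (auto simp: vge_def)
    thus ?thesis using u w by (intro exI[of _ "z ^ r + a"]) auto
  qed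
qed

text \<open>
  Weak approximation, in the form needed later. If \<open>z\<close> has a zero at \<open>v\<close> and poles
  at the other valuations, then \<open>1 / (1 + z\<^sup>n)\<close> is a unit at \<open>v\<close> with high
  zeros elsewhere.
\<close>

lemma approximate_idempotent:
  assumes V: "finite V" "V \<subseteq> \<V>" and v: "v \<in> V"
  shows "\<exists>e. e \<noteq> 0 \<and> v e = 0 \<and> (\<forall>u\<in>V - {v}. int N \<le> u e)"
proof -
  have vV: "v \<in> \<V>" using assms by auto
  obtain z where z: "z \<noteq> 0" "0 < v z" "\<And>u. u \<in> V - {v} \<Longrightarrow> u z < 0"
    using val_isolate[of "V - {v}" v] assms by blast
  define n where "n = Suc N"
  have v1: "1 + z ^ n \<noteq> 0" "v (1 + z ^ n) = 0"
  proof -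
    have "1 * 1 \<le> int n * v z" using z(2) by (intro mult_mono) (auto simp: n_def)
    hence "vge v (v 1 + 1) (z ^ n)" using z vV by (simp add: vge_def val_power)
    from val_add_eq[OF vV _ this] show "1 + z ^ n \<noteq> 0" "v (1 + z ^ n) = 0" using vV by auto
  qed
  have "int N \<le> u (inverse (1 + z ^ n))" if u: "u \<in> V - {v}" for u
  proof -
    have uV: "u \<in> \<V>" using u V by auto
    have le: "int n * u z \<le> - int n"
      using mult_left_mono[of "u z" "-1" "int n"] z(3)[OF u] by simp
    have "n > 0" by (simp add: n_def)
    hence "vge u (u (z ^ n) + 1) 1" using le z uV by (auto simp: vge_def val_power)
    from val_add_eq(2)[OF uV _ this] have "u (1 + z ^ n) = int n * u z"
      using z uV by (simp add: add.commute val_power)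
    thus ?thesis using le v1 uV by (simp add: val_inverse n_def)
  qed
  thus ?thesis using v1 vV by (intro exI[of _ "inverse (1 + z ^ n)"]) (auto simp: val_inverse)
qed

text \<open>
  In a relation over \<open>\<bbbF>[x]\<close>, divide by the highest power of \<open>x\<close> that occurs:
  modulo \<open>1 / x\<close> only the top coefficients survive, so they form a relation with constant
  coefficients, and independence modulo \<open>1 / x\<close> makes all of them zero.
\<close>

lemma poly_independent_if_independent_mod_pole:
  assumes I: "finite I" and V: "V \<subseteq> \<V>" and x: "\<And>v. v \<in> V \<Longrightarrow> v x < 0" "x \<noteq> 0"
    and reg: "\<And>i v. i \<in> I \<Longrightarrow> v \<in> V \<Longrightarrow> vge v 0 (w i)"
    and ind: "\<And>c. (\<And>v. v \<in> V \<Longrightarrow> vge v (- v x) (\<Sum>i\<in>I. \<iota> (c i) * w i)) \<Longrightarrow> \<forall>i\<in>I. c i = 0"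
  shows "poly_independent x I w"
  unfolding poly_independent_def
proof (intro allI impI)
  fix p assume rel: "(\<Sum>i\<in>I. ev x (p i) * w i) = 0"
  define N where "N = Max (insert 0 ((\<lambda>i. degree (p i)) ` I))"
  have deg: "degree (p i) \<le> N" if "i \<in> I" for i using that I by (auto simp: N_def)
  define q where "q i = (\<Sum>k<N. \<iota> (coeff (p i) k) * x ^ k)" for i
  define y where "y = (\<Sum>i\<in>I. \<iota> (coeff (p i) N) * w i)"
  have evq: "ev x (p i) = q i + \<iota> (coeff (p i) N) * x ^ N" if "i \<in> I" for i
    using ev_altdef[OF deg[OF that], of x] by (simp add: q_def lessThan_Suc_atMost[symmetric])
  have "0 = (\<Sum>i\<in>I. (q i + \<iota> (coeff (p i) N) * x ^ N) * w i)"
    unfolding rel[symmetric] by (rule sum.cong) (simp_all add: evq)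
  also have "\<dots> = (\<Sum>i\<in>I. q i * w i) + x ^ N * y"
    by (simp add: y_def algebra_simps sum.distrib sum_distrib_left)
  finally have y: "x ^ N * y = - (\<Sum>i\<in>I. q i * w i)"
    by (metis add.commute add_eq_0_iff)
  have "\<forall>i\<in>I. coeff (p i) N = 0"
  proof (rule ind)
    fix v assume v: "v \<in> V"
    hence vV: "v \<in> \<V>" using V by auto
    have "vge v ((int N - 1) * v x + 0) (q i * w i)" if i: "i \<in> I" for i
    proof (intro vge_mult vV reg[OF i v], unfold q_def, intro vge_sum vge_scale vV)
      fix k assume "k \<in> {..<N}"
      hence "int k \<le> int N - 1" by auto
      hence "(int N - 1) * v x \<le> int k * v x" using x(1)[OF v] by (intro mult_right_mono_neg) auto
      thus "vge v ((int N - 1) * v x) (x ^ k)" using x(2) vV by (simp add: vge_def val_power)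
    qed
    hence "vge v ((int N - 1) * v x) (x ^ N * y)" unfolding y by (simp add: vge_minus vV vge_sum)
    hence "vge v ((int N - 1) * v x - int N * v x) y"
      using x(2) vV by (simp add: vge_mult_cancel val_power)
    thus "vge v (- v x) (\<Sum>i\<in>I. \<iota> (coeff (p i) N) * w i)"
      unfolding y_def by (simp add: left_diff_distrib)
  qed
  hence *: "coeff (p i) N = 0" if "i \<in> I" for i using that by blast
  show "\<forall>i\<in>I. p i = 0"
  proof (cases "N = 0")
    case True
    show ?thesis
    proof
      fix i assume "i \<in> I"
      hence "degree (p i) = 0" "coeff (p i) 0 = 0" using deg[of i] *[of i] True by auto
      thus "p i = 0" by (metis leading_coeff_0_iff)
    qed
  next
    case False
    have "N \<in> insert 0 ((\<lambda>i. degree (p i)) ` I)" unfolding N_def by (rule Max_in) (use I in auto)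
    then obtain i where i: "i \<in> I" "degree (p i) = N" using False by auto
    hence "coeff (p i) (degree (p i)) = 0" using * by simp
    hence "p i = 0" by (simp only: leading_coeff_0_iff)
    thus ?thesis using i False by simp
  qed
qed

lemma poly_independent_image:
  assumes I: "finite I" and w: "poly_independent x I w"
  shows "inj_on w I" "poly_independent x (w ` I) (\<lambda>y. y)"
proof -
  show inj: "inj_on w I"
  proof (rule inj_onI, rule ccontr)
    fix i j assume ij: "i \<in> I" "j \<in> I" "w i = w j" "i \<noteq> j"
    define p :: "_ \<Rightarrow> 'a poly" where "p k = (if k = i then 1 else if k = j then -1 else 0)" for k
    have "(\<Sum>k\<in>I. ev x (p k) * w k) = (\<Sum>k\<in>{i,j}. ev x (p k) * w k)"
      using I ij by (intro sum.mono_neutral_right) (auto simp: p_def)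
    also have "\<dots> = 0" using ij by (simp add: p_def)
    finally have "p i = 0" using w ij unfolding poly_independent_def by blast
    thus False by (simp add: p_def)
  qed
  show "poly_independent x (w ` I) (\<lambda>y. y)"
    unfolding poly_independent_def
  proof (intro allI impI)
    fix p assume "(\<Sum>y\<in>w ` I. ev x (p y) * y) = 0"
    hence "(\<Sum>i\<in>I. ev x (p (w i)) * w i) = 0" by (simp add: sum.reindex[OF inj])
    hence "\<forall>i\<in>I. p (w i) = 0" using w[unfolded poly_independent_def, rule_format, of "\<lambda>i. p (w i)"] by blast
    thus "\<forall>y\<in>w ` I. p y = 0" by simp
  qed
qed

text \<open>
  The set \<open>Y\<close> is a basis of the function field over \<open>\<bbbF>(x)\<close>; the bound is
  stated for families over any index type, as it will be applied to disjoint unions.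
\<close>

lemma maximal_poly_independent_set:
  assumes x: "transcendental_over \<iota> x"
  obtains Y where "finite Y" "poly_independent x Y (\<lambda>y. y)"
    "\<And>(I :: 'i set) w. finite I \<Longrightarrow> poly_independent x I w \<Longrightarrow> card I \<le> card Y"
proof -
  obtain Z where "finite Z" "\<And>h. \<exists>a\<in>generated_algebra Z. \<exists>b\<in>generated_algebra Z. b \<noteq> 0 \<and> h = a / b"
    using finitely_generated by blast
  from rank_bound[OF x algebraic_dependence this]
  obtain n where n: "card Y \<le> n" if "finite Y \<and> poly_independent x Y (\<lambda>y. y)" for Y by blast
  define P where "P k \<longleftrightarrow> (\<exists>Y. finite Y \<and> poly_independent x Y (\<lambda>y. y) \<and> card Y = k)" for k
  have "P 0" unfolding P_def by (rule exI[of _ "{}"]) (auto simp: poly_independent_def)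
  hence "P (Greatest P)" by (rule GreatestI_nat[where b = n]) (use n in \<open>auto simp: P_def\<close>)
  then obtain Y where Y: "finite Y" "poly_independent x Y (\<lambda>y. y)" "card Y = Greatest P" by (auto simp: P_def)
  have "card I \<le> card Y" if "finite I" "poly_independent x I w" for I :: "'i set" and w
  proof -
    note im = poly_independent_image[OF that]
    have "P (card I)" unfolding P_def using im that(1) card_image[OF im(1)] by blast
    thus ?thesis unfolding Y(3) by (rule Greatest_le_nat[where b = n]) (use n in \<open>auto simp: P_def\<close>)
  qed
  thus thesis using that Y by blast
qed

text \<open>
  Approximate idempotents at distinct poles of \<open>x\<close> are independent over
  \<open>\<bbbF>(x)\<close>, so the number of poles is at most the degree of the field over
  \<open>\<bbbF>(x)\<close>.
\<close>

lemma finite_poles: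
  assumes x: "x \<noteq> 0"
  shows "finite {v \<in> \<V>. v x < 0}"
proof (cases "\<exists>v\<in>\<V>. v x < 0")
  case True
  hence "transcendental_over \<iota> x" using transcendental_if_val_neg x by blast
  then obtain Y where Y: "finite Y" "poly_independent x Y (\<lambda>y. y)"
    "\<And>(I :: ('k \<Rightarrow> int) set) w. finite I \<Longrightarrow> poly_independent x I w \<Longrightarrow> card I \<le> card Y"
    using maximal_poly_independent_set[where ?'i = "'k \<Rightarrow> int"] by metis
  have bound: "card V \<le> card Y" if V: "finite V" "V \<subseteq> {v \<in> \<V>. v x < 0}" for V
  proof -
    define N where "N = nat (\<Sum>v\<in>V. \<bar>v x\<bar>)"
    have N: "- v x \<le> int N" if "v \<in> V" for v
    proof -
      have "\<bar>v x\<bar> \<le> (\<Sum>v\<in>V. \<bar>v x\<bar>)" using that V(1) by (intro member_le_sum) auto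
      thus ?thesis by (simp add: N_def)
    qed
    have VV: "V \<subseteq> \<V>" using V by auto
    have "\<forall>v\<in>V. \<exists>e. e \<noteq> 0 \<and> v e = 0 \<and> (\<forall>u\<in>V - {v}. int N \<le> u e)"
      using approximate_idempotent[OF V(1) VV] by blast
    then obtain e where e: "\<And>v. v \<in> V \<Longrightarrow> e v \<noteq> 0" "\<And>v. v \<in> V \<Longrightarrow> v (e v) = 0"
      "\<And>u v. v \<in> V \<Longrightarrow> u \<in> V \<Longrightarrow> u \<noteq> v \<Longrightarrow> int N \<le> u (e v)" by (metis insert_Diff insert_iff)
    have reg: "vge u 0 (e v)" if "v \<in> V" "u \<in> V" for u v
      using e(2)[of v] e(3)[of v u] that by (cases "u = v") (auto simp: vge_def)
    have "poly_independent x V e"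
    proof (rule poly_independent_if_independent_mod_pole[OF V(1) VV _ x reg])
      fix c assume c: "\<And>v. v \<in> V \<Longrightarrow> vge v (- v x) (\<Sum>i\<in>V. \<iota> (c i) * e i)"
      show "\<forall>v\<in>V. c v = 0"
      proof
        fix v assume v: "v \<in> V"
        hence vV: "v \<in> \<V>" "v x < 0" using V by auto
        show "c v = 0"
        proof (rule isolated_term_vanishes[OF vV(1) V(1) v, where w = e])
          show "vge v (v (e v) + 1) (\<Sum>i\<in>V. \<iota> (c i) * e i)"
            using vge_mono[OF c[OF v]] e(2)[OF v] vV by simp
          fix u assume "u \<in> V" "u \<noteq> v"
          thus "c u = 0 \<or> vge v (v (e v) + 1) (e u)"
            using e(2)[OF v] e(3)[of u v] v N[OF v] vV by (auto simp: vge_def)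
        qed (use e v in auto)
      qed
    qed (use V in auto)
    thus ?thesis using Y V by blast
  qed
  show ?thesis
  proof (rule ccontr)
    assume "infinite {v \<in> \<V>. v x < 0}"
    then obtain V where "finite V" "card V = Suc (card Y)" "V \<subseteq> {v \<in> \<V>. v x < 0}"
      using infinite_arbitrarily_large by blast
    thus False using bound[of V] by simp
  qed
next
  case False
  hence "{v \<in> \<V>. v x < 0} = {}" by auto
  thus ?thesis by (simp only: finite.emptyI)
qed

lemma finite_support_val: "x \<noteq> 0 \<Longrightarrow> finite {v \<in> \<V>. v x \<noteq> 0}"
proof -
  assume x: "x \<noteq> 0"
  have "{v \<in> \<V>. v x \<noteq> 0} \<subseteq> {v \<in> \<V>. v x < 0} \<union> {v \<in> \<V>. v (inverse x) < 0}"
    using x by (auto simp: val_inverse)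
  thus ?thesis using finite_poles[OF x] finite_poles[of "inverse x"] x by (meson finite_Un finite_subset nonzero_imp_inverse_nonzero)
qed

end

section \<open>Spaces of sections\<close>

context const_embedding begin

text \<open>
  The Riemann-Roch spaces live in an infinite-dimensional space, where \<open>dim\<close> is monotone only on
  subsets of the span of a finite set.
\<close>

definition finite_span :: "'k set \<Rightarrow> bool" where
  "finite_span V \<longleftrightarrow> (\<exists>S. finite S \<and> V \<subseteq> span S)"

lemma finite_span_basis:
  assumes "finite_span V"
  obtains B where "B \<subseteq> V" "\<not> dependent B" "V \<subseteq> span B" "card B = dim V" "finite B"
proof -
  obtain B where B: "B \<subseteq> V" "\<not> dependent B" "V \<subseteq> span B" "card B = dim V" by (rule basis_exists)
  obtain S where S: "finite S" "V \<subseteq> span S" using assms by (auto simp: finite_span_def)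
  have "finite B" using independent_span_bound[OF S(1) B(2)] B(1) S(2) by auto
  thus thesis using that B by blast
qed

lemma finite_span_subset: "finite_span W \<Longrightarrow> V \<subseteq> W \<Longrightarrow> finite_span V"
  unfolding finite_span_def by blast

lemma dim_mono: assumes "finite_span W" "V \<subseteq> W" shows "dim V \<le> dim W"
proof -
  obtain B where B: "W \<subseteq> span B" "card B = dim W" "finite B"
    using finite_span_basis[OF assms(1)] by metis
  thus ?thesis using dim_le_card[of V B] assms(2) by auto
qed

lemma dim_le_dim_plus_card:
  assumes "finite_span V" "finite S" "W \<subseteq> span (V \<union> S)"
  shows "finite_span W" "dim W \<le> dim V + card S"
proof -
  obtain B where B: "V \<subseteq> span B" "card B = dim V" "finite B"
    using finite_span_basis[OF assms(1)] by metis
  have "V \<union> S \<subseteq> span (B \<union> S)"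
    using B(1) span_mono[of B "B \<union> S"] span_superset[of "B \<union> S"] by auto
  hence "span (V \<union> S) \<subseteq> span (B \<union> S)" by (rule span_minimal[OF _ subspace_span])
  hence W: "W \<subseteq> span (B \<union> S)" using assms(3) by blast
  thus "finite_span W" using B(3) assms(2) by (auto simp: finite_span_def)
  show "dim W \<le> dim V + card S"
    using dim_le_card[OF W] B assms(2) card_Un_le[of B S] by simp
qed

lemma complement_independent:
  assumes B: "\<not> dependent B" "B' \<subseteq> B" and W: "finite W" "W \<subseteq> B - B'"
    and sum: "(\<Sum>f\<in>W. \<iota> (c f) * f) \<in> span B'" and f: "f \<in> W"
  shows "c f = 0"
proof (rule ccontr)
  assume cf: "c f \<noteq> 0"
  let ?S = "span (B - {f})"
  have "\<iota> (c f) * f = (\<Sum>f\<in>W. \<iota> (c f) * f) - (\<Sum>g\<in>W - {f}. \<iota> (c g) * g)"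
    using sum.remove[OF W(1) f, of "\<lambda>f. \<iota> (c f) * f"] by (simp add: algebra_simps)
  also have "\<dots> \<in> ?S"
  proof (rule span_diff)
    have "B' \<subseteq> B - {f}" using f W(2) B(2) by auto
    thus "(\<Sum>f\<in>W. \<iota> (c f) * f) \<in> ?S" using sum span_mono by blast
    show "(\<Sum>g\<in>W - {f}. \<iota> (c g) * g) \<in> ?S"
      using W(2) by (intro span_sum span_scale span_base) auto
  qed
  finally have "\<iota> (inverse (c f)) * (\<iota> (c f) * f) \<in> ?S" by (rule span_scale)
  moreover have "\<iota> (inverse (c f)) * \<iota> (c f) = 1"
    using cf by (simp flip: iota_simps)
  ultimately have "f \<in> ?S" by (simp flip: mult.assoc)
  thus False using B(1) f W(2) unfolding dependent_def by blast
qed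

lemma relation_mod_subspace:
  assumes V: "finite_span V" "subspace V'" "V' \<subseteq> V" and w: "\<And>i. i \<in> {..<n} \<Longrightarrow> w i \<in> V" and n: "dim V < dim V' + n"
  shows "\<exists>g. (\<exists>i<n. g i \<noteq> 0) \<and> (\<Sum>i<n. \<iota> (g i) * w i) \<in> V'"
proof -
  obtain B where B: "B \<subseteq> V'" "\<not> dependent B" "V' \<subseteq> span B" "card B = dim V'" "finite B"
    using finite_span_basis[OF finite_span_subset[OF V(1,3)]] by metis
  obtain S where S: "V \<subseteq> span S" "card S = dim V" "finite S"
    using finite_span_basis[OF V(1)] by metis
  define u where "u = case_sum (\<lambda>b. b) w"
  have B_S: "b \<in> span S" if "b \<in> B" for b using that B(1) V(3) S(1) by blast
  have w_S: "w i \<in> span S" if "i < n" for i using w[of i] that S(1) by auto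
  have u: "u i \<in> span S" if "i \<in> B <+> {..<n}" for i
    using that B_S w_S by (auto simp: u_def)
  have card: "card S < card (B <+> {..<n})" using n B(4,5) S(2) by (simp add: card_Plus)
  have fin: "finite (B <+> {..<n})" using B(5) by simp
  have "\<exists>g. (\<exists>i\<in>B <+> {..<n}. g i \<noteq> 0) \<and> (\<Sum>i\<in>B <+> {..<n}. \<iota> (g i) * u i) = 0"
    by (rule linear_relation_if_card_less[OF fin S(3) _ card]) (rule u)
  then obtain g where g: "\<exists>i\<in>B <+> {..<n}. g i \<noteq> 0" "(\<Sum>i\<in>B <+> {..<n}. \<iota> (g i) * u i) = 0" by blast
  have sum: "(\<Sum>b\<in>B. \<iota> (g (Inl b)) * b) + (\<Sum>i<n. \<iota> (g (Inr i)) * w i) = 0"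
    using g(2) B(5) by (simp add: sum.Plus u_def)
  have "(\<Sum>b\<in>B. \<iota> (g (Inl b)) * b) \<in> V'"
    using B(1) by (intro subspace_sum[OF V(2)] subspace_scale[OF V(2)]) auto
  hence "- (\<Sum>b\<in>B. \<iota> (g (Inl b)) * b) \<in> V'" by (rule subspace_neg[OF V(2)])
  moreover have "(\<Sum>i<n. \<iota> (g (Inr i)) * w i) = - (\<Sum>b\<in>B. \<iota> (g (Inl b)) * b)"
    using sum by (simp add: eq_neg_iff_add_eq_0 add.commute)
  moreover have "\<exists>i<n. g (Inr i) \<noteq> 0"
  proof (rule ccontr)
    assume "\<not> ?thesis"
    hence 0: "g (Inr i) = 0" if "i < n" for i using that by blast
    hence "(\<Sum>b\<in>B. \<iota> (g (Inl b)) * b) = 0" using sum by simp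
    hence "g (Inl b) = 0" if "b \<in> B" for b
      using complement_independent[OF B(2), of "{}" B "\<lambda>b. g (Inl b)" b] B(5) that by simp
    thus False using g(1) 0 by auto
  qed
  ultimately show ?thesis by (intro exI[of _ "\<lambda>i. g (Inr i)"]) simp
qed

end

context function_field_places begin

text \<open>
  The space of \<open>f\<close> with \<open>div f + D \<ge> 0\<close>. A divisor is given by its
  multiplicities as a function on valuations.
\<close>

definition sections :: "(('k \<Rightarrow> int) \<Rightarrow> int) \<Rightarrow> 'k set" where
  "sections D = {f. \<forall>v\<in>\<V>. vge v (- D v) f}"

lemma subspace_sections: "subspace (sections D)"
  unfolding subspace_def sections_def by (auto intro: vge_add vge_scale)

lemma sections_mono: "(\<And>v. v \<in> \<V> \<Longrightarrow> D v \<le> D' v) \<Longrightarrow> sections D \<subseteq> sections D'"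
  unfolding sections_def using vge_mono by fastforce

lemma sections_cong: "(\<And>v. v \<in> \<V> \<Longrightarrow> D v = D' v) \<Longrightarrow> sections D = sections D'"
  unfolding sections_def by auto

lemma mult_sections_iff:
  assumes "f \<noteq> 0"
  shows "f * g \<in> sections D \<longleftrightarrow> g \<in> sections (\<lambda>v. D v + v f)"
  unfolding sections_def using assms by (auto simp: vge_mult_cancel)

lemma span_mult_image: "span ((\<lambda>g. f * g) ` S) = (\<lambda>g. f * g) ` span S"
proof -
  have l: "module_hom (\<lambda>c f. \<iota> c * f) (\<lambda>c f. \<iota> c * f) ((*) f)"
    by unfold_locales (auto simp: algebra_simps)
  show ?thesis using module_hom.span_image[OF l] by simp
qed

lemma dim_mult_image_le:
  assumes "finite_span V"
  shows "finite_span ((\<lambda>g. f * g) ` V) \<and> dim ((\<lambda>g. f * g) ` V) \<le> dim V"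
proof -
  obtain B where B: "V \<subseteq> span B" "card B = dim V" "finite B"
    using finite_span_basis[OF assms(1)] by metis
  hence sub: "(\<lambda>g. f * g) ` V \<subseteq> span ((\<lambda>g. f * g) ` B)" by (auto simp: span_mult_image)
  show ?thesis using dim_le_card[OF sub] sub B card_image_le[of B "(*) f"]
    by (auto simp: finite_span_def intro: order.trans)
qed

lemma dim_sections_translate_le:
  assumes f: "f \<noteq> 0" and fin: "finite_span (sections D)"
    and le: "\<And>v. v \<in> \<V> \<Longrightarrow> E v \<le> D v + v f"
  shows "dim (sections E) \<le> dim (sections D)"
proof -
  have "sections E \<subseteq> (\<lambda>g. inverse f * g) ` sections D"
  proof
    fix g assume "g \<in> sections E"
    hence "g \<in> sections (\<lambda>v. D v + v f)" using sections_mono[of E "\<lambda>v. D v + v f"] le by auto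
    hence "f * g \<in> sections D" using mult_sections_iff[OF f] by simp
    moreover have "g = inverse f * (f * g)" using f by simp
    ultimately show "g \<in> (\<lambda>g. inverse f * g) ` sections D" by blast
  qed
  thus ?thesis using dim_mult_image_le[OF fin, of "inverse f"] dim_mono by (meson order.trans)
qed

text \<open>
  Multiplying \<open>h\<close> by the leading coefficient \<open>g(x)\<close> of its equation over
  \<open>\<bbbF>[x]\<close> makes it integral: \<open>y = g(x) h\<close> satisfies a monic equation. At a
  place where \<open>x\<close> is regular a pole of \<open>y\<close> would make \<open>y\<^sup>d\<close> the
  dominant term; at a pole of \<open>x\<close> the same comparison bounds the pole of \<open>y\<close> by a
  multiple of that of \<open>x\<close>.
\<close>

lemma integral_multiple:
  assumes x: "transcendental_over \<iota> x"
  shows "\<exists>g N. g \<noteq> 0 \<and> (\<forall>v\<in>\<V>. if v x < 0 then vge v (int N * v x) (ev x g * h) else vge v 0 (ev x g * h))"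
proof -
  have x0: "x \<noteq> 0" by (rule transcendental_nonzero[OF x])
  obtain p where p: "p \<noteq> 0" "poly (map_poly (ev x) p) h = 0"
    using algebraic_dependence[of x h] by (auto simp: algebraic_over_gen_iff)
  define d where "d = degree p"
  define g where "g = coeff p d"
  have rel: "(\<Sum>i\<le>d. ev x (coeff p i) * h ^ i) = 0"
    using p(2) by (subst (asm) poly_map_poly_altdef[OF ev_hom, of p d]) (auto simp: d_def)
  have g0: "g \<noteq> 0" using p(1) by (simp add: g_def d_def)
  hence evg: "ev x g \<noteq> 0" using x unfolding transcendental_iff by blast
  have d0: "d > 0" using rel evg by (cases d) (auto simp: g_def)
  define a where "a i = coeff p i * g ^ (d - 1 - i)" for i
  define y where "y = ev x g * h"
  have y: "y ^ d = - (\<Sum>i<d. ev x (a i) * y ^ i)"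
  proof -
    have "(\<Sum>i<d. ev x (a i) * y ^ i) + y ^ d = ev x g ^ (d - 1) * (\<Sum>i\<le>d. ev x (coeff p i) * h ^ i)"
    proof -
      have "ev x (a i) * y ^ i = ev x g ^ (d - 1) * (ev x (coeff p i) * h ^ i)" if "i < d" for i
      proof -
        have "ev x g ^ (d - 1) = ev x g ^ (d - 1 - i) * ev x g ^ i"
          using that by (simp add: power_add[symmetric])
        thus ?thesis by (simp add: a_def y_def ring_hom_map_power[OF ev_hom] power_mult_distrib mult_ac)
      qed
      moreover have "y ^ d = ev x g ^ (d - 1) * (ev x (coeff p d) * h ^ d)"
        using d0 by (cases d) (auto simp: y_def g_def power_mult_distrib mult_ac)
      ultimately show ?thesis
        by (simp add: lessThan_Suc_atMost[symmetric] sum_distrib_left distrib_left)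
    qed
    thus ?thesis using rel by (simp add: eq_neg_iff_add_eq_0 add.commute)
  qed
  define N where "N = Max ((\<lambda>i. degree (a i)) ` {..<d})"
  have N: "degree (a i) \<le> N" if "i < d" for i using that by (auto simp: N_def)
  have no_pole: "vge v K y" if v: "v \<in> \<V>" and K: "K \<le> 0" and a: "\<And>i. i < d \<Longrightarrow> vge v K (ev x (a i))" for v K
  proof (rule ccontr)
    assume "\<not> vge v K y"
    hence yv: "y \<noteq> 0" "v y < K" by (auto simp: vge_def)
    have "vge v (K + (int d - 1) * v y) (\<Sum>i<d. ev x (a i) * y ^ i)"
    proof (intro vge_sum v vge_mult a)
      fix i assume "i \<in> {..<d}"
      hence "int i \<le> int d - 1" by auto
      hence "(int d - 1) * v y \<le> int i * v y" using yv K by (intro mult_right_mono_neg) auto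
      thus "vge v ((int d - 1) * v y) (y ^ i)" using yv v by (simp add: vge_def val_power)
    qed auto
    hence "vge v (K + (int d - 1) * v y) (y ^ d)" unfolding y by (simp add: vge_minus v)
    thus False using yv v by (simp add: vge_def val_power algebra_simps)
  qed
  have poly_v: "vge v K (ev x (a i))" if v: "v \<in> \<V>" and i: "i < d" and K: "\<And>j. j \<le> N \<Longrightarrow> K \<le> int j * v x" for v K i
    unfolding ev_altdef[OF N[OF i]]
    using K x0 v by (intro vge_sum vge_scale v) (auto simp: vge_def val_power)
  show ?thesis
  proof (intro exI[of _ g] exI[of _ N] conjI g0 ballI)
    fix v assume v: "v \<in> \<V>"
    have "vge v (int N * v x) y" if "v x < 0"
    proof (intro no_pole poly_v v)
      show "int N * v x \<le> 0" using that by (simp add: mult_nonneg_nonpos)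
      fix j assume "j \<le> N"
      thus "int N * v x \<le> int j * v x" using that by (intro mult_right_mono_neg) auto
    qed
    moreover have "vge v 0 y" if "\<not> v x < 0"
      using that by (intro no_pole poly_v v) auto
    ultimately show "if v x < 0 then vge v (int N * v x) (ev x g * h) else vge v 0 (ev x g * h)"
      by (simp add: y_def)
  qed
qed

text \<open>
  Being regular everywhere, \<open>f\<close> minus a constant is algebraic over the constants, and a nonzero
  algebraic element has no zeros.
\<close>

lemma algebraic_constant:
  assumes f: "\<And>v. v \<in> \<V> \<Longrightarrow> vge v 0 f" and u: "u \<in> \<V>" and res: "vge u 1 (f - \<iota> c)"
  shows "f = \<iota> c"
proof (rule ccontr)
  assume "f \<noteq> \<iota> c"
  hence nz: "f - \<iota> c \<noteq> 0" by simp
  hence "0 \<le> v (f - \<iota> c)" if "v \<in> \<V>" for v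
    using vge_diff[OF that f[OF that] vge_const[OF that]] by (auto simp: vge_def)
  hence "\<not> transcendental_over \<iota> (f - \<iota> c)" using regular_everywhere nz by blast
  moreover have "transcendental_over \<iota> (f - \<iota> c)"
    using res nz by (intro transcendental_if_val_pos[OF u]) (auto simp: vge_def)
  ultimately show False by blast
qed

end

text \<open>
  A finite set \<open>\<Q>\<close> of places with residue field \<open>\<bbbF>\<close>. Divisors supported on
  it have the naive degree, and their sections are the Riemann-Roch spaces of the theorem.
\<close>

locale rational_places = function_field_places \<iota> \<V> for \<iota> :: "'a::{field,finite} \<Rightarrow> 'k::field" and \<V> +
  fixes \<Q> :: "('k \<Rightarrow> int) set"
  assumes finite_Q: "finite \<Q>" and Q_nonempty: "\<Q> \<noteq> {}" and Q_subset: "\<Q> \<subseteq> \<V>"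
    and rational: "v \<in> \<Q> \<Longrightarrow> vge v 0 f \<Longrightarrow> \<exists>c. vge v 1 (f - \<iota> c)"
begin

lemma Q_in [simp]: "v \<in> \<Q> \<Longrightarrow> v \<in> \<V>" using Q_subset by auto

definition supported :: "(('k \<Rightarrow> int) \<Rightarrow> int) \<Rightarrow> bool" where
  "supported D \<longleftrightarrow> (\<forall>v. v \<notin> \<Q> \<longrightarrow> D v = 0)"

definition deg :: "(('k \<Rightarrow> int) \<Rightarrow> int) \<Rightarrow> int" where
  "deg D = (\<Sum>v\<in>\<Q>. D v)"

lemma sections_zero: "sections (\<lambda>_. 0) = range \<iota>"
proof (intro equalityI subsetI)
  fix f assume "f \<in> sections (\<lambda>_. 0)"
  hence f: "\<And>v. v \<in> \<V> \<Longrightarrow> vge v 0 f" by (simp add: sections_def)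
  obtain u where u: "u \<in> \<Q>" using Q_nonempty by auto
  obtain c where "vge u 1 (f - \<iota> c)" using rational[OF u f[OF Q_in[OF u]]] by blast
  hence "f = \<iota> c" using algebraic_constant[OF f Q_in[OF u]] by blast
  thus "f \<in> range \<iota>" by simp
next
  fix f assume "f \<in> range \<iota>"
  thus "f \<in> sections (\<lambda>_. 0)" by (auto simp: sections_def vge_const)
qed

lemma range_iota_span: "range \<iota> = span {1}"
  by (auto simp: span_singleton)

lemma finite_span_sections_zero: "finite_span (sections (\<lambda>_. 0))"
  unfolding finite_span_def sections_zero range_iota_span by blast

lemma dim_sections_zero: "dim (sections (\<lambda>_. 0)) \<le> 1"
  unfolding sections_zero range_iota_span using dim_le_card[of "span {1}" "{1}"] by simp

text \<open>
  At a rational place \<open>g / f\<close> agrees with a constant up to a term with a zero.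
\<close>

lemma leading_coefficient:
  assumes v: "v \<in> \<Q>" and f: "f \<noteq> 0" and g: "vge v (v f) g"
  shows "\<exists>c. vge v (v f + 1) (g - \<iota> c * f)"
proof -
  have vV: "v \<in> \<V>" using v by simp
  have "vge v 0 (g / f)" using g f vV by (cases "g = 0") (auto simp: vge_def val_divide)
  then obtain c where "vge v 1 (g / f - \<iota> c)" using rational[OF v] by blast
  hence "vge v (v f + 1) (f * (g / f - \<iota> c))" by (intro vge_mult vV) auto
  thus ?thesis using f by (intro exI[of _ c]) (simp add: algebra_simps)
qed

text \<open>
  Allowing one more pole at a rational place adds at most one dimension: a section with the new pole, if there
  is one, cancels the leading terms of all others.
\<close>

lemma sections_step:
  assumes u: "u \<in> \<Q>"
  shows "\<exists>w. sections (D(u := D u + 1)) \<subseteq> span (sections D \<union> {w})"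
proof (cases "\<exists>w\<in>sections (D(u := D u + 1)). w \<noteq> 0 \<and> u w = - D u - 1")
  case True
  then obtain w where w: "w \<in> sections (D(u := D u + 1))" "w \<noteq> 0" "u w = - D u - 1" by blast
  have "g \<in> span (sections D \<union> {w})" if g: "g \<in> sections (D(u := D u + 1))" for g
  proof -
    have "vge u (- ((D(u := D u + 1)) u)) g" using g Q_in[OF u] unfolding sections_def by blast
    hence "vge u (u w) g" using w by simp
    then obtain c where c: "vge u (u w + 1) (g - \<iota> c * w)" using leading_coefficient[OF u w(2)] by blast
    have "g - \<iota> c * w \<in> sections (D(u := D u + 1))"
      using subspace_sections g w(1) by (intro subspace_diff subspace_scale)
    hence "g - \<iota> c * w \<in> sections D" using c w by (auto simp: sections_def split: if_splits)
    hence "(g - \<iota> c * w) + \<iota> c * w \<in> span (sections D \<union> {w})"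
      by (intro span_add span_scale span_base) auto
    thus ?thesis by simp
  qed
  thus ?thesis by blast
next
  case False
  have "sections (D(u := D u + 1)) \<subseteq> sections D"
  proof
    fix g assume g: "g \<in> sections (D(u := D u + 1))"
    have "vge u (- ((D(u := D u + 1)) u)) g" using g Q_in[OF u] unfolding sections_def by blast
    hence "vge u (- D u - 1) g" by simp
    moreover have "g = 0 \<or> u g \<noteq> - D u - 1" using False g by blast
    ultimately have "vge u (- D u) g" by (auto simp: vge_def)
    thus "g \<in> sections D" using g by (auto simp: sections_def split: if_splits)
  qed
  thus ?thesis using span_superset[of "sections D \<union> {0}"] by blast
qed

lemma finite_span_step:
  assumes "u \<in> \<Q>" "finite_span (sections D)"
  shows "finite_span (sections (D(u := D u + 1)))" "dim (sections (D(u := D u + 1))) \<le> dim (sections D) + 1"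
proof -
  obtain w where w: "sections (D(u := D u + 1)) \<subseteq> span (sections D \<union> {w})"
    using sections_step[OF assms(1)] by blast
  show "finite_span (sections (D(u := D u + 1)))" "dim (sections (D(u := D u + 1))) \<le> dim (sections D) + 1"
    using dim_le_dim_plus_card[OF assms(2) _ w] by auto
qed

lemma sections_growth:
  assumes D: "supported D" "supported E" "\<And>v. D v \<le> E v" and fin: "finite_span (sections D)"
  shows "finite_span (sections E) \<and> int (dim (sections E)) \<le> int (dim (sections D)) + (deg E - deg D)"
  using assms
proof (induction "nat (deg E - deg D)" arbitrary: E)
  case 0
  have "D v = E v" for v
  proof (cases "v \<in> \<Q>")
    case True
    have "(\<Sum>v\<in>\<Q>. E v - D v) = 0" using 0 sum_nonneg[of \<Q> "\<lambda>v. E v - D v"] by (simp add: deg_def sum_subtractf)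
    thus ?thesis using sum_nonneg_eq_0_iff[of \<Q> "\<lambda>v. E v - D v"] 0 finite_Q True by simp
  qed (use 0 in \<open>simp add: supported_def\<close>)
  hence "E = D" by auto
  thus ?case using 0 by simp
next
  case (Suc n)
  have "\<exists>u\<in>\<Q>. D u < E u"
  proof (rule ccontr)
    assume "\<not> ?thesis"
    hence "(\<Sum>v\<in>\<Q>. E v) \<le> (\<Sum>v\<in>\<Q>. D v)" by (intro sum_mono) auto
    thus False using Suc(2) by (simp add: deg_def)
  qed
  then obtain u where u: "u \<in> \<Q>" "D u < E u" by blast
  define E' where "E' = E(u := E u - 1)"
  have dE: "deg E = deg E' + 1"
    using u finite_Q sum.remove[OF finite_Q u(1), of E] sum.remove[OF finite_Q u(1), of E']
    by (simp add: deg_def E'_def)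
  have E: "E = E'(u := E' u + 1)" by (auto simp: E'_def)
  have IH: "finite_span (sections E') \<and> int (dim (sections E')) \<le> int (dim (sections D)) + (deg E' - deg D)"
  proof (rule Suc(1))
    show "n = nat (deg E' - deg D)" using Suc(2) dE by simp
    show "supported E'" using Suc u by (auto simp: supported_def E'_def)
    show "D v \<le> E' v" for v using Suc(5)[of v] u by (auto simp: E'_def)
  qed (use Suc in auto)
  show ?case using finite_span_step[OF u(1) IH[THEN conjunct1]] IH dE unfolding E[symmetric] by simp
qed

lemma finite_span_sections:
  assumes "supported D"
  shows "finite_span (sections D)"
proof -
  have "finite_span (sections (\<lambda>v. max (D v) 0))"
    using sections_growth[of "\<lambda>_. 0" "\<lambda>v. max (D v) 0"] assms finite_span_sections_zero
    by (auto simp: supported_def)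
  thus ?thesis by (rule finite_span_subset) (rule sections_mono, simp)
qed

lemma dim_sections_diff_le:
  "supported D \<Longrightarrow> supported E \<Longrightarrow> (\<And>v. D v \<le> E v) \<Longrightarrow>
     int (dim (sections E)) \<le> int (dim (sections D)) + (deg E - deg D)"
  using sections_growth finite_span_sections by blast

lemma dim_sections_upper: "supported D \<Longrightarrow> (\<And>v. 0 \<le> D v) \<Longrightarrow> int (dim (sections D)) \<le> deg D + 1"
  using dim_sections_diff_le[of "\<lambda>_. 0" D] dim_sections_zero by (simp add: supported_def deg_def)

text \<open>
  The sum of local uniformizers, each weighted by an approximate idempotent at its place.
\<close>

lemma common_uniformizer: "\<exists>s. s \<noteq> 0 \<and> (\<forall>v\<in>\<Q>. v s = 1)"
proof -
  have "\<forall>v\<in>\<Q>. \<exists>t. t \<noteq> 0 \<and> v t = 1" using val_uniformizer by simp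
  then obtain t where t: "\<And>v. v \<in> \<Q> \<Longrightarrow> t v \<noteq> 0 \<and> v (t v) = 1" by metis
  define N where "N = nat (2 + (\<Sum>(v, u)\<in>\<Q> \<times> \<Q>. \<bar>u (t v)\<bar>))"
  have N: "2 \<le> int N + u (t v)" if "v \<in> \<Q>" "u \<in> \<Q>" for u v
  proof -
    have "(\<lambda>(v, u). \<bar>u (t v)\<bar>) (v, u) \<le> (\<Sum>(v, u)\<in>\<Q> \<times> \<Q>. \<bar>u (t v)\<bar>)"
      using that finite_Q by (intro member_le_sum) auto
    thus ?thesis by (simp add: N_def)
  qed
  have "\<forall>v\<in>\<Q>. \<exists>e. e \<noteq> 0 \<and> v e = 0 \<and> (\<forall>u\<in>\<Q> - {v}. int N \<le> u e)"
    using approximate_idempotent[OF finite_Q Q_subset] by blast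
  then obtain e where e: "\<And>v. v \<in> \<Q> \<Longrightarrow> e v \<noteq> 0" "\<And>v. v \<in> \<Q> \<Longrightarrow> v (e v) = 0"
    "\<And>u v. v \<in> \<Q> \<Longrightarrow> u \<in> \<Q> - {v} \<Longrightarrow> int N \<le> u (e v)" by metis
  define s where "s = (\<Sum>v\<in>\<Q>. e v * t v)"
  have s: "s \<noteq> 0 \<and> v s = 1" if v: "v \<in> \<Q>" for v
  proof -
    have 1: "e v * t v \<noteq> 0" "v (e v * t v) = 1" using e(1,2)[OF v] t[OF v] Q_in[OF v] by (auto simp: val_mult)
    have "vge v (1 + 1) (\<Sum>u\<in>\<Q> - {v}. e u * t u)"
    proof (rule vge_sum)
      fix u assume u: "u \<in> \<Q> - {v}"
      hence "int N \<le> v (e u)" using e(3)[of u v] v by auto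
      thus "vge v (1 + 1) (e u * t u)"
        using N[of u v] u v e t by (simp add: vge_def val_mult)
    qed (use v in auto)
    hence "vge v (v (e v * t v) + 1) (\<Sum>u\<in>\<Q> - {v}. e u * t u)" by (simp add: 1)
    note sum = val_add_eq[OF Q_in[OF v] 1(1) this]
    have "s = e v * t v + (\<Sum>u\<in>\<Q> - {v}. e u * t u)"
      unfolding s_def by (rule sum.remove[OF finite_Q v])
    thus ?thesis using 1(2) sum by metis
  qed
  thus ?thesis using Q_nonempty by (intro exI[of _ s]) blast
qed

end

section \<open>Riemann's inequality\<close>

context function_field_places begin

text \<open>
  The divisor \<open>k\<close> times the divisor of poles of \<open>x\<close>.
\<close>

definition pole_multiple :: "'k \<Rightarrow> nat \<Rightarrow> ('k \<Rightarrow> int) \<Rightarrow> int" where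
  "pole_multiple x k = (\<lambda>v. if v x < 0 then - int k * v x else 0)"

text \<open>
  The functions \<open>x\<^sup>j y\<close>, with \<open>j \<le> k\<close> and \<open>y\<close> an integral
  multiple of an element of \<open>Y\<close>, are linearly independent, and their poles are bounded by those
  of \<open>x\<^bsup>k + c\<^esup>\<close>.
\<close>

lemma pole_multiple_dim_lower:
  assumes x: "transcendental_over \<iota> x" and Y: "finite Y" "poly_independent x Y (\<lambda>y. y)"
  shows "\<exists>c. \<forall>k. finite_span (sections (pole_multiple x (k + c))) \<longrightarrow>
           card Y * (k + 1) \<le> dim (sections (pole_multiple x (k + c)))"
proof -
  have x0: "x \<noteq> 0" by (rule transcendental_nonzero[OF x])
  have "\<forall>y. \<exists>g N. g \<noteq> 0 \<and>
      (\<forall>v\<in>\<V>. if v x < 0 then vge v (int N * v x) (ev x g * y) else vge v 0 (ev x g * y))"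
    using integral_multiple[OF x] by blast
  then obtain g N where g: "\<And>y. g y \<noteq> 0"
    and N: "\<And>y v. v \<in> \<V> \<Longrightarrow> if v x < 0 then vge v (int (N y) * v x) (ev x (g y) * y) else vge v 0 (ev x (g y) * y)"
    by metis
  define c where "c = sum N Y"
  have "card Y * (k + 1) \<le> dim (sections (pole_multiple x (k + c)))"
    if fin: "finite_span (sections (pole_multiple x (k + c)))" for k
  proof (rule ccontr)
    assume less: "\<not> ?thesis"
    obtain S where S: "sections (pole_multiple x (k + c)) \<subseteq> span S"
        "card S = dim (sections (pole_multiple x (k + c)))" "finite S"
      using finite_span_basis[OF fin] by metis
    define w where "w = (\<lambda>(y, j). x ^ j * (ev x (g y) * y))"
    have w: "w i \<in> span S" if "i \<in> Y \<times> {..k}" for i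
    proof -
      from that obtain y j where i: "i = (y, j)" "y \<in> Y" "j \<le> k" by auto
      have Ny: "N y \<le> c" unfolding c_def by (intro member_le_sum) (use i Y in auto)
      have "w i \<in> sections (pole_multiple x (k + c))"
        unfolding sections_def
      proof (intro CollectI ballI)
        fix v assume v: "v \<in> \<V>"
        show "vge v (- pole_multiple x (k + c) v) (w i)"
        proof (cases "v x < 0")
          case True
          have "vge v (int j * v x + int (N y) * v x) (w i)"
            unfolding w_def i prod.case using N[OF v, of y] True x0 v
            by (intro vge_mult) (auto simp: vge_def val_power)
          moreover have "int (k + c) * v x \<le> int (j + N y) * v x"
            using True i(3) Ny by (intro mult_right_mono_neg) auto
          ultimately show ?thesis using True by (auto simp: pole_multiple_def algebra_simps intro: vge_mono)
        next
          case False
          have "vge v 0 (x ^ j)" using False x0 v by (auto simp: vge_def val_power)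
          thus ?thesis using N[OF v, of y] False v by (simp add: pole_multiple_def w_def i vge_0_mult)
        qed
      qed
      thus ?thesis using S(1) by blast
    qed
    have less': "card S < card (Y \<times> {..k})" using less S(2) by (simp add: card_cartesian_product)
    have fin2: "finite (Y \<times> {..k})" using Y(1) by simp
    have "\<exists>h. (\<exists>i\<in>Y \<times> {..k}. h i \<noteq> 0) \<and> (\<Sum>i\<in>Y \<times> {..k}. \<iota> (h i) * w i) = 0"
      by (rule linear_relation_if_card_less[OF fin2 S(3) _ less']) (rule w)
    then obtain h where h: "\<exists>i\<in>Y \<times> {..k}. h i \<noteq> 0" "(\<Sum>i\<in>Y \<times> {..k}. \<iota> (h i) * w i) = 0" by blast
    define p where "p y = (\<Sum>j\<le>k. monom (h (y, j)) j) * g y" for y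
    have "(\<Sum>y\<in>Y. ev x (p y) * y) = (\<Sum>i\<in>Y \<times> {..k}. \<iota> (h i) * w i)"
      by (simp add: sum.cartesian_product' w_def p_def sum_distrib_left sum_distrib_right
          ring_hom_map_sum[OF ev_hom] mult_ac)
    hence "\<forall>y\<in>Y. p y = 0" using Y(2) h(2) unfolding poly_independent_def by metis
    hence p0: "(\<Sum>j\<le>k. monom (h (y, j)) j) = 0" if "y \<in> Y" for y using that g[of y] by (auto simp: p_def)
    obtain y j where yj: "y \<in> Y" "j \<le> k" "h (y, j) \<noteq> 0" using h(1) by auto
    have "coeff (\<Sum>j\<le>k. monom (h (y, j)) j) j = h (y, j)"
      using yj by (simp add: coeff_sum if_distrib cong: if_cong)
    thus False using yj p0 by auto
  qed
  thus ?thesis by blast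
qed

end

context rational_places begin

text \<open>
  The divisor \<open>D r\<close> has multiplicity \<open>k\<close> at the places in \<open>\<Q>\<close> and
  \<open>r\<close> times the pole order of \<open>x\<close> at its other poles. Suppose that the sections
  \<open>W\<close> of \<open>D (Suc r)\<close> are independent modulo those of \<open>D r\<close>. Divided by
  \<open>x\<^bsup>r + 1\<^esup>\<close> and multiplied by \<open>E\<close>, which is a unit at the poles
  outside \<open>\<Q>\<close> and has high zeros on \<open>\<Q>\<close>, they remain independent modulo
  \<open>1 / x\<close>, also together with approximate idempotents at the places in \<open>\<Q>\<close>. All
  of them are then independent over \<open>\<bbbF>(x)\<close>, so that \<open>card W + card \<Q> \<le>
  n\<close>.
\<close>

lemma pole_reduction_step:
  assumes x: "x \<noteq> 0" "\<And>v. v \<in> \<Q> \<Longrightarrow> v x = -1"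
    and n: "\<And>(I :: (('k \<Rightarrow> int) + 'k) set) w. finite I \<Longrightarrow> poly_independent x I w \<Longrightarrow> card I \<le> n"
    and D: "D = (\<lambda>r v. if v \<in> \<Q> then int k else if v x < 0 then - int r * v x else 0)"
    and fin: "finite_span (sections (D r))"
  shows "finite_span (sections (D (Suc r))) \<and> dim (sections (D (Suc r))) + card \<Q> \<le> dim (sections (D r)) + n"
proof -
  define P where "P = {v \<in> \<V>. v x < 0}"
  have P: "finite P" "P \<subseteq> \<V>" using finite_poles[OF x(1)] by (auto simp: P_def)
  have QP: "\<Q> \<subseteq> P"
  proof
    fix v assume v: "v \<in> \<Q>"
    thus "v \<in> P" using x(2)[OF v] by (simp add: P_def)
  qed
  \<comment> \<open>at places in \<open>\<Q>\<close> a zero of order \<open>M + 1\<close> absorbs the pole of order \<open>k\<close> that sections may have there, and still vanishes\<close>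
  define M where "M = nat (\<Sum>v\<in>P. \<bar>v x\<bar>) + k"
  have M: "- v x \<le> int M" if "v \<in> P" for v
  proof -
    have "\<bar>v x\<bar> \<le> (\<Sum>v\<in>P. \<bar>v x\<bar>)" using that P(1) by (intro member_le_sum) auto
    thus ?thesis by (simp add: M_def)
  qed
  have "\<forall>v\<in>P. \<exists>e. e \<noteq> 0 \<and> v e = 0 \<and> (\<forall>u\<in>P - {v}. int (M + 1) \<le> u e)"
    using approximate_idempotent[OF P] by blast
  then obtain e where e: "\<And>v. v \<in> P \<Longrightarrow> e v \<noteq> 0" "\<And>v. v \<in> P \<Longrightarrow> v (e v) = 0"
    "\<And>u v. v \<in> P \<Longrightarrow> u \<in> P - {v} \<Longrightarrow> int (M + 1) \<le> u (e v)" by metis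
  have e_reg: "vge u 0 (e v)" if "v \<in> P" "u \<in> P" for u v
    using e(2)[of v] e(3)[of v u] that by (cases "u = v") (auto simp: vge_def)
  define E where "E = (\<Sum>v\<in>P - \<Q>. e v)"
  have E_T: "E \<noteq> 0 \<and> v E = 0" if v: "v \<in> P - \<Q>" for v
  proof -
    have vV: "v \<in> \<V>" using v P by auto
    have "vge v (v (e v) + 1) (\<Sum>u\<in>P - \<Q> - {v}. e u)"
    proof (rule vge_sum[OF vV])
      fix u assume u: "u \<in> P - \<Q> - {v}"
      thus "vge v (v (e v) + 1) (e u)" using e(2)[of v] e(3)[of u v] v by (auto simp: vge_def)
    qed
    note sum = val_add_eq[OF vV _ this]
    have "E = e v + (\<Sum>u\<in>P - \<Q> - {v}. e u)"
      unfolding E_def by (rule sum.remove) (use v P(1) in auto)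
    thus ?thesis using e(1,2)[of v] v sum by (metis Diff_iff)
  qed
  have E_Q: "vge v (int (M + 1)) E" if v: "v \<in> \<Q>" for v
    unfolding E_def
  proof (rule vge_sum)
    fix u assume u: "u \<in> P - \<Q>"
    thus "vge v (int (M + 1)) (e u)" using e(3)[of u v] v QP by (auto simp: vge_def)
  qed (use v in auto)
  have E_T0: "vge v 0 E" if "v \<in> P - \<Q>" for v using E_T[OF that] by (simp add: vge_def)
  obtain B' where B': "B' \<subseteq> sections (D r)" "\<not> dependent B'" "sections (D r) \<subseteq> span B'"
      "card B' = dim (sections (D r))" "finite B'"
    using finite_span_basis[OF fin] by metis
  have sub: "sections (D r) \<subseteq> sections (D (Suc r))"
    by (rule sections_mono) (auto simp: D algebra_simps)
  obtain B where B: "B' \<subseteq> B" "B \<subseteq> sections (D (Suc r))" "\<not> dependent B" "sections (D (Suc r)) \<subseteq> span B"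
    using maximal_independent_subset_extend[OF order.trans[OF B'(1) sub] B'(2)] by blast
  \<comment> \<open>the index set is a disjoint union: places contribute idempotents, elements of \<open>W\<close> the modified sections\<close>
  have key: "card W + card \<Q> \<le> n" if W: "finite W" "W \<subseteq> B - B'" for W
  proof -
    define y where "y = inverse x ^ Suc r"
    have y0: "y \<noteq> 0" using x by (simp add: y_def)
    have vy: "v y = - (int (Suc r) * v x)" if "v \<in> \<V>" for v
      using that x by (simp add: y_def val_power val_inverse val_mult del: of_nat_Suc power_Suc)
    define w where "w = case_sum e (\<lambda>f. E * (y * f))"
    have Wsec: "f \<in> sections (D (Suc r))" if "f \<in> W" for f using that W B by auto
    have sec_P: "vge v 0 (y * f)" if f: "f \<in> sections (D (Suc r))" and v: "v \<in> P - \<Q>" for f v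
    proof -
      have vV: "v \<in> \<V>" using v P by auto
      hence "vge v (- D (Suc r) v) f" using f by (auto simp: sections_def)
      hence "vge v (- (- int (Suc r) * v x)) f" using v by (simp add: D P_def del: of_nat_Suc)
      hence "vge v (int (Suc r) * v x) f" by (simp del: of_nat_Suc)
      thus ?thesis using vge_mult_cancel[OF vV y0, of 0 f] vy[OF vV] by simp
    qed
    have sec_Q: "vge v (- int k) (y * f)" if f: "f \<in> sections (D (Suc r))" and v: "v \<in> \<Q>" for f v
    proof -
      have vV: "v \<in> \<V>" using v by auto
      hence "vge v (- D (Suc r) v) f" using f by (auto simp: sections_def)
      hence "vge v (- int k) f" using v by (simp add: D)
      thus ?thesis using vge_mult_cancel[OF vV y0, of "- int k" f] vy[OF vV] x(2)[OF v]
        by (auto intro: vge_mono)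
    qed
    have w_Q: "vge v 1 (E * (y * f))" if f: "f \<in> sections (D (Suc r))" and v: "v \<in> \<Q>" for f v
    proof -
      have "vge v (int (M + 1) + - int k) (E * (y * f))"
        by (intro vge_mult E_Q sec_Q f v Q_in)
      thus ?thesis by (rule vge_mono) (simp add: M_def)
    qed
    let ?I = "\<Q> <+> W"
    have fI: "finite ?I" using finite_Q W by simp
    have "poly_independent x ?I w"
    proof (rule poly_independent_if_independent_mod_pole[OF fI P(2)])
      show "v x < 0" if "v \<in> P" for v using that by (simp add: P_def)
      show "x \<noteq> 0" by fact
      fix i v assume i: "i \<in> ?I" and v: "v \<in> P"
      show "vge v 0 (w i)"
      proof (cases i)
        case (Inl u)
        thus ?thesis using i e_reg[of u v] v QP by (auto simp: w_def)
      next
        case (Inr f)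
        hence f: "f \<in> sections (D (Suc r))" using i Wsec by auto
        show ?thesis
        proof (cases "v \<in> \<Q>")
          case True
          show ?thesis using vge_mono[OF w_Q[OF f True], of 0] Inr by (simp add: w_def)
        next
          case False
          thus ?thesis using E_T0[of v] sec_P[OF f, of v] v P(2) Inr by (auto simp: w_def intro!: vge_0_mult)
        qed
      qed
    next
      fix c assume c: "\<And>v. v \<in> P \<Longrightarrow> vge v (- v x) (\<Sum>i\<in>?I. \<iota> (c i) * w i)"
      have cQ: "c (Inl u) = 0" if u: "u \<in> \<Q>" for u
      proof (rule isolated_term_vanishes[OF Q_in[OF u] fI, where w = w])
        have uP: "u \<in> P" using u QP by auto
        have wu: "u (w (Inl u)) = 0" using e(2)[OF uP] by (simp add: w_def)
        show "Inl u \<in> ?I" "w (Inl u) \<noteq> 0" using u e(1)[OF uP] by (auto simp: w_def)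
        show "vge u (u (w (Inl u)) + 1) (\<Sum>i\<in>?I. \<iota> (c i) * w i)" using c[OF uP] x(2)[OF u] wu by simp
        fix i assume i: "i \<in> ?I" "i \<noteq> Inl u"
        show "c i = 0 \<or> vge u (u (w (Inl u)) + 1) (w i)"
        proof (cases i)
          case (Inl u')
          thus ?thesis using i e(3)[of u' u] u uP QP wu by (auto simp: w_def vge_def)
        next
          case (Inr f)
          thus ?thesis using i Wsec[of f] w_Q[of f u] u wu by (auto simp: w_def)
        qed
      qed
      define h where "h = (\<Sum>f\<in>W. \<iota> (c (Inr f)) * f)"
      have h: "h \<in> sections (D (Suc r))"
        unfolding h_def using Wsec by (intro subspace_sum subspace_scale subspace_sections) auto
      have "(\<Sum>i\<in>?I. \<iota> (c i) * w i) = (\<Sum>u\<in>\<Q>. \<iota> (c (Inl u)) * w (Inl u)) + (\<Sum>f\<in>W. \<iota> (c (Inr f)) * w (Inr f))"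
        using finite_Q W(1) by (simp add: sum.Plus)
      also have "\<dots> = E * (y * h)" using cQ by (simp add: w_def h_def sum_distrib_left mult_ac)
      finally have sum: "(\<Sum>i\<in>?I. \<iota> (c i) * w i) = E * (y * h)" .
      have "h \<in> sections (D r)"
        unfolding sections_def
      proof (intro CollectI ballI)
        fix v assume v: "v \<in> \<V>"
        show "vge v (- D r v) h"
        proof (cases "v \<in> P - \<Q>")
          case True
          have Ev: "E \<noteq> 0" "v E = 0" using E_T[OF True] by auto
          have "vge v (- v x) (E * (y * h))" using c[of v] True sum by simp
          hence "vge v (- v x - v y) h" by (simp add: vge_mult_cancel[OF v Ev(1)] vge_mult_cancel[OF v y0] Ev(2))
          thus ?thesis using True vy[OF v] by (simp add: D P_def algebra_simps)
        next
          case False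
          hence "D r v = D (Suc r) v" using v by (auto simp: D P_def)
          thus ?thesis using h v by (auto simp: sections_def)
        qed
      qed
      hence "(\<Sum>f\<in>W. \<iota> (c (Inr f)) * f) \<in> span B'" using B'(3) by (auto simp: h_def)
      hence "c (Inr f) = 0" if "f \<in> W" for f
        using complement_independent[OF B(3) B(1) W, of "\<lambda>f. c (Inr f)"] that by blast
      thus "\<forall>i\<in>?I. c i = 0" using cQ by auto
    qed
    hence "card ?I \<le> n" by (rule n[OF fI])
    thus ?thesis using finite_Q W by (simp add: card_Plus)
  qed
  have "finite (B - B')"
  proof (rule ccontr)
    assume "infinite (B - B')"
    then obtain W where "finite W" "card W = Suc n" "W \<subseteq> B - B'"
      using infinite_arbitrarily_large by blast
    thus False using key[of W] by simp
  qed
  hence finB: "finite B" using B'(5) by (metis Diff_infinite_finite)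
  have "card B = card B' + card (B - B')"
    using card_Un_disjoint[of B' "B - B'"] finB B'(5) B(1) by (simp add: Un_absorb1)
  moreover have "card B = dim (sections (D (Suc r)))" by (rule basis_card_eq_dim) (use B in auto)
  ultimately show ?thesis
    using key[of "B - B'"] B'(4) B(4) finB \<open>finite (B - B')\<close> by (auto simp: finite_span_def)
qed

text \<open>
  With \<open>n\<close> the degree of the field over \<open>\<bbbF>(x)\<close> and \<open>m\<close> the number
  of places in \<open>\<Q>\<close>, the lower bound \<open>n k - c\<close> loses \<open>k (n - m)\<close> in
  \<open>k\<close> reduction steps. What is left is \<open>m k\<close>, the degree of the divisor with
  multiplicity \<open>k\<close> on \<open>\<Q>\<close>, minus a constant. A general divisor is reached from a
  large multiple, losing at most one dimension for each unit of degree.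
\<close>

lemma riemann_inequality:
  "\<exists>c::nat. \<forall>D. supported D \<longrightarrow> deg D - int c \<le> int (dim (sections D))"
proof -
  obtain s where s: "s \<noteq> 0" "\<And>v. v \<in> \<Q> \<Longrightarrow> v s = 1" using common_uniformizer by blast
  define x where "x = inverse s"
  have x: "x \<noteq> 0" "\<And>v. v \<in> \<Q> \<Longrightarrow> v x = -1" using s by (auto simp: x_def val_inverse)
  obtain u where u: "u \<in> \<Q>" using Q_nonempty by blast
  have tr: "transcendental_over \<iota> x"
    using transcendental_if_val_neg[of u x] u x(1) x(2)[OF u] by simp
  obtain Y where Y: "finite Y" "poly_independent x Y (\<lambda>y. y)"
    "\<And>(I :: (('k \<Rightarrow> int) + 'k) set) w. finite I \<Longrightarrow> poly_independent x I w \<Longrightarrow> card I \<le> card Y"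
    using maximal_poly_independent_set[OF tr, where ?'i = "('k \<Rightarrow> int) + 'k"] by metis
  define n where "n = card Y"
  define m where "m = card \<Q>"
  define D where "D k r = (\<lambda>v. if v \<in> \<Q> then int k else if v x < 0 then - int r * v x else 0)" for k r :: nat
  have Deq: "D k = (\<lambda>r v. if v \<in> \<Q> then int k else if v x < 0 then - int r * v x else 0)" for k
    by (simp add: D_def fun_eq_iff)
  have D0: "supported (D k 0)" "deg (D k 0) = int k * int m" for k
    by (auto simp: D_def supported_def deg_def m_def)
  have chain: "finite_span (sections (D k r)) \<and> dim (sections (D k r)) + r * m \<le> dim (sections (D k 0)) + r * n" for k r
  proof (induction r)
    case 0
    thus ?case using finite_span_sections[OF D0(1)] by simp
  next
    case (Suc r)
    have "finite_span (sections (D k (Suc r))) \<and> dim (sections (D k (Suc r))) + m \<le> dim (sections (D k r)) + n"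
      unfolding m_def n_def
    proof (rule pole_reduction_step)
      show "finite_span (sections (D k r))" using Suc by simp
    qed (fact x Y(3) Deq)+
    thus ?case using Suc by simp
  qed
  have Dkk: "sections (D k k) = sections (pole_multiple x k)" for k
  proof (rule sections_cong)
    fix v
    show "D k k v = pole_multiple x k v"
      using x(2)[of v] by (cases "v \<in> \<Q>") (auto simp: D_def pole_multiple_def)
  qed
  obtain c where c: "\<And>k. finite_span (sections (pole_multiple x (k + c))) \<Longrightarrow>
      n * (k + 1) \<le> dim (sections (pole_multiple x (k + c)))"
    using pole_multiple_dim_lower[OF tr Y(1,2)] unfolding n_def by blast
  have ineq: "int (k + c) * int m - int (c * n) \<le> int (dim (sections (D (k + c) 0)))" for k
  proof -
    have "n * (k + 1) \<le> dim (sections (D (k + c) (k + c)))"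
      using c[of k] chain[of "k + c" "k + c"] by (simp add: Dkk)
    hence "n * (k + 1) + (k + c) * m \<le> dim (sections (D (k + c) 0)) + (k + c) * n"
      using chain[of "k + c" "k + c"] by linarith
    hence "int (n * (k + 1) + (k + c) * m) \<le> int (dim (sections (D (k + c) 0)) + (k + c) * n)"
      by (simp only: of_nat_le_iff)
    thus ?thesis by (simp add: algebra_simps)
  qed
  have "deg E - int (c * n) \<le> int (dim (sections E))" if E: "supported E" for E
  proof -
    define k where "k = nat (\<Sum>v\<in>\<Q>. \<bar>E v\<bar>)"
    have le: "E v \<le> D (k + c) 0 v" for v
    proof (cases "v \<in> \<Q>")
      case True
      have "\<bar>E v\<bar> \<le> (\<Sum>v\<in>\<Q>. \<bar>E v\<bar>)" using True finite_Q by (intro member_le_sum) auto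
      thus ?thesis using True by (simp add: D_def k_def)
    qed (use E in \<open>simp add: supported_def D_def\<close>)
    from dim_sections_diff_le[OF E D0(1) le]
    have "int (dim (sections (D (k + c) 0))) \<le> int (dim (sections E)) + (int (k + c) * int m - deg E)"
      by (simp only: D0)
    thus ?thesis using ineq[of k] by linarith
  qed
  thus ?thesis by blast
qed

section \<open>Principal divisors supported on two rational places\<close>

text \<open>
  If \<open>f\<close> is a section of \<open>D\<close>, then \<open>f\<^sup>k\<close> maps the sections of
  \<open>- k D\<close> injectively into the constants, whereas their dimension would grow with
  \<open>k\<close> if \<open>deg D\<close> were negative.
\<close>

lemma deg_nonneg:
  assumes D: "supported D" and f: "f \<in> sections D" "f \<noteq> 0"
  shows "0 \<le> deg D"
proof (rule ccontr)
  assume neg: "\<not> 0 \<le> deg D"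
  obtain c :: nat where c: "\<And>D. supported D \<Longrightarrow> deg D - int c \<le> int (dim (sections D))"
    using riemann_inequality by blast
  \<comment> \<open>\<open>- k deg D - c\<close> is then at least \<open>2\<close>, exceeding the dimension of the constants\<close>
  define k where "k = c + 2"
  define E where "E v = - int k * D v" for v
  have "supported E" "deg E = - int k * deg D"
    using D by (auto simp: supported_def E_def deg_def sum_distrib_left)
  moreover have "dim (sections E) \<le> dim (sections (\<lambda>_. 0))"
  proof (rule dim_sections_translate_le[of "f ^ k"])
    fix v assume v: "v \<in> \<V>"
    hence "- D v \<le> v f" using f by (auto simp: sections_def vge_def)
    hence "int k * - D v \<le> int k * v f" by (intro mult_left_mono) auto
    thus "E v \<le> 0 + v (f ^ k)" using v f by (simp add: E_def val_power)
  qed (use f finite_span_sections_zero in auto)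
  moreover have "int k * 1 \<le> int k * - deg D" using neg by (intro mult_left_mono) auto
  ultimately have "int k - int c \<le> int (dim (sections (\<lambda>_. 0)))" using c[of E] by fastforce
  thus False using dim_sections_zero by (simp add: k_def)
qed

lemma exists_nonzero_section: "0 < dim (sections D) \<Longrightarrow> \<exists>f\<in>sections D. f \<noteq> 0"
proof (rule ccontr)
  assume "0 < dim (sections D)" "\<not> (\<exists>f\<in>sections D. f \<noteq> 0)"
  hence "sections D \<subseteq> span {}" by auto
  hence "dim (sections D) \<le> card ({} :: 'k set)" by (intro dim_le_card) auto
  thus False using \<open>0 < _\<close> by simp
qed

definition two_point :: "('k \<Rightarrow> int) \<Rightarrow> ('k \<Rightarrow> int) \<Rightarrow> int \<Rightarrow> int \<Rightarrow> ('k \<Rightarrow> int) \<Rightarrow> int" where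
  "two_point u w a b = (\<lambda>v. if v = u then a else if v = w then b else 0)"

lemma two_point:
  assumes "u \<in> \<Q>" "w \<in> \<Q>" "u \<noteq> w"
  shows "supported (two_point u w a b)" "deg (two_point u w a b) = a + b"
proof -
  show "supported (two_point u w a b)" using assms by (auto simp: supported_def two_point_def)
  have "deg (two_point u w a b) = (\<Sum>v\<in>{u, w}. two_point u w a b v)"
    unfolding deg_def using assms finite_Q by (intro sum.mono_neutral_right) (auto simp: two_point_def)
  thus "deg (two_point u w a b) = a + b" using assms by (simp add: two_point_def)
qed

lemma two_point_val_sum:
  assumes uw: "u \<in> \<Q>" "w \<in> \<Q>" "u \<noteq> w" and f: "f \<noteq> 0" "\<And>v. v \<in> \<V> - {u, w} \<Longrightarrow> vge v 0 f"
  shows "u f + w f \<le> 0"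
proof -
  have "f \<in> sections (two_point u w (- u f) (- w f))"
    using f by (auto simp: sections_def two_point_def)
  from deg_nonneg[OF two_point(1)[OF uw] this f(1)] show ?thesis by (simp add: two_point(2)[OF uw])
qed

lemma finite_polys_degree: "finite {p :: 'a poly. degree p \<le> n}"
proof -
  have "{p :: 'a poly. degree p \<le> n} \<subseteq> (\<lambda>g. \<Sum>i\<le>n. monom (g i) i) ` (PiE {..n} (\<lambda>_. UNIV))"
  proof
    fix p :: "'a poly" assume p: "p \<in> {p. degree p \<le> n}"
    have "p = (\<Sum>i\<le>n. monom (restrict (coeff p) {..n} i) i)"
      using p by (subst poly_as_sum_of_monoms'[symmetric, of p n]) auto
    thus "p \<in> (\<lambda>g. \<Sum>i\<le>n. monom (g i) i) ` (PiE {..n} (\<lambda>_. UNIV))"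
      by (intro image_eqI[of _ _ "restrict (coeff p) {..n}"]) auto
  qed
  thus ?thesis by (rule finite_subset) (intro finite_imageI finite_PiE, auto)
qed

text \<open>
  Let \<open>R\<close> be the ring of functions regular outside \<open>u\<close> and \<open>w\<close>, and
  \<open>f \<in> R\<close> nonzero, with zeros of total degree at most \<open>M\<close> at the other places.
  By Riemann's inequality the codimension of the ideal \<open>f R\<close> in \<open>R\<close> is bounded in
  terms of \<open>M\<close>, so the ideal contains \<open>p(y)\<close> for some nonzero polynomial
  \<open>p\<close> of degree at most \<open>N\<close>, where \<open>y \<in> R\<close> is any fixed
  transcendental element. There are only finitely many such \<open>p\<close>, and \<open>z\<close> is the
  product of all \<open>p(y)\<close>.
\<close>

lemma bounded_codimension_common_multiple:
  assumes uw: "u \<in> \<Q>" "w \<in> \<Q>" "u \<noteq> w"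
  defines "R \<equiv> {h. \<forall>v\<in>\<V> - {u, w}. vge v 0 h}"
  shows "\<exists>z\<in>R. z \<noteq> 0 \<and> (\<forall>f\<in>R. f \<noteq> 0 \<longrightarrow> - int M \<le> u f + w f \<longrightarrow> (\<exists>h\<in>R. z = f * h))"
proof -
  obtain c :: nat where c: "\<And>D. supported D \<Longrightarrow> deg D - int c \<le> int (dim (sections D))"
    using riemann_inequality by blast
  have R_sub: "subspace R"
    unfolding R_def subspace_def by (auto intro: vge_add vge_scale)
  have R_mult: "a * b \<in> R" if "a \<in> R" "b \<in> R" for a b
    using that by (auto simp: R_def intro: vge_0_mult)
  have R_1: "1 \<in> R" by (auto simp: R_def vge_def)
  have R_pow: "a ^ i \<in> R" if "a \<in> R" for a i
    by (induction i) (auto intro: R_mult R_1 that)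
  obtain y where y: "y \<in> R" "transcendental_over \<iota> y"
  proof -
    let ?D = "two_point u w (int c + 2) 0"
    have "int (dim (sections ?D)) \<ge> 2" using c[OF two_point(1)[OF uw]] two_point(2)[OF uw, of "int c + 2" 0] by (metis add.right_neutral add_diff_cancel_left')
    hence "\<not> sections ?D \<subseteq> span {1}" using dim_le_card[of "sections ?D" "{1}"] by auto
    then obtain y where y: "y \<in> sections ?D" "y \<notin> range \<iota>" unfolding range_iota_span by blast
    have "y \<noteq> 0" using y(2) by (metis iota_simps(4) rangeI)
    moreover have "\<exists>v\<in>\<V>. v y < 0"
    proof (rule ccontr)
      assume "\<not> ?thesis"
      hence "y \<in> sections (\<lambda>_. 0)" by (auto simp: sections_def vge_def)
      thus False using y(2) sections_zero by simp
    qed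
    ultimately have "transcendental_over \<iota> y" using transcendental_if_val_neg by blast
    moreover have "y \<in> R" using y(1) by (auto simp: R_def sections_def two_point_def)
    ultimately show thesis using that by blast
  qed
  define N where "N = M + c + 2"
  define Ps where "Ps = {p :: 'a poly. degree p \<le> N} - {0}"
  have finPs: "finite Ps" unfolding Ps_def by (intro finite_Diff finite_polys_degree)
  define z where "z = (\<Prod>p\<in>Ps. ev y p)"
  have evR: "ev y p \<in> R" for p
    unfolding ev_altdef[OF order.refl] by (intro subspace_sum subspace_scale R_sub R_pow y)
  have prodR: "(\<Prod>p\<in>A. ev y p) \<in> R" for A :: "'a poly set"
    by (induction A rule: infinite_finite_induct) (auto intro: R_mult R_1 evR)
  have ev0: "ev y p \<noteq> 0" if "p \<noteq> 0" for p using y(2) that unfolding transcendental_iff by blast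
  have "\<exists>h\<in>R. z = f * h" if f: "f \<in> R" "f \<noteq> 0" "- int M \<le> u f + w f" for f
  proof -
    \<comment> \<open>poles of order \<open>b\<close> at \<open>u\<close> and \<open>w\<close> admit \<open>1, y, \<dots>, y ^ N\<close>\<close>
    define b where "b = int N * (\<bar>u y\<bar> + \<bar>w y\<bar>)"
    have b: "0 \<le> b" by (simp add: b_def)
    define D where "D = two_point u w b b"
    define D' where "D' = two_point u w (b + u f) (b + w f)"
    have D: "supported D" "deg D = b + b" "supported D'" "deg D' = b + b + (u f + w f)"
      unfolding D_def D'_def using two_point[OF uw] by auto
    let ?V' = "(\<lambda>g. f * g) ` sections D'"
    have V'sub: "subspace ?V'"
      using span_mult_image[of f "sections D'"] subspace_sections by (metis span_eq_iff subspace_span)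
    have V'D: "?V' \<subseteq> sections D"
    proof
      fix g assume "g \<in> ?V'"
      then obtain h where h: "g = f * h" "h \<in> sections D'" by auto
      have "h \<in> sections (\<lambda>v. D v + v f)"
        unfolding sections_def
      proof (intro CollectI ballI)
        fix v assume v: "v \<in> \<V>"
        have hv: "vge v (- D' v) h" using h(2) v by (simp add: sections_def)
        show "vge v (- (D v + v f)) h"
        proof (cases "v \<in> {u, w}")
          case False
          hence "0 \<le> v f" using f v by (auto simp: R_def vge_def)
          thus ?thesis using hv False by (auto simp: D_def D'_def two_point_def intro: vge_mono)
        qed (use hv in \<open>auto simp: D_def D'_def two_point_def\<close>)
      qed
      thus "g \<in> sections D" using mult_sections_iff[OF f(2)] h(1) by simp
    qed
    have dimV': "dim (sections D') \<le> dim ?V'"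
    proof -
      have "sections D' = (\<lambda>g. inverse f * g) ` ?V'" using f(2) by (auto simp: image_image mult.assoc[symmetric])
      moreover have "finite_span ?V'" using finite_span_subset[OF finite_span_sections[OF D(1)] V'D] .
      ultimately show ?thesis using dim_mult_image_le[of ?V' "inverse f"] by simp
    qed
    have less: "dim (sections D) < dim ?V' + Suc N"
    proof -
      have "int (dim (sections D)) \<le> b + b + 1"
        using dim_sections_upper[OF D(1)] D(2) b by (auto simp: D_def two_point_def)
      moreover have "b + b + (u f + w f) - int c \<le> int (dim (sections D'))" using c[OF D(3)] D(4) by simp
      ultimately show ?thesis using dimV' f(3) by (simp add: N_def)
    qed
    have yi: "y ^ i \<in> sections D" if i: "i \<in> {..<Suc N}" for i
      unfolding sections_def
    proof (intro CollectI ballI)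
      fix v assume v: "v \<in> \<V>"
      have y0: "y \<noteq> 0" using ev0[of "[:0, 1:]"] by auto
      have bound: "- b \<le> int i * v y" if "v = u \<or> v = w"
      proof -
        have "\<bar>int i * v y\<bar> \<le> int N * (\<bar>u y\<bar> + \<bar>w y\<bar>)"
          unfolding abs_mult using i that by (intro mult_mono) auto
        thus ?thesis by (simp add: b_def)
      qed
      show "vge v (- D v) (y ^ i)"
        using bound R_pow[OF y(1), of i] v y0 by (auto simp: D_def two_point_def R_def vge_def val_power)
    qed
    have "\<exists>g. (\<exists>i<Suc N. g i \<noteq> 0) \<and> (\<Sum>i<Suc N. \<iota> (g i) * y ^ i) \<in> ?V'"
      by (rule relation_mod_subspace[OF finite_span_sections[OF D(1)] V'sub V'D _ less]) (rule yi)
    then obtain g where g: "\<exists>i<Suc N. g i \<noteq> 0" "(\<Sum>i<Suc N. \<iota> (g i) * y ^ i) \<in> ?V'" by blast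
    define p where "p = (\<Sum>i<Suc N. monom (g i) i)"
    obtain i where i: "i < Suc N" "g i \<noteq> 0" using g(1) by blast
    have "coeff p i = g i" using i by (simp add: p_def coeff_sum if_distrib cong: if_cong)
    hence "p \<noteq> 0" using i by auto
    moreover have "degree p \<le> N" unfolding p_def
      by (intro degree_sum_le) (auto intro: order.trans[OF degree_monom_le])
    ultimately have p: "p \<in> Ps" by (simp add: Ps_def)
    have "ev y p = (\<Sum>i<Suc N. \<iota> (g i) * y ^ i)"
      unfolding p_def ring_hom_map_sum[OF ev_hom] by simp
    then obtain h where h: "ev y p = f * h" "h \<in> sections D'" using g(2) by auto
    have "h \<in> R" unfolding R_def
    proof (intro CollectI ballI)
      fix v assume v: "v \<in> \<V> - {u, w}"
      hence "vge v (- D' v) h" using h(2) by (auto simp: sections_def)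
      thus "vge v 0 h" using v by (simp add: D'_def two_point_def)
    qed
    moreover have "z = ev y p * (\<Prod>p\<in>Ps - {p}. ev y p)" unfolding z_def by (rule prod.remove[OF finPs p])
    ultimately show ?thesis using R_mult prodR h(1) by (metis mult.assoc)
  qed
  moreover have "z \<noteq> 0" unfolding z_def using finPs ev0 by (auto simp: Ps_def)
  moreover have "z \<in> R" unfolding z_def by (rule prodR)
  ultimately show ?thesis by blast
qed

text \<open>
  The functions \<open>f i\<close> have a zero of order at least \<open>N i\<close> at \<open>w\<close> and,
  by degree, at most \<open>N i + c + 1\<close>; the spacing \<open>c + 2\<close> of the numbers \<open>N
  i\<close> makes these orders distinct. All \<open>f i\<close> divide the same \<open>z\<close>, so two of
  them have equal orders at every place other than \<open>u\<close> and \<open>w\<close>. Their quotient has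
  the required divisor, since the orders of a function supported on two rational places add up to
  \<open>0\<close>.
\<close>

lemma two_point_principal:
  assumes uw: "u \<in> \<Q>" "w \<in> \<Q>" "u \<noteq> w"
  shows "\<exists>f t. f \<noteq> 0 \<and> 0 < t \<and> u f = t \<and> w f = - t \<and> (\<forall>v\<in>\<V> - {u, w}. v f = 0)"
proof -
  define R where "R = {h. \<forall>v\<in>\<V> - {u, w}. vge v 0 h}"
  obtain c :: nat where c: "\<And>D. supported D \<Longrightarrow> deg D - int c \<le> int (dim (sections D))"
    using riemann_inequality by blast
  define N where "N i = i * (c + 2)" for i :: nat
  let ?D = "\<lambda>i. two_point u w (int (N i) + int c + 1) (- int (N i))"
  have "\<exists>f. f \<in> sections (?D i) \<and> f \<noteq> 0" for i
    using exists_nonzero_section[of "?D i"] c[OF two_point(1)[OF uw], of "int (N i) + int c + 1" "- int (N i)"]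
      two_point(2)[OF uw, of "int (N i) + int c + 1" "- int (N i)"] by fastforce
  then obtain f where f: "\<And>i. f i \<in> sections (?D i)" "\<And>i. f i \<noteq> 0" by metis
  have fR: "f i \<in> R" for i
    unfolding R_def
  proof (intro CollectI ballI)
    fix v assume v: "v \<in> \<V> - {u, w}"
    hence "vge v (- ?D i v) (f i)" using f(1)[of i] by (auto simp: sections_def)
    thus "vge v 0 (f i)" using v by (simp add: two_point_def)
  qed
  have fu: "u (f i) \<ge> - (int (N i) + int c + 1)" for i
    using f(1)[of i] f(2)[of i] uw(1) by (auto simp: sections_def two_point_def vge_def dest!: bspec[of _ _ u])
  have fw: "int (N i) \<le> w (f i)" for i
    using f(1)[of i] f(2)[of i] uw by (auto simp: sections_def two_point_def vge_def dest!: bspec[of _ _ w])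
  have fuw: "u (f i) + w (f i) \<le> 0" for i
    using two_point_val_sum[OF uw f(2)] fR[of i] by (simp add: R_def)
  obtain z where z: "z \<in> R" "z \<noteq> 0"
      "\<And>f. f \<in> R \<Longrightarrow> f \<noteq> 0 \<Longrightarrow> - int (c + 1) \<le> u f + w f \<Longrightarrow> \<exists>h\<in>R. z = f * h"
    using bounded_codimension_common_multiple[OF uw, of "c + 1"] unfolding R_def[symmetric] by blast
  have bound: "0 \<le> v (f i) \<and> v (f i) \<le> v z" if v: "v \<in> \<V> - {u, w}" for v i
  proof -
    have "- int (c + 1) \<le> u (f i) + w (f i)" using fu[of i] fw[of i] by simp
    then obtain h where h: "h \<in> R" "z = f i * h" using z(3)[OF fR f(2)] by blast
    have "h \<noteq> 0" using h z(2) by auto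
    thus ?thesis using h fR[of i] v f(2)[of i] by (auto simp: R_def vge_def val_mult)
  qed
  define Z where "Z = {v \<in> \<V>. v z \<noteq> 0} - {u, w}"
  have finZ: "finite Z" unfolding Z_def using finite_support_val[OF z(2)] by simp
  define r where "r i = restrict (\<lambda>v. v (f i)) Z" for i
  have Z: "v \<in> \<V> - {u, w}" if "v \<in> Z" for v using that by (simp add: Z_def)
  have "r i \<in> PiE Z (\<lambda>v. {0..v z})" for i
  proof (rule PiE_I)
    show "r i v \<in> {0..v z}" if "v \<in> Z" for v using bound[OF Z[OF that], of i] that by (simp add: r_def)
    show "r i v = undefined" if "v \<notin> Z" for v using that by (simp add: r_def)
  qed
  hence "range r \<subseteq> PiE Z (\<lambda>v. {0..v z})" by blast
  hence "finite (range r)" by (rule finite_subset) (intro finite_PiE finZ, auto)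
  hence "\<not> inj r" using finite_imageD by blast
  then obtain i j where ij: "r i = r j" "i < j" by (metis injI linorder_neqE_nat)
  define g where "g = f j / f i"
  have g0: "g \<noteq> 0" using f(2) by (simp add: g_def)
  have gv: "v g = 0" if v: "v \<in> \<V> - {u, w}" for v
  proof -
    have "v (f i) = v (f j)"
    proof (cases "v \<in> Z")
      case True
      thus ?thesis using fun_cong[OF ij(1), of v] by (simp add: r_def)
    next
      case False
      hence "v z = 0" using v by (auto simp: Z_def)
      thus ?thesis using bound[OF v, of i] bound[OF v, of j] by simp
    qed
    thus ?thesis using v f(2) by (simp add: g_def val_divide)
  qed
  have "u g + w g \<le> 0"
  proof (rule two_point_val_sum[OF uw g0])
    fix v assume "v \<in> \<V> - {u, w}"
    from gv[OF this] show "vge v 0 g" by (simp add: vge_def)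
  qed
  moreover have "u (inverse g) + w (inverse g) \<le> 0"
  proof (rule two_point_val_sum[OF uw])
    fix v assume v: "v \<in> \<V> - {u, w}"
    show "vge v 0 (inverse g)" using gv[OF v] v g0 by (simp add: vge_def val_inverse)
  qed (use g0 in simp)
  ultimately have sum0: "u g + w g = 0" using g0 uw by (simp add: val_inverse)
  have "w (f i) \<le> int (N i) + int c + 1" using fu[of i] fuw[of i] by linarith
  also have "\<dots> < int (N j)"
  proof -
    have "(i + 1) * (c + 2) \<le> j * (c + 2)" using ij(2) by (intro mult_right_mono) auto
    hence "N i + c + 1 < N j" by (simp add: N_def algebra_simps)
    thus ?thesis by linarith
  qed
  also have "\<dots> \<le> w (f j)" by (rule fw)
  finally have "0 < w g" using uw f(2) by (simp add: g_def val_divide)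
  thus ?thesis using sum0 g0 gv uw
    by (intro exI[of _ "inverse g"] exI[of _ "w g"]) (auto simp: val_inverse)
qed

end

section \<open>Extension of partial homomorphisms to valuation rings\<close>

text \<open>
  The graph of a ring homomorphism from a subring of one field to another field. Working with graphs rather
  than with pairs of a subring and a map makes extension the same as inclusion, so that unions of chains need
  no gluing.
\<close>

definition ring_graph :: "('k::field \<times> 'b::field) set \<Rightarrow> bool" where
  "ring_graph G \<longleftrightarrow> (1, 1) \<in> G \<and>
     (\<forall>a p b q. (a, p) \<in> G \<longrightarrow> (b, q) \<in> G \<longrightarrow> (a - b, p - q) \<in> G \<and> (a * b, p * q) \<in> G) \<and>
     (\<forall>p. (0, p) \<in> G \<longrightarrow> p = 0)"

lemma ring_graphD:
  assumes "ring_graph G"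
  shows "(1, 1) \<in> G" "(0, 0) \<in> G" "(0, p) \<in> G \<Longrightarrow> p = 0"
    "(a, p) \<in> G \<Longrightarrow> (b, q) \<in> G \<Longrightarrow> (a - b, p - q) \<in> G"
    "(a, p) \<in> G \<Longrightarrow> (b, q) \<in> G \<Longrightarrow> (a + b, p + q) \<in> G"
    "(a, p) \<in> G \<Longrightarrow> (b, q) \<in> G \<Longrightarrow> (a * b, p * q) \<in> G"
    "(a, p) \<in> G \<Longrightarrow> (- a, - p) \<in> G"
    "(a, p) \<in> G \<Longrightarrow> (a, q) \<in> G \<Longrightarrow> p = q"
proof -
  have diff: "(a - b, p - q) \<in> G" if "(a, p) \<in> G" "(b, q) \<in> G" for a b p q
    using assms that unfolding ring_graph_def by blast
  show 1: "(1, 1) \<in> G" and sv: "(0, p) \<in> G \<Longrightarrow> p = 0" for p using assms by (auto simp: ring_graph_def)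
  show 0: "(0, 0) \<in> G" using diff[OF 1 1] by simp
  have neg: "(- a, - p) \<in> G" if "(a, p) \<in> G" for a p using diff[OF 0 that] by simp
  show "(a, p) \<in> G \<Longrightarrow> (b, q) \<in> G \<Longrightarrow> (a - b, p - q) \<in> G" by (rule diff)
  show "(a, p) \<in> G \<Longrightarrow> (- a, - p) \<in> G" by (rule neg)
  show "(a, p) \<in> G \<Longrightarrow> (b, q) \<in> G \<Longrightarrow> (a + b, p + q) \<in> G" using diff[of a p "- b" "- q"] neg[of b q] by simp
  show "(a, p) \<in> G \<Longrightarrow> (b, q) \<in> G \<Longrightarrow> (a * b, p * q) \<in> G" using assms unfolding ring_graph_def by blast
  show "(a, p) \<in> G \<Longrightarrow> (a, q) \<in> G \<Longrightarrow> p = q" using diff[of a p a q] sv[of "p - q"] by simp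
qed

lemma ring_graph_power: "ring_graph G \<Longrightarrow> (a, p) \<in> G \<Longrightarrow> (a ^ n, p ^ n) \<in> G"
  by (induction n) (auto intro: ring_graphD)

lemma ring_graph_sum:
  "ring_graph G \<Longrightarrow> (\<And>i. i \<in> I \<Longrightarrow> (f i, g i) \<in> G) \<Longrightarrow> (sum f I, sum g I) \<in> G"
  by (induction I rule: infinite_finite_induct) (auto intro: ring_graphD)

lemma ring_graph_prod:
  "ring_graph G \<Longrightarrow> (\<And>i. i \<in> I \<Longrightarrow> (f i, g i) \<in> G) \<Longrightarrow> (prod f I, prod g I) \<in> G"
  by (induction I rule: infinite_finite_induct) (auto intro: ring_graphD)

definition poly_graph :: "('k::field \<times> 'b::field) set \<Rightarrow> ('k poly \<times> 'b poly) set" where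
  "poly_graph G = {(p, q). \<forall>i. (coeff p i, coeff q i) \<in> G}"

lemma poly_graph_diff:
  "ring_graph G \<Longrightarrow> (p, q) \<in> poly_graph G \<Longrightarrow> (p', q') \<in> poly_graph G \<Longrightarrow> (p - p', q - q') \<in> poly_graph G"
  by (auto simp: poly_graph_def intro: ring_graphD)

lemma poly_graph_mult:
  "ring_graph G \<Longrightarrow> (p, q) \<in> poly_graph G \<Longrightarrow> (p', q') \<in> poly_graph G \<Longrightarrow> (p * p', q * q') \<in> poly_graph G"
  by (auto simp: poly_graph_def coeff_mult intro!: ring_graph_sum ring_graphD(6))

lemma poly_graph_monom: "ring_graph G \<Longrightarrow> (a, b) \<in> G \<Longrightarrow> (monom a n, monom b n) \<in> poly_graph G"
  by (auto simp: poly_graph_def intro: ring_graphD)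

definition maximal_ring_graph :: "('k::field \<times> 'b::field) set \<Rightarrow> bool" where
  "maximal_ring_graph G \<longleftrightarrow> ring_graph G \<and> (\<forall>H. ring_graph H \<longrightarrow> G \<subseteq> H \<longrightarrow> H = G)"

lemma maximal_ring_graph_exists:
  assumes "ring_graph G0"
  shows "\<exists>G. maximal_ring_graph G \<and> G0 \<subseteq> G"
proof -
  define A where "A = {G. ring_graph G \<and> G0 \<subseteq> G}"
  have "\<exists>M\<in>A. \<forall>N\<in>A. M \<subseteq> N \<longrightarrow> N = M"
  proof (rule subset_Zorn_nonempty)
    show "A \<noteq> {}" using assms by (auto simp: A_def)
    fix \<C> assume C: "\<C> \<noteq> {}" "subset.chain A \<C>"
    have two: "\<exists>G\<in>\<C>. x \<in> G \<and> y \<in> G" if "x \<in> \<Union>\<C>" "y \<in> \<Union>\<C>" for x y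
      using that C(2) unfolding subset_chain_def A_def by blast
    have rg: "ring_graph G" if "G \<in> \<C>" for G using C(2) that unfolding subset_chain_def A_def by blast
    obtain G1 where G1: "G1 \<in> \<C>" using C(1) by blast
    have "ring_graph (\<Union>\<C>)"
      unfolding ring_graph_def
    proof (intro conjI allI impI)
      show "(1, 1) \<in> \<Union>\<C>" using ring_graphD(1)[OF rg[OF G1]] G1 by blast
    next
      fix a p b q assume "(a, p) \<in> \<Union>\<C>" "(b, q) \<in> \<Union>\<C>"
      from two[OF this] obtain G where G: "G \<in> \<C>" "(a, p) \<in> G" "(b, q) \<in> G" by blast
      show "(a - b, p - q) \<in> \<Union>\<C>" "(a * b, p * q) \<in> \<Union>\<C>"
        using ring_graphD(4,6)[OF rg[OF G(1)] G(2,3)] G(1) by blast+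
    next
      fix p assume "(0, p) \<in> \<Union>\<C>"
      thus "p = 0" using ring_graphD(3) rg by blast
    qed
    moreover have "G0 \<subseteq> \<Union>\<C>" using C unfolding subset_chain_def A_def by blast
    ultimately show "\<Union>\<C> \<in> A" by (simp add: A_def)
  qed
  then obtain M where M: "M \<in> A" "\<And>N. N \<in> A \<Longrightarrow> M \<subseteq> N \<Longrightarrow> N = M" by blast
  have "H = M" if H: "ring_graph H" "M \<subseteq> H" for H
  proof (rule M(2))
    show "H \<in> A" using H M(1) unfolding A_def by blast
  qed (rule H(2))
  moreover have "ring_graph M" "G0 \<subseteq> M" using M(1) by (simp_all add: A_def)
  ultimately show ?thesis unfolding maximal_ring_graph_def by metis
qed

text \<open>
  If \<open>c\<close> is a root of the image of every relation satisfied by \<open>x\<close>, then \<open>p(x)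
  \<mapsto> q(c)\<close> is a well-defined extension, which maximality forces to be trivial.
\<close>

lemma maximal_ring_graph_adjoin:
  assumes max: "maximal_ring_graph G"
    and root: "\<And>p q. (p, q) \<in> poly_graph G \<Longrightarrow> poly p x = 0 \<Longrightarrow> poly q c = 0"
  shows "(x, c) \<in> G"
proof -
  have G: "ring_graph G" using max by (simp add: maximal_ring_graph_def)
  define H where "H = {(poly p x, poly q c) | p q. (p, q) \<in> poly_graph G}"
  have HI: "(poly p x, poly q c) \<in> H" if "(p, q) \<in> poly_graph G" for p q using that by (auto simp: H_def)
  have "ring_graph H"
    unfolding ring_graph_def
  proof (intro conjI allI impI)
    show "(1, 1) \<in> H" using HI[OF poly_graph_monom[OF G ring_graphD(1)[OF G], of 0]] by (simp add: poly_monom)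
  next
    fix a p b q assume "(a, p) \<in> H" "(b, q) \<in> H"
    then obtain r s r' s' where *: "a = poly r x" "p = poly s c" "(r, s) \<in> poly_graph G"
       "b = poly r' x" "q = poly s' c" "(r', s') \<in> poly_graph G" unfolding H_def by blast
    show "(a - b, p - q) \<in> H" using HI[OF poly_graph_diff[OF G *(3,6)]] by (simp add: *)
    show "(a * b, p * q) \<in> H" using HI[OF poly_graph_mult[OF G *(3,6)]] by (simp add: *)
  next
    fix p assume "(0, p) \<in> H"
    thus "p = 0" unfolding H_def using root by force
  qed
  moreover have "G \<subseteq> H"
  proof clarify
    fix a b assume "(a, b) \<in> G"
    from HI[OF poly_graph_monom[OF G this, of 0]] show "(a, b) \<in> H" by (simp add: poly_monom)
  qed
  ultimately have "H = G" using max by (simp add: maximal_ring_graph_def)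
  thus ?thesis using HI[OF poly_graph_monom[OF G ring_graphD(1)[OF G], of 1]] by (simp add: poly_monom)
qed

text \<open>
  The value of \<open>1 / a\<close> can be prescribed as \<open>1 / l\<close>: a relation for \<open>1 /
  a\<close>, multiplied by a power of \<open>a\<close>, becomes an identity inside the domain, whose image is
  the relation required of \<open>1 / l\<close>.
\<close>

lemma maximal_ring_graph_inverse:
  assumes max: "maximal_ring_graph G" and al: "(a, l) \<in> G" "l \<noteq> 0"
  shows "(inverse a, inverse l) \<in> G"
proof (rule maximal_ring_graph_adjoin[OF max])
  fix p q assume pq: "(p, q) \<in> poly_graph G" and 0: "poly p (inverse a) = 0"
  have G: "ring_graph G" using max by (simp add: maximal_ring_graph_def)
  have a: "a \<noteq> 0" using ring_graphD(3)[OF G] al by blast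
  define n where "n = max (degree p) (degree q)"
  have clear: "(\<Sum>i\<le>n. coeff r i * b ^ (n - i)) = b ^ n * poly r (inverse b)"
    if "b \<noteq> 0" "degree r \<le> n" for b :: "'c::field" and r
  proof -
    have "b ^ (n - i) = b ^ n * inverse b ^ i" if "i \<le> n" for i
      using that \<open>b \<noteq> 0\<close> by (simp add: power_diff power_inverse field_class.field_divide_inverse)
    moreover have "poly r (inverse b) = (\<Sum>i\<le>n. coeff r i * inverse b ^ i)"
      unfolding poly_altdef using that(2) by (intro sum.mono_neutral_left) (auto simp: coeff_eq_0)
    ultimately show ?thesis by (simp add: sum_distrib_left mult_ac)
  qed
  have "((\<Sum>i\<le>n. coeff p i * a ^ (n - i)), (\<Sum>i\<le>n. coeff q i * l ^ (n - i))) \<in> G"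
    using pq by (intro ring_graph_sum G ring_graphD(6)[OF G] ring_graph_power al) (auto simp: poly_graph_def)
  hence "(0, l ^ n * poly q (inverse l)) \<in> G"
    using clear[OF a, of p] clear[OF al(2), of q] 0 by (simp add: n_def)
  thus "poly q (inverse l) = 0" using ring_graphD(3)[OF G] al(2) by fastforce
qed

text \<open>
  The images of the relations of \<open>x\<close> form an ideal of polynomials over a subfield of the
  codomain. A generator has minimal degree; if this degree is positive, a root of the generator is an
  admissible value for \<open>x\<close>. Otherwise some relation has a nonzero constant as its image, and
  normalizing it writes \<open>1\<close> as a polynomial in \<open>x\<close> with coefficients in the kernel.
\<close>

lemma maximal_ring_graph_alternative:
  fixes G :: "('k::field \<times> 'b::alg_closed_field) set"
  assumes max: "maximal_ring_graph G" and nin: "\<And>c. (x, c) \<notin> G"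
  shows "\<exists>m n. (\<forall>i. (m i, 0) \<in> G) \<and> (\<Sum>i\<le>n. m i * x ^ i) = 1"
proof -
  have G: "ring_graph G" using max by (simp add: maximal_ring_graph_def)
  define I where "I = {(p, q). (p, q) \<in> poly_graph G \<and> poly p x = 0 \<and> q \<noteq> 0}"
  have "I \<noteq> {}"
  proof
    assume "I = {}"
    hence "q = 0" if "(p, q) \<in> poly_graph G" "poly p x = 0" for p q using that by (auto simp: I_def)
    hence "poly q 0 = 0" if "(p, q) \<in> poly_graph G" "poly p x = 0" for p q using that by fastforce
    hence "(x, 0) \<in> G" by (rule maximal_ring_graph_adjoin[OF max])
    thus False using nin by blast
  qed
  then obtain p0 q0 where "(p0, q0) \<in> I" by auto
  hence "\<exists>d. \<exists>(p, q)\<in>I. degree q = d" by blast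
  then obtain d where d: "\<exists>(p, q)\<in>I. degree q = d" "\<And>d'. d' < d \<Longrightarrow> \<not> (\<exists>(p, q)\<in>I. degree q = d')"
    using exists_least_iff[of "\<lambda>d. \<exists>(p, q)\<in>I. degree q = d"] by blast
  obtain p q where pq: "(p, q) \<in> I" "degree q = d" using d(1) by blast
  hence PG: "(p, q) \<in> poly_graph G" "poly p x = 0" "q \<noteq> 0" by (auto simp: I_def)
  have "d = 0"
  proof (rule ccontr)
    assume "d \<noteq> 0"
    then obtain c where c: "poly q c = 0" using alg_closed_imp_poly_has_root[of q] pq(2) by auto
    have lq: "(coeff p d, coeff q d) \<in> G" "coeff q d \<noteq> 0" using PG pq(2) by (auto simp: poly_graph_def)
    have "poly q' c = 0" if "(p', q') \<in> poly_graph G" "poly p' x = 0" for p' q'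
      using that
    proof (induction "degree q'" arbitrary: p' q' rule: less_induct)
      case less
      show ?case
      proof (cases "q' = 0")
        case False
        define d' where "d' = degree q'"
        have "d \<le> d'" using d(2)[of d'] less.prems False by (force simp: I_def d'_def)
        define r where "r = (coeff p' d' * inverse (coeff p d), coeff q' d' * inverse (coeff q d))"
        have r: "(fst r, snd r) \<in> G"
          using maximal_ring_graph_inverse[OF max lq] less.prems(1)
          by (auto simp: r_def poly_graph_def intro!: ring_graphD(6)[OF G])
        define p'' where "p'' = p' - monom (fst r) (d' - d) * p"
        define q'' where "q'' = q' - monom (snd r) (d' - d) * q"
        have pq'': "(p'', q'') \<in> poly_graph G" unfolding p''_def q''_def
          by (intro poly_graph_diff poly_graph_mult poly_graph_monom G r PG less.prems)
        have p''0: "poly p'' x = 0" using less.prems(2) PG(2) by (simp add: p''_def)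
        have q''c: "poly q'' c = poly q' c" using c by (simp add: q''_def)
        show ?thesis
        proof (cases "degree q'' < d'")
          case True
          thus ?thesis using less.hyps[OF _ pq'' p''0] q''c by (simp add: d'_def)
        next
          case ge: False
          have "degree (monom (snd r) (d' - d) * q) \<le> (d' - d) + d"
            using degree_mult_le[of "monom (snd r) (d' - d)" q] degree_monom_le[of "snd r" "d' - d"] pq(2) by linarith
          hence "degree q'' \<le> d'" unfolding q''_def using \<open>d \<le> d'\<close> by (intro degree_diff_le) (auto simp: d'_def)
          hence deg: "degree q'' = d'" using ge by simp
          have "coeff (monom (snd r) (d' - d) * q) d' = snd r * coeff q d"
            using \<open>d \<le> d'\<close> by (simp add: coeff_monom_mult)
          hence "coeff q'' d' = 0" using lq(2) by (simp add: q''_def r_def)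
          hence "q'' = 0" using deg by (metis leading_coeff_0_iff)
          thus ?thesis using q''c by simp
        qed
      qed auto
    qed
    hence "(x, c) \<in> G" by (rule maximal_ring_graph_adjoin[OF max])
    thus False using nin by blast
  qed
  define l where "l = coeff q 0"
  have l: "l \<noteq> 0" using PG(3) pq(2) \<open>d = 0\<close> unfolding l_def by (metis leading_coeff_0_iff)
  have q: "coeff q i = (if i = 0 then l else 0)" for i
    using pq(2) \<open>d = 0\<close> by (auto simp: l_def coeff_eq_0)
  have p0: "(coeff p 0, l) \<in> G" and pi: "\<And>i. i > 0 \<Longrightarrow> (coeff p i, 0) \<in> G"
    using PG(1) q by (auto simp: poly_graph_def) (metis not_gr_zero)+
  have p00: "coeff p 0 \<noteq> 0" using ring_graphD(3)[OF G] p0 l by metis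
  have inv: "(inverse (coeff p 0), inverse l) \<in> G" by (rule maximal_ring_graph_inverse[OF max p0 l])
  define m where "m i = (if i = 0 then 0 else - (inverse (coeff p 0) * coeff p i))" for i
  have "(m i, 0) \<in> G" for i
    using ring_graphD(7)[OF G ring_graphD(6)[OF G inv pi[of i]]] ring_graphD(2)[OF G] by (auto simp: m_def)
  moreover have "(\<Sum>i\<le>degree p. m i * x ^ i) = 1"
  proof -
    have "0 = inverse (coeff p 0) * (\<Sum>i\<le>degree p. coeff p i * x ^ i)" using PG(2) by (simp add: poly_altdef)
    also have "\<dots> = (\<Sum>i\<le>degree p. (if i = 0 then 1 else 0) - m i * x ^ i)"
      unfolding sum_distrib_left using p00 by (intro sum.cong) (auto simp: m_def)
    also have "\<dots> = 1 - (\<Sum>i\<le>degree p. m i * x ^ i)" by (simp add: sum_subtractf)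
    finally show ?thesis by simp
  qed
  ultimately show ?thesis by blast
qed

text \<open>
  If neither \<open>x\<close> nor \<open>1 / x\<close> belongs to the domain, then \<open>1\<close> is a
  polynomial in either of them with coefficients in the kernel. With both degrees minimal, the relation of
  smaller degree can be used to shorten the other one.
\<close>

lemma maximal_ring_graph_valuation:
  fixes G :: "('k::field \<times> 'b::alg_closed_field) set"
  assumes max: "maximal_ring_graph G" and x: "x \<noteq> 0"
  shows "(\<exists>c. (x, c) \<in> G) \<or> (\<exists>c. (inverse x, c) \<in> G)"
proof (rule ccontr)
  assume no: "\<not> ?thesis"
  have G: "ring_graph G" using max by (simp add: maximal_ring_graph_def)
  define rel where "rel y n \<longleftrightarrow> (\<exists>m. (\<forall>i. (m i, 0) \<in> G) \<and> (\<Sum>i\<le>n. m i * y ^ i) = 1)" for y :: 'k and n :: nat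
  have shorten: "\<exists>k<n. rel y k" if y: "y \<noteq> 0" "rel y n" "rel (inverse y) n'" "n' \<le> n" for y n n'
  proof -
    obtain m m' where m: "\<And>i. (m i, 0) \<in> G" "(\<Sum>i\<le>n. m i * y ^ i) = 1"
      and m': "\<And>i. (m' i, 0) \<in> G" "(\<Sum>i\<le>n'. m' i * inverse y ^ i) = 1"
      using y unfolding rel_def by blast
    have n0: "n > 0"
    proof (rule ccontr)
      assume "\<not> n > 0"
      hence "(1, 0) \<in> G" using m by (metis atMost_0 bot_nat_0.not_eq_extremum empty_iff finite.emptyI mult.right_neutral power_0 sum.empty sum.insert add.right_neutral)
      thus False using ring_graphD(8)[OF G ring_graphD(1)[OF G]] by force
    qed
    define e where "e = inverse (1 - m' 0)"
    have e1: "(1 - m' 0, 1) \<in> G" using ring_graphD(4)[OF G ring_graphD(1)[OF G] m'(1)[of 0]] by simp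
    hence e: "(e, 1) \<in> G" using maximal_ring_graph_inverse[OF max e1] by (simp add: e_def)
    have ne: "1 - m' 0 \<noteq> 0" using ring_graphD(3)[OF G] e1 by (metis zero_neq_one)
    define f where "f j = (if j \<le> n' then e * m' j else 0)" for j
    have f: "(f j, 0) \<in> G" for j
      using ring_graphD(6)[OF G e m'(1)[of j]] ring_graphD(2)[OF G] by (simp add: f_def)
    have yn: "y ^ n = (\<Sum>i<n. f (n - i) * y ^ i)"
    proof -
      have "1 = m' 0 + (\<Sum>j=1..n'. m' j * inverse y ^ j)"
        using m'(2) by (simp add: atMost_atLeast0 sum.atLeast_Suc_atMost)
      hence "1 - m' 0 = (\<Sum>j=1..n'. m' j * inverse y ^ j)" by (simp add: algebra_simps)
      hence "1 = e * (\<Sum>j=1..n'. m' j * inverse y ^ j)" using ne by (metis e_def left_inverse)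
      also have "\<dots> = (\<Sum>j=1..n. f j * inverse y ^ j)"
        unfolding sum_distrib_left using y(4) by (intro sum.mono_neutral_cong_left) (auto simp: f_def)
      finally have "y ^ n = y ^ n * (\<Sum>j=1..n. f j * inverse y ^ j)" by simp
      also have "\<dots> = (\<Sum>j=1..n. f j * y ^ (n - j))"
        unfolding sum_distrib_left using y(1)
        by (intro sum.cong) (auto simp: power_diff power_inverse field_class.field_divide_inverse mult_ac)
      also have "\<dots> = (\<Sum>i<n. f (n - i) * y ^ i)"
        by (rule sum.reindex_bij_witness[where i = "\<lambda>i. n - i" and j = "\<lambda>j. n - j"]) auto
      finally show ?thesis .
    qed
    define m'' where "m'' i = m i + m n * f (n - i)" for i
    have "(m'' i, 0) \<in> G" for i
      using ring_graphD(5)[OF G m(1)[of i] ring_graphD(6)[OF G m(1)[of n] f[of "n - i"]]] by (simp add: m''_def)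
    moreover have "(\<Sum>i\<le>n - 1. m'' i * y ^ i) = 1"
    proof -
      have "{..n - 1} = {..<n}" using n0 by auto
      hence "(\<Sum>i\<le>n - 1. m'' i * y ^ i) = (\<Sum>i<n. m i * y ^ i) + m n * (\<Sum>i<n. f (n - i) * y ^ i)"
        by (simp add: m''_def algebra_simps sum.distrib sum_distrib_left)
      also have "\<dots> = 1" using m(2) by (simp add: yn[symmetric] lessThan_Suc_atMost[symmetric])
      finally show ?thesis .
    qed
    ultimately have "rel y (n - 1)" unfolding rel_def by blast
    thus ?thesis using n0 by (intro exI[of _ "n - 1"]) auto
  qed
  have ex: "\<exists>n. rel x n" "\<exists>n. rel (inverse x) n"
    using maximal_ring_graph_alternative[OF max, of x] maximal_ring_graph_alternative[OF max, of "inverse x"] no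
    unfolding rel_def by blast+
  define n where "n = (LEAST n. rel x n)"
  define n' where "n' = (LEAST n. rel (inverse x) n)"
  have n: "rel x n" "rel (inverse x) n'" using LeastI_ex[OF ex(1)] LeastI_ex[OF ex(2)] by (auto simp: n_def n'_def)
  show False
  proof (cases "n' \<le> n")
    case True
    from shorten[OF x n True] show False using not_less_Least unfolding n_def by blast
  next
    case False
    hence "\<exists>k<n'. rel (inverse x) k" using shorten[of "inverse x" n' n] n x by simp
    thus False using not_less_Least unfolding n'_def by blast
  qed
qed

section \<open>Local rings with principal maximal ideal\<close>

text \<open>
  A local ring presented by the graph of its evaluation homomorphism: \<open>Domain G\<close> is the ring and
  its maximal ideal, the kernel, is generated by \<open>t\<close>.
\<close>

locale discrete_place = const_embedding \<iota> for \<iota> :: "'a::{field,finite} \<Rightarrow> 'k::field" +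
  fixes G :: "('k \<times> 'a alg_closure) set" and t :: 'k
  assumes graph: "ring_graph G"
    and const_graph: "(\<iota> c, to_ac c) \<in> G"
    and graph_inverse: "(a, p) \<in> G \<Longrightarrow> p \<noteq> 0 \<Longrightarrow> (inverse a, inverse p) \<in> G"
    and graph_fraction: "\<exists>a b. a \<in> Domain G \<and> b \<in> Domain G \<and> b \<noteq> 0 \<and> h = a / b"
    and max_ideal_principal: "(a, 0) \<in> G \<longleftrightarrow> (\<exists>h\<in>Domain G. a = t * h)"
    and dependence: "algebraic_over_gen \<iota> a b"
    and exists_transcendental: "\<exists>x. transcendental_over \<iota> x"
begin

abbreviation "R \<equiv> Domain G"

lemmas graph_simps = ring_graphD[OF graph]

lemma R_1: "1 \<in> R" using graph_simps(1) by blast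
lemma R_const: "\<iota> c \<in> R" using const_graph by blast
lemma R_add: "a \<in> R \<Longrightarrow> b \<in> R \<Longrightarrow> a + b \<in> R" using graph_simps(5) by blast
lemma R_mult: "a \<in> R \<Longrightarrow> b \<in> R \<Longrightarrow> a * b \<in> R" using graph_simps(6) by blast
lemma R_minus: "a \<in> R \<Longrightarrow> - a \<in> R" using graph_simps(7) by blast
lemma R_power: "a \<in> R \<Longrightarrow> a ^ n \<in> R" by (induction n) (auto intro: R_1 R_mult)
lemma R_sum: "(\<And>i. i \<in> I \<Longrightarrow> f i \<in> R) \<Longrightarrow> sum f I \<in> R"
  by (induction I rule: infinite_finite_induct) (use R_const[of 0] in \<open>auto intro: R_add\<close>)

lemma t_graph: "(t, 0) \<in> G"
  using max_ideal_principal[of t] R_1 by force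

lemma t_R: "t \<in> R" using t_graph by blast

lemma ev_R: "a \<in> R \<Longrightarrow> ev a p \<in> R"
  unfolding ev_altdef[OF order.refl] by (intro R_sum R_mult R_const R_power)

definition runit :: "'k \<Rightarrow> bool" where
  "runit u \<longleftrightarrow> u \<in> R \<and> inverse u \<in> R \<and> u \<noteq> 0"

lemma runit_graph: assumes "(u, p) \<in> G" "p \<noteq> 0" shows "runit u"
  using graph_inverse[OF assms] assms graph_simps(3) unfolding runit_def by blast

lemma runit_iff: "runit u \<longleftrightarrow> u \<in> R \<and> (u, 0) \<notin> G"
proof
  assume u: "runit u"
  then obtain q where q: "(inverse u, q) \<in> G" by (auto simp: runit_def)
  show "u \<in> R \<and> (u, 0) \<notin> G"
  proof
    show "(u, 0) \<notin> G"
    proof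
      assume "(u, 0) \<in> G"
      from graph_simps(6)[OF this q] have "(1, 0) \<in> G" using u by (simp add: runit_def)
      thus False using graph_simps(8)[OF graph_simps(1)] by force
    qed
  qed (use u in \<open>simp add: runit_def\<close>)
next
  assume u: "u \<in> R \<and> (u, 0) \<notin> G"
  then obtain p where "(u, p) \<in> G" by blast
  thus "runit u" using runit_graph[of u p] u by metis
qed

lemma runit_1: "runit 1" using R_1 by (simp add: runit_def)
lemma runit_mult: "runit a \<Longrightarrow> runit b \<Longrightarrow> runit (a * b)"
  by (auto simp: runit_def R_mult)
lemma runit_inverse: "runit a \<Longrightarrow> runit (inverse a)" by (auto simp: runit_def)
lemma runit_power: "runit a \<Longrightarrow> runit (a ^ n)" by (induction n) (auto intro: runit_1 runit_mult)

lemma runit_powi: "runit a \<Longrightarrow> runit (a powi n)"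
  by (cases n rule: int_cases2) (auto simp: power_int_minus intro: runit_power runit_inverse)

text \<open>
  If \<open>t\<close> were \<open>0\<close>, the ring would be the whole field and would embed into the
  algebraic closure of the constants, although it contains a transcendental element.
\<close>

lemma t_nonzero: "t \<noteq> 0"
proof
  assume t0: "t = 0"
  have field: "h \<in> R" for h
  proof -
    obtain a b where ab: "a \<in> R" "b \<in> R" "b \<noteq> 0" "h = a / b" using graph_fraction by blast
    hence "(b, 0) \<notin> G" using max_ideal_principal[of b] t0 by auto
    hence "runit b" using ab by (simp add: runit_iff)
    thus "h \<in> R" using ab by (simp add: runit_def R_mult field_class.field_divide_inverse)
  qed
  obtain x where x: "transcendental_over \<iota> x" using exists_transcendental by blast
  obtain c where c: "(x, c) \<in> G" using field[of x] by blast
  obtain p where p: "p \<noteq> 0" "poly (map_poly to_ac p) c = 0"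
    using alg_closure_algebraic[of c] by metis
  have "ring_hom_map (to_ac :: 'a \<Rightarrow> 'a alg_closure)" by (simp add: ring_hom_map_def)
  from poly_map_poly_altdef[OF this order.refl, of p c]
  have "(ev x p, poly (map_poly to_ac p) c) \<in> G"
    unfolding ev_altdef[OF order.refl]
    by (simp only:) (intro ring_graph_sum graph graph_simps(6) const_graph ring_graph_power c)
  hence "ev x p = 0" using max_ideal_principal[of "ev x p"] p(2) t0 by auto
  thus False using x p(1) unfolding transcendental_iff by blast
qed

lemma poly_split_order:
  fixes p :: "'r::comm_ring_1 poly"
  assumes "p \<noteq> 0"
  shows "\<exists>k q. p = monom 1 k * q \<and> coeff q 0 \<noteq> 0"
  using assms
proof (induction p)
  case (pCons a p)
  show ?case
  proof (cases "a = 0")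
    case False
    thus ?thesis by (intro exI[of _ 0] exI[of _ "pCons a p"]) simp
  next
    case True
    then obtain k q where "p = monom 1 k * q" "coeff q 0 \<noteq> 0" using pCons by auto
    thus ?thesis using True by (intro exI[of _ "Suc k"] exI[of _ q]) (auto simp: monom_Suc)
  qed
qed auto

text \<open>
  After splitting off a power of \<open>t\<close>, the constant term is nonzero, so the remaining factor does
  not lie in the maximal ideal.
\<close>

lemma ev_t: assumes "p \<noteq> 0" shows "\<exists>k u. runit u \<and> ev t p = t ^ k * u"
proof -
  obtain k q where q: "p = monom 1 k * q" "coeff q 0 \<noteq> 0" using poly_split_order[OF assms] by blast
  have "(ev t q, to_ac (coeff q 0)) \<in> G"
  proof (cases q)
    case (pCons c r)
    have "(t * ev t r, 0) \<in> G" using max_ideal_principal[of "t * ev t r"] ev_R[OF t_R] by blast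
    from graph_simps(5)[OF const_graph this] show ?thesis using pCons by simp
  qed
  hence "runit (ev t q)" using runit_graph q(2) by simp
  thus ?thesis using q by (intro exI[of _ k] exI[of _ "ev t q"]) simp
qed

text \<open>
  The algebraic dependence of \<open>f\<close> and \<open>t\<close>, divided by a power of \<open>f\<close>,
  expresses a nonzero polynomial in \<open>t\<close> as a multiple of \<open>f\<close>; and a nonzero
  polynomial in \<open>t\<close> is a unit times a power of \<open>t\<close>. This replaces the Noetherian
  property in showing that no nonzero element is divisible by all powers of \<open>t\<close>.
\<close>

lemma divides_power_t:
  assumes f: "f \<in> R" "f \<noteq> 0"
  shows "\<exists>k. \<exists>h\<in>R. t ^ k = f * h"
proof -
  obtain P where P: "P \<noteq> 0" "poly (map_poly (ev t) P) f = 0"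
    using dependence[of t f] by (auto simp: algebraic_over_gen_iff)
  obtain s S where S: "P = monom 1 s * S" "coeff S 0 \<noteq> 0" using poly_split_order[OF P(1)] by blast
  note h = ring_hom_map_poly_eval[OF ev_hom, of t f]
  have "f ^ s * poly (map_poly (ev t) S) f = 0"
    using P(2) unfolding S(1) ring_hom_mapD(3)[OF h] by (simp add: map_poly_monom poly_monom)
  hence S0: "poly (map_poly (ev t) S) f = 0" using f(2) by simp
  obtain c S' where cS: "S = pCons c S'" by (cases S)
  have "ev t c + f * poly (map_poly (ev t) S') f = 0"
    using S0 unfolding cS poly_map_poly_pCons[OF ev_hom] .
  hence c: "ev t c = f * (- poly (map_poly (ev t) S') f)" by (simp add: eq_neg_iff_add_eq_0)
  have hR: "- poly (map_poly (ev t) S') f \<in> R"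
    unfolding poly_map_poly_altdef[OF ev_hom order.refl]
    by (intro R_minus R_sum R_mult ev_R t_R R_power f)
  obtain k u where u: "runit u" "ev t c = t ^ k * u" using ev_t[of c] S(2) cS by auto
  have "t ^ k = f * (- poly (map_poly (ev t) S') f * inverse u)"
    using u c by (simp add: runit_def field_simps)
  thus ?thesis using hR u(1) R_mult unfolding runit_def by blast
qed

lemma t_power_not_dividing: "h \<in> R \<Longrightarrow> t ^ k \<noteq> t ^ (k + Suc l) * h"
proof
  assume h: "h \<in> R" and eq: "t ^ k = t ^ (k + Suc l) * h"
  hence "t ^ k * 1 = t ^ k * (t * (t ^ l * h))" by (simp add: power_add mult_ac)
  hence one: "1 = t * (t ^ l * h)" using t_nonzero by simp
  have "(1, 0) \<in> G" using max_ideal_principal[of 1] one R_mult[OF R_power[OF t_R] h] by blast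
  thus False using runit_iff runit_1 by blast
qed

lemma regular_factorization:
  assumes f: "f \<in> R" "f \<noteq> 0"
  shows "\<exists>j u. runit u \<and> f = t ^ j * u"
proof -
  obtain k h where k: "h \<in> R" "t ^ k = f * h" using divides_power_t[OF f] by blast
  define P where "P j \<longleftrightarrow> (\<exists>g\<in>R. f = t ^ j * g)" for j
  have bound: "j \<le> k" if "P j" for j
  proof (rule ccontr)
    assume "\<not> j \<le> k"
    then obtain l where l: "j = k + Suc l" by (metis add_Suc_right less_imp_Suc_add not_le)
    from that obtain g where g: "g \<in> R" "f = t ^ j * g" unfolding P_def by blast
    have "t ^ k = t ^ (k + Suc l) * (g * h)" using g k l by (simp add: mult_ac)
    thus False using t_power_not_dividing R_mult g k by blast
  qed
  have "P 0" using f by (auto simp: P_def)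
  define j where "j = Greatest P"
  have j: "P j" unfolding j_def by (rule GreatestI_nat[of P 0 k]) (use bound \<open>P 0\<close> in auto)
  then obtain g where g: "g \<in> R" "f = t ^ j * g" by (auto simp: P_def)
  have "(g, 0) \<notin> G"
  proof
    assume "(g, 0) \<in> G"
    then obtain g' where "g' \<in> R" "g = t * g'" using max_ideal_principal by blast
    hence "P (Suc j)" using g by (auto simp: P_def mult_ac)
    hence "Suc j \<le> j" unfolding j_def by (rule Greatest_le_nat[of P _ k]) (use bound in auto)
    thus False by simp
  qed
  hence "runit g" using g runit_iff by blast
  thus ?thesis using g by blast
qed

lemma factorization:
  assumes f: "f \<noteq> 0"
  shows "\<exists>k u. runit u \<and> f = u * t powi k"
proof -
  obtain a b where ab: "a \<in> R" "b \<in> R" "b \<noteq> 0" "f = a / b" using graph_fraction by blast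
  have "a \<noteq> 0" using ab f by auto
  obtain i u where u: "runit u" "a = t ^ i * u" using regular_factorization ab \<open>a \<noteq> 0\<close> by blast
  obtain j w where w: "runit w" "b = t ^ j * w" using regular_factorization ab by blast
  have "f = (u * inverse w) * t powi (int i - int j)"
    using u w ab t_nonzero by (simp add: runit_def power_int_diff field_simps)
  thus ?thesis using u w runit_mult runit_inverse by blast
qed

lemma factorization_regular_iff:
  assumes "runit u"
  shows "u * t powi k \<in> R \<longleftrightarrow> 0 \<le> k"
proof
  assume "0 \<le> k"
  thus "u * t powi k \<in> R" using assms R_mult R_power[OF t_R] by (auto simp: power_int_def runit_def)
next
  assume R: "u * t powi k \<in> R"
  show "0 \<le> k"
  proof (rule ccontr)
    assume k: "\<not> 0 \<le> k"
    define l where "l = nat (- k) - 1"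
    have l: "nat (- k) = Suc l" using k by (simp add: l_def)
    have "inverse u * (u * t powi k) \<in> R" using R assms R_mult by (auto simp: runit_def)
    moreover have "inverse u * (u * t powi k) = inverse t ^ Suc l"
      using assms k l by (simp add: runit_def power_int_def flip: mult.assoc)
    ultimately have "inverse t ^ Suc l \<in> R" by simp
    hence "t ^ 0 \<noteq> t ^ (0 + Suc l) * inverse t ^ Suc l" by (rule t_power_not_dividing)
    thus False using t_nonzero by (simp add: power_mult_distrib[symmetric] del: power_Suc)
  qed
qed

lemma factorization_unique:
  assumes "runit u" "runit w" "u * t powi k = w * t powi l"
  shows "k = l"
proof -
  have 1: "(u * inverse w) * t powi (k - l) = 1" "(w * inverse u) * t powi (l - k) = 1"
    using assms t_nonzero by (auto simp: runit_def power_int_diff field_simps)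
  have "0 \<le> k - l" using factorization_regular_iff[of "u * inverse w" "k - l"] assms runit_mult runit_inverse R_1 1 by metis
  moreover have "0 \<le> l - k" using factorization_regular_iff[of "w * inverse u" "l - k"] assms runit_mult runit_inverse R_1 1 by metis
  ultimately show ?thesis by simp
qed

definition ord :: "'k \<Rightarrow> int" where
  "ord f = (THE k. \<exists>u. runit u \<and> f = u * t powi k)"

lemma ord_eqI: "runit u \<Longrightarrow> ord (u * t powi k) = k"
  unfolding ord_def using factorization_unique by (intro the_equality) blast+

lemma ord_factorization: "f \<noteq> 0 \<Longrightarrow> \<exists>u. runit u \<and> f = u * t powi ord f"
  using factorization ord_eqI by metis

lemma ord_mult: assumes "a \<noteq> 0" "b \<noteq> 0" shows "ord (a * b) = ord a + ord b"
proof -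
  obtain u w where uw: "runit u" "a = u * t powi ord a" "runit w" "b = w * t powi ord b"
    using ord_factorization assms by metis
  have "t powi ord a * t powi ord b = t powi (ord a + ord b)" by (simp add: power_int_add t_nonzero)
  hence "a * b = (u * w) * t powi (ord a + ord b)" using uw(2,4) by (metis mult.commute mult.left_commute)
  thus ?thesis using ord_eqI[OF runit_mult[OF uw(1,3)]] by metis
qed

lemma ord_regular_iff: "f \<noteq> 0 \<Longrightarrow> f \<in> R \<longleftrightarrow> 0 \<le> ord f"
  using ord_factorization factorization_regular_iff by metis

lemma ord_t: "ord t = 1"
  using ord_eqI[OF runit_1, of 1] by simp

lemma ord_t_powi: "ord (t powi k) = k"
  using ord_eqI[OF runit_1, of k] by simp

lemma ord_const: "c \<noteq> 0 \<Longrightarrow> ord (\<iota> c) = 0"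
  using ord_eqI[of "\<iota> c" 0] runit_graph[OF const_graph[of c]] by simp

lemma ord_max_ideal_iff: assumes "f \<noteq> 0" shows "(f, 0) \<in> G \<longleftrightarrow> 1 \<le> ord f"
proof -
  have "(f, 0) \<in> G \<longleftrightarrow> f / t \<in> R"
    using max_ideal_principal[of f] t_nonzero by (force simp: field_simps)
  also have "\<dots> \<longleftrightarrow> 0 \<le> ord (f / t)" using assms t_nonzero by (intro ord_regular_iff) auto
  also have "ord f = ord (f / t) + ord t" using ord_mult[of "f / t" t] assms t_nonzero by simp
  hence "0 \<le> ord (f / t) \<longleftrightarrow> 1 \<le> ord f" by (simp add: ord_t)
  finally show ?thesis .
qed

lemma ord_add:
  assumes "a \<noteq> 0" "b \<noteq> 0" "a + b \<noteq> 0"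
  shows "min (ord a) (ord b) \<le> ord (a + b)"
proof -
  define m where "m = min (ord a) (ord b)"
  define s where "s = t powi m"
  have s: "s \<noteq> 0" "ord s = m" using t_nonzero ord_t_powi by (auto simp: s_def)
  have q: "ord (x / s) = ord x - m" if "x \<noteq> 0" for x
    using ord_mult[of "x / s" s] that s by simp
  have "a / s \<in> R" "b / s \<in> R" using assms s q by (auto simp: ord_regular_iff m_def)
  hence "(a + b) / s \<in> R" using R_add by (simp add: add_divide_distrib)
  hence "0 \<le> ord (a + b) - m" using assms s q ord_regular_iff[of "(a + b) / s"] by simp
  thus ?thesis by (simp add: m_def)
qed

lemma ord_uniformizer_independent:
  assumes s: "s \<noteq> 0" "ord s = 1" and u: "runit u"
  shows "ord (u * s powi k) = k"
proof -
  obtain w where w: "runit w" "s = w * t powi 1" using ord_factorization[OF s(1)] s(2) by metis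
  have "u * s powi k = (u * w powi k) * t powi k" using w by (simp add: power_int_mult_distrib)
  thus ?thesis using ord_eqI runit_mult runit_powi u w by metis
qed

end

section \<open>Forms and their values at points\<close>

abbreviation "lk \<equiv> Poly_Mapping.lookup"
abbreviation "keys \<equiv> Poly_Mapping.keys"

definition monom_eval :: "(nat \<Rightarrow> 'b::comm_ring_1) \<Rightarrow> (nat \<Rightarrow>\<^sub>0 nat) \<Rightarrow> 'b" where
  "monom_eval v u = (\<Prod>i\<in>keys u. v i ^ lk u i)"

definition monom_degree :: "(nat \<Rightarrow>\<^sub>0 nat) \<Rightarrow> nat" where
  "monom_degree u = (\<Sum>i\<in>keys u. lk u i)"

lemma monom_eval_superset:
  "finite S \<Longrightarrow> keys u \<subseteq> S \<Longrightarrow> monom_eval v u = (\<Prod>i\<in>S. v i ^ lk u i)"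
  unfolding monom_eval_def by (rule prod.mono_neutral_left) (auto simp: in_keys_iff)

lemma monom_degree_superset:
  "finite S \<Longrightarrow> keys u \<subseteq> S \<Longrightarrow> monom_degree u = (\<Sum>i\<in>S. lk u i)"
  unfolding monom_degree_def by (rule sum.mono_neutral_left) (auto simp: in_keys_iff)

lemma monom_eval_add: "monom_eval v (u + u') = monom_eval v u * monom_eval v u'"
proof -
  let ?S = "keys u \<union> keys u'"
  have "keys (u + u') \<subseteq> ?S" by (rule Poly_Mapping.keys_add)
  thus ?thesis
    by (simp add: monom_eval_superset[of ?S] lookup_add power_add prod.distrib)
qed

lemma monom_degree_add: "monom_degree (u + u') = monom_degree u + monom_degree u'"
proof -
  let ?S = "keys u \<union> keys u'"
  have "keys (u + u') \<subseteq> ?S" by (rule Poly_Mapping.keys_add)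
  thus ?thesis
    by (simp add: monom_degree_superset[of ?S] lookup_add sum.distrib)
qed

lemma monom_eval_scale: "monom_eval (\<lambda>i. c * v i) u = c ^ monom_degree u * monom_eval v u"
  by (simp add: monom_eval_def monom_degree_def power_mult_distrib prod.distrib power_sum)

lemma mpoly_eval_superset:
  "\<phi> 0 = 0 \<Longrightarrow> finite S \<Longrightarrow> keys f \<subseteq> S \<Longrightarrow>
     mpoly_eval \<phi> v f = (\<Sum>u\<in>S. \<phi> (lk f u) * monom_eval v u)"
  unfolding mpoly_eval_def monom_eval_def[symmetric]
  by (rule sum.mono_neutral_left) (auto simp: in_keys_iff)

lemma mpoly_eval_single: "\<phi> 0 = 0 \<Longrightarrow> mpoly_eval \<phi> v (Poly_Mapping.single u c) = \<phi> c * monom_eval v u"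
  by (subst mpoly_eval_superset[of \<phi> "{u}"]) auto

lemma mpoly_eval_add:
  assumes "ring_hom_map \<phi>"
  shows "mpoly_eval \<phi> v (f + g) = mpoly_eval \<phi> v f + mpoly_eval \<phi> v g"
proof -
  let ?S = "keys f \<union> keys g"
  have "keys (f + g) \<subseteq> ?S" by (rule Poly_Mapping.keys_add)
  thus ?thesis
    by (simp add: mpoly_eval_superset[of \<phi> ?S] ring_hom_mapD[OF assms] lookup_add algebra_simps sum.distrib)
qed

lemma mpoly_eval_zero: "mpoly_eval \<phi> v 0 = 0"
  by (simp add: mpoly_eval_def)

lemma mpoly_eval_uminus:
  assumes "ring_hom_map \<phi>"
  shows "mpoly_eval \<phi> v (- f) = - mpoly_eval \<phi> v f"
  using mpoly_eval_add[OF assms, of v f "- f"] by (simp add: mpoly_eval_zero eq_neg_iff_add_eq_0 add.commute)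

lemma mpoly_eval_sum:
  assumes "ring_hom_map \<phi>"
  shows "mpoly_eval \<phi> v (sum F I) = (\<Sum>i\<in>I. mpoly_eval \<phi> v (F i))"
  by (induction I rule: infinite_finite_induct) (auto simp: mpoly_eval_zero mpoly_eval_add[OF assms])

lemma poly_mapping_eq_sum_single:
  "f = (\<Sum>u\<in>keys f. Poly_Mapping.single u (lk f u))"
proof (rule poly_mapping_eqI)
  fix k
  show "lk f k = lk (\<Sum>u\<in>keys f. Poly_Mapping.single u (lk f u)) k"
    by (simp add: lookup_sum lookup_single when_def in_keys_iff)
qed

lemma mpoly_eval_mult:
  fixes f g :: "'a::comm_ring_1 mpoly"
  assumes "ring_hom_map \<phi>"
  shows "mpoly_eval \<phi> v (f * g) = mpoly_eval \<phi> v f * mpoly_eval \<phi> v g"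
proof -
  note [simp] = ring_hom_mapD[OF assms]
  let ?m = "\<lambda>f u. Poly_Mapping.single u (lk f u)"
  have "f * g = (\<Sum>u\<in>keys f. ?m f u) * (\<Sum>w\<in>keys g. ?m g w)"
    using poly_mapping_eq_sum_single[of f] poly_mapping_eq_sum_single[of g] by simp
  also have "\<dots> = (\<Sum>u\<in>keys f. \<Sum>w\<in>keys g.
      Poly_Mapping.single (u + w) (lk f u * lk g w))"
    by (simp add: sum_product mult_single)
  finally have "mpoly_eval \<phi> v (f * g) = (\<Sum>u\<in>keys f. \<Sum>w\<in>keys g.
      \<phi> (lk f u) * \<phi> (lk g w) * monom_eval v (u + w))"
    by (simp add: mpoly_eval_sum[OF assms] mpoly_eval_single)
  also have "\<dots> = mpoly_eval \<phi> v f * mpoly_eval \<phi> v g"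
    unfolding mpoly_eval_def monom_eval_def[symmetric]
    by (simp add: sum_product monom_eval_add mult_ac)
  finally show ?thesis .
qed

lemma is_form_iff:
  "is_form n d f \<longleftrightarrow> (\<forall>u\<in>keys f. keys u \<subseteq> {..n} \<and> monom_degree u = d)"
  by (simp add: is_form_def monom_degree_def)

lemma is_form_add: "is_form n d f \<Longrightarrow> is_form n d g \<Longrightarrow> is_form n d (f + g)"
  unfolding is_form_iff using Poly_Mapping.keys_add[of f g] by blast

lemma is_form_uminus: "is_form n d f \<Longrightarrow> is_form n d (- f)"
  for f :: "'a::comm_ring_1 mpoly"
  unfolding is_form_iff by (simp add: in_keys_iff)

lemma is_form_diff: "is_form n d f \<Longrightarrow> is_form n d g \<Longrightarrow> is_form n d (f - g)"
  for f :: "'a::comm_ring_1 mpoly"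
  using is_form_add[of n d f "- g"] is_form_uminus[of n d g] by simp

lemma is_form_mult: "is_form n d f \<Longrightarrow> is_form n e g \<Longrightarrow> is_form n (d + e) (f * g)"
  for f :: "'a::comm_ring_1 mpoly"
  unfolding is_form_iff
proof
  fix w assume f: "\<forall>u\<in>keys f. keys u \<subseteq> {..n} \<and> monom_degree u = d"
    and g: "\<forall>u\<in>keys g. keys u \<subseteq> {..n} \<and> monom_degree u = e"
    and w: "w \<in> keys (f * g)"
  obtain a b where ab: "w = a + b" "a \<in> keys f" "b \<in> keys g"
    using w keys_mult[of f g] by blast
  show "keys w \<subseteq> {..n} \<and> monom_degree w = d + e"
    using f g ab Poly_Mapping.keys_add[of a b] by (simp add: monom_degree_add) blast
qed

definition var_power :: "nat \<Rightarrow> nat \<Rightarrow> 'a::comm_ring_1 mpoly" where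
  "var_power j d = Poly_Mapping.single (Poly_Mapping.single j d) 1"

lemma var_power_form: "j \<le> n \<Longrightarrow> is_form n d (var_power j d)"
  unfolding var_power_def is_form_iff
  by (auto simp: monom_degree_superset[of "{j}"] split: if_splits)

lemma mpoly_eval_var_power: "ring_hom_map \<phi> \<Longrightarrow> mpoly_eval \<phi> v (var_power j d) = v j ^ d"
  unfolding var_power_def by (simp add: mpoly_eval_single ring_hom_mapD monom_eval_superset[of "{j}"])

definition const_form :: "'a \<Rightarrow> 'a::comm_ring_1 mpoly" where
  "const_form c = Poly_Mapping.single 0 c"

lemma const_form_form: "is_form n 0 (const_form c)"
  unfolding const_form_def is_form_iff by (auto simp: monom_degree_def)

lemma mpoly_eval_const_form: "ring_hom_map \<phi> \<Longrightarrow> mpoly_eval \<phi> v (const_form c) = \<phi> c"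
  unfolding const_form_def by (simp add: mpoly_eval_single ring_hom_mapD monom_eval_def)

lemma mpoly_eval_form_scale:
  "is_form n d f \<Longrightarrow> mpoly_eval \<phi> (\<lambda>i. c * v i) f = c ^ d * mpoly_eval \<phi> v f"
  unfolding mpoly_eval_def monom_eval_def[symmetric] is_form_iff
  by (simp add: monom_eval_scale sum_distrib_left mult_ac)

lemma mpoly_eval_graph:
  assumes G: "ring_graph G" and c: "\<And>c. (\<phi> c, \<psi> c) \<in> G" and f: "is_form n d f" and ab: "\<And>i. i \<le> n \<Longrightarrow> (a i, b i) \<in> G"
  shows "(mpoly_eval \<phi> a f, mpoly_eval \<psi> b f) \<in> G"
  unfolding mpoly_eval_def
proof (intro ring_graph_sum[OF G] ring_graphD(6)[OF G] c ring_graph_prod[OF G] ring_graph_power[OF G] ab)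
  fix u i assume "u \<in> keys f" "i \<in> keys u"
  thus "i \<le> n" using f by (auto simp: is_form_def)
qed

lemma to_ac_hom: "ring_hom_map (to_ac :: 'a::field \<Rightarrow> 'a alg_closure)"
  by (simp add: ring_hom_map_def)

lemma proj_space_member:
  assumes "P \<in> proj_space n" "v \<in> P"
  shows "\<exists>i\<le>n. v i \<noteq> 0" "P = {w. \<exists>c. c \<noteq> 0 \<and> w = (\<lambda>i. c * v i)}"
    "\<And>i. n < i \<Longrightarrow> v i = 0"
proof -
  obtain v0 where v0: "\<exists>i. v0 i \<noteq> 0" "\<forall>i>n. v0 i = 0" "P = {w. \<exists>c. c \<noteq> 0 \<and> w = (\<lambda>i. c * v0 i)}"
    using assms(1) unfolding proj_space_def by (auto elim!: quotientE)
  obtain c where c: "c \<noteq> 0" "v = (\<lambda>i. c * v0 i)" using assms(2) v0(3) by blast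
  show "\<exists>i\<le>n. v i \<noteq> 0" using v0(1,2) c by (metis mult_eq_0_iff not_le)
  show "n < i \<Longrightarrow> v i = 0" for i using v0(2) c by simp
  have "\<exists>d. d \<noteq> 0 \<and> w = (\<lambda>i. d * v i)" if "e \<noteq> 0" "w = (\<lambda>i. e * v0 i)" for w e
    using that c by (intro exI[of _ "e / c"]) auto
  moreover have "\<exists>e. e \<noteq> 0 \<and> w = (\<lambda>i. e * v0 i)" if "d \<noteq> 0" "w = (\<lambda>i. d * v i)" for w d
    using that c by (intro exI[of _ "d * c"]) auto
  ultimately show "P = {w. \<exists>c. c \<noteq> 0 \<and> w = (\<lambda>i. c * v i)}" unfolding v0(3) by blast
qed

lemma quotient_point:
  "x \<in> A \<Longrightarrow> {w. \<exists>c. c \<noteq> 0 \<and> w = (\<lambda>i. c * x i)} \<in> A // {(v, w). \<exists>c. c \<noteq> 0 \<and> w = (\<lambda>i. c * v i)}"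
  for x :: "nat \<Rightarrow> 'b::field"
  using quotientI[of x A "{(v, w). \<exists>c. c \<noteq> 0 \<and> w = (\<lambda>i. c * v i)}"] by (simp add: Image_def)

lemma proj_space_nonempty: "P \<in> proj_space n \<Longrightarrow> \<exists>v. v \<in> P"
  unfolding proj_space_def by (auto elim!: quotientE intro!: exI[of _ 1])

lemma vanishes_at_iff:
  assumes "P \<in> proj_space n" "v \<in> P" "is_form n d f"
  shows "vanishes_at \<phi> f P \<longleftrightarrow> mpoly_eval \<phi> v f = 0"
proof
  assume "mpoly_eval \<phi> v f = 0"
  hence "mpoly_eval \<phi> (\<lambda>i. c * v i) f = 0" for c by (simp add: mpoly_eval_form_scale[OF assms(3)])
  thus "vanishes_at \<phi> f P" unfolding vanishes_at_def proj_space_member(2)[OF assms(1,2)] by blast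
qed (use assms in \<open>auto simp: vanishes_at_def\<close>)

section \<open>The places of a nonsingular curve\<close>

locale smooth_curve =
  fixes C :: "('a::{field,finite}, 'k::field) curve"
  assumes curve: "nonsingular_projective_curve C"
begin

abbreviation "cform \<equiv> is_form (ambient C)"
abbreviation "ac_val \<equiv> mpoly_eval to_ac"
abbreviation "places \<equiv> val_at C ` points C"

lemma const_hom: "ring_hom_map (const C)"
  using curve by (simp add: nonsingular_projective_curve_def is_function_field_def ring_hom_map_def)

sublocale const_embedding "const C"
  by unfold_locales (rule const_hom)

lemmas gen_hom_simps =
  mpoly_eval_add[OF const_hom] mpoly_eval_mult[OF const_hom] mpoly_eval_uminus[OF const_hom]
lemmas ac_hom_simps =
  mpoly_eval_add[OF to_ac_hom] mpoly_eval_mult[OF to_ac_hom] mpoly_eval_uminus[OF to_ac_hom]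

lemma gen_val_zero_iff: "cform d f \<Longrightarrow> gen_val C f = 0 \<longleftrightarrow> (\<forall>P\<in>points C. vanishes_at to_ac f P)"
  using curve unfolding nonsingular_projective_curve_def is_function_field_def by blast

lemma function_fraction:
  "\<exists>d f g. cform d f \<and> cform d g \<and> gen_val C g \<noteq> 0 \<and> h = gen_val C f / gen_val C g"
  using curve unfolding nonsingular_projective_curve_def is_function_field_def by blast

lemma points_proj: "P \<in> points C \<Longrightarrow> P \<in> proj_space (ambient C)"
  by (simp add: points_def zero_locus_def)

lemma alg_dep: "algebraic_over_gen (const C) a b"
  using curve algebraically_dependent_pair unfolding nonsingular_projective_curve_def dimension_one_def by blast

lemma ex_transcendental: "\<exists>x. transcendental_over (const C) x"
  using curve unfolding nonsingular_projective_curve_def dimension_one_def by blast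

text \<open>
  The evaluation of regular functions at the point with homogeneous coordinates \<open>v\<close>.
\<close>

definition local_graph :: "(nat \<Rightarrow> 'a alg_closure) \<Rightarrow> ('k \<times> 'a alg_closure) set" where
  "local_graph v = {(gen_val C f / gen_val C g, ac_val v f / ac_val v g) | d f g.
     cform d f \<and> cform d g \<and> ac_val v g \<noteq> 0}"

context
  fixes P v
  assumes P: "P \<in> points C" and v: "v \<in> P"
begin

lemma gen_val_nonzero:
  "cform d g \<Longrightarrow> ac_val v g \<noteq> 0 \<Longrightarrow> gen_val C g \<noteq> 0"
  using gen_val_zero_iff[of d g] vanishes_at_iff[OF points_proj[OF P] v, of d g to_ac] P by blast

lemma gen_val_zero_imp: "cform d g \<Longrightarrow> gen_val C g = 0 \<Longrightarrow> ac_val v g = 0"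
  using gen_val_nonzero by blast

lemma local_graphI:
  "cform d f \<Longrightarrow> cform d g \<Longrightarrow> ac_val v g \<noteq> 0 \<Longrightarrow>
   (gen_val C f / gen_val C g, ac_val v f / ac_val v g) \<in> local_graph v"
  unfolding local_graph_def by blast

lemma local_graphE:
  assumes "(a, p) \<in> local_graph v"
  obtains d f g where "cform d f" "cform d g" "ac_val v g \<noteq> 0"
    "gen_val C g \<noteq> 0" "a = gen_val C f / gen_val C g" "p = ac_val v f / ac_val v g"
  using assms gen_val_nonzero unfolding local_graph_def by blast

lemma local_graph_const: "(const C c, to_ac c) \<in> local_graph v"
  using local_graphI[OF const_form_form[of _ c] const_form_form[of _ 1]]
  by (simp add: gen_val_def mpoly_eval_const_form const_hom to_ac_hom)

text \<open>
  The value is well defined: a form that vanishes at the generic point vanishes at every point of the curve.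
\<close>

lemma ring_graph_local: "ring_graph (local_graph v)"
  unfolding ring_graph_def
proof (intro conjI allI impI)
  show "(1, 1) \<in> local_graph v" using local_graph_const[of 1] by simp
next
  fix a p b q assume "(a, p) \<in> local_graph v" "(b, q) \<in> local_graph v"
  then obtain d f g e h k where
    1: "cform d f" "cform d g" "ac_val v g \<noteq> 0"
      "gen_val C g \<noteq> 0" "a = gen_val C f / gen_val C g" "p = ac_val v f / ac_val v g" and
    2: "cform e h" "cform e k" "ac_val v k \<noteq> 0"
      "gen_val C k \<noteq> 0" "b = gen_val C h / gen_val C k" "q = ac_val v h / ac_val v k"
    by (elim local_graphE) blast
  have gk: "cform (d + e) (g * k)" "ac_val v (g * k) \<noteq> 0"
    using 1 2 by (auto intro: is_form_mult simp: ac_hom_simps)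
  have "cform (d + e) (f * k - g * h)" using 1 2 by (intro is_form_diff is_form_mult)
  from local_graphI[OF this gk] show "(a - b, p - q) \<in> local_graph v"
    using 1 2 unfolding gen_val_def diff_conv_add_uminus[of "f * k"] gen_hom_simps ac_hom_simps
    by (simp add: diff_frac_eq mult_ac)
  have "cform (d + e) (f * h)" using 1 2 by (intro is_form_mult)
  from local_graphI[OF this gk] show "(a * b, p * q) \<in> local_graph v"
    using 1 2 unfolding gen_val_def gen_hom_simps ac_hom_simps by simp
next
  fix p assume "(0, p) \<in> local_graph v"
  then obtain d f g where "cform d f" "gen_val C g \<noteq> 0" "0 = gen_val C f / gen_val C g"
     "p = ac_val v f / ac_val v g"
    by (elim local_graphE) blast
  thus "p = 0" using gen_val_zero_imp[of d f] by simp
qed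

lemma local_graph_inverse:
  assumes "(a, p) \<in> local_graph v" "p \<noteq> 0"
  shows "(inverse a, inverse p) \<in> local_graph v"
proof -
  obtain d f g where 1: "cform d f" "cform d g"
      "a = gen_val C f / gen_val C g" "p = ac_val v f / ac_val v g"
    using assms(1) by (elim local_graphE) blast
  thus ?thesis using local_graphI[OF 1(2,1)] assms(2) by auto
qed

lemma local_ring_eq: "local_ring C P = Domain (local_graph v)"
  unfolding local_ring_def local_graph_def using vanishes_at_iff[OF points_proj[OF P] v] by blast

lemma max_ideal_eq: "a \<in> max_ideal C P \<longleftrightarrow> (a, 0) \<in> local_graph v"
proof
  assume "a \<in> max_ideal C P"
  then obtain d f g where "cform d f" "cform d g" "\<not> vanishes_at to_ac g P"
      "vanishes_at to_ac f P" "a = gen_val C f / gen_val C g"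
    unfolding max_ideal_def by blast
  thus "(a, 0) \<in> local_graph v"
    using local_graphI[of d f g] vanishes_at_iff[OF points_proj[OF P] v, of d _ to_ac] by simp
next
  assume "(a, 0) \<in> local_graph v"
  then obtain d f g where 1: "cform d f" "cform d g" "ac_val v g \<noteq> 0"
      "a = gen_val C f / gen_val C g" "0 = ac_val v f / ac_val v g"
    by (elim local_graphE) blast
  hence "\<not> vanishes_at to_ac g P" "vanishes_at to_ac f P"
    using vanishes_at_iff[OF points_proj[OF P] v, of d _ to_ac] by auto
  thus "a \<in> max_ideal C P" unfolding max_ideal_def using 1 by blast
qed

lemma nonzero_coordinate: "\<exists>j\<le>ambient C. v j \<noteq> 0 \<and> coord C j \<noteq> 0"
proof -
  obtain j where j: "j \<le> ambient C" "v j \<noteq> 0" using proj_space_member(1)[OF points_proj[OF P] v] by blast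
  thus ?thesis using gen_val_nonzero[OF var_power_form[OF j(1), of 1]]
    by (auto simp: mpoly_eval_var_power to_ac_hom const_hom gen_val_def)
qed

lemma discrete_place_local:
  assumes t: "uniformizer C P t"
  shows "discrete_place (const C) (local_graph v) t"
proof unfold_locales
  show "ring_graph (local_graph v)" by (rule ring_graph_local)
  show "(const C c, to_ac c) \<in> local_graph v" for c by (rule local_graph_const)
  show "(inverse a, inverse p) \<in> local_graph v" if "(a, p) \<in> local_graph v" "p \<noteq> 0" for a p
    using local_graph_inverse that .
  show "\<exists>a b. a \<in> Domain (local_graph v) \<and> b \<in> Domain (local_graph v) \<and> b \<noteq> 0 \<and> h = a / b" for h
  proof -
    obtain d f g where h: "cform d f" "cform d g" "gen_val C g \<noteq> 0"
        "h = gen_val C f / gen_val C g"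
      using function_fraction by blast
    obtain j where j: "j \<le> ambient C" "v j \<noteq> 0" "coord C j \<noteq> 0" using nonzero_coordinate by blast
    have x: "gen_val C (var_power j d) \<noteq> 0" "ac_val v (var_power j d) \<noteq> 0"
      using j by (auto simp: gen_val_def mpoly_eval_var_power const_hom to_ac_hom)
    show ?thesis
      using local_graphI[OF h(1) var_power_form[OF j(1)] x(2)] local_graphI[OF h(2) var_power_form[OF j(1)] x(2)] x h(3,4)
      by (intro exI[of _ "gen_val C f / gen_val C (var_power j d)"] exI[of _ "gen_val C g / gen_val C (var_power j d)"]) auto
  qed
  show "(a, 0) \<in> local_graph v \<longleftrightarrow> (\<exists>h\<in>Domain (local_graph v). a = t * h)" for a
    using t unfolding uniformizer_def local_ring_eq by (subst max_ideal_eq[symmetric]) blast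
  show "algebraic_over_gen (const C) a b" for a b by (rule alg_dep)
  show "\<exists>x. transcendental_over (const C) x" by (rule ex_transcendental)
qed

text \<open>
  The defining property of \<open>val_at\<close> allows any uniformizer; two uniformizers differ by a unit, so
  the order does not depend on the choice.
\<close>

lemma val_at_eq_ord:
  assumes t: "uniformizer C P t" and f: "f \<noteq> 0"
  shows "val_at C P f = discrete_place.ord (local_graph v) t f"
proof -
  interpret PL: discrete_place "const C" "local_graph v" t by (rule discrete_place_local[OF t])
  show ?thesis
    unfolding val_at_def
  proof (rule the_equality)
    obtain u where "PL.runit u" "f = u * t powi PL.ord f" using PL.ord_factorization[OF f] by blast
    thus "\<exists>t u. uniformizer C P t \<and> u \<in> local_ring C P \<and> inverse u \<in> local_ring C P \<and> u \<noteq> 0 \<and>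
        f = u * t powi PL.ord f"
      using t unfolding local_ring_eq PL.runit_def by blast
  next
    fix k assume "\<exists>t u. uniformizer C P t \<and> u \<in> local_ring C P \<and> inverse u \<in> local_ring C P \<and> u \<noteq> 0 \<and>
        f = u * t powi k"
    then obtain s u where su: "uniformizer C P s" "PL.runit u" "f = u * s powi k"
      unfolding local_ring_eq PL.runit_def by blast
    interpret ps: discrete_place "const C" "local_graph v" s by (rule discrete_place_local[OF su(1)])
    have s0: "s \<noteq> 0" by (rule ps.t_nonzero)
    obtain h where h: "h \<in> PL.R" "t = s * h" using ps.max_ideal_principal PL.t_graph by blast
    have h0: "h \<noteq> 0" using h PL.t_nonzero by auto
    have "1 = PL.ord s + PL.ord h" using PL.ord_mult[OF s0 h0] h(2) PL.ord_t by simp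
    moreover have "0 \<le> PL.ord h" using PL.ord_regular_iff[OF h0] h(1) by simp
    moreover have "1 \<le> PL.ord s" using PL.ord_max_ideal_iff[OF s0] ps.t_graph by simp
    ultimately have "PL.ord s = 1" by simp
    thus "k = PL.ord f" using PL.ord_uniformizer_independent[OF s0 _ su(2)] su(3) by simp
  qed
qed

end

lemma uniformizer_exists: "P \<in> points C \<Longrightarrow> \<exists>t. uniformizer C P t"
  using curve unfolding nonsingular_projective_curve_def nonsingular_def by blast

lemma point_place:
  assumes P: "P \<in> points C" and v: "v \<in> P"
  obtains t where "uniformizer C P t" "discrete_place (const C) (local_graph v) t"
    "\<And>f. f \<noteq> 0 \<Longrightarrow> val_at C P f = discrete_place.ord (local_graph v) t f"
  using uniformizer_exists[OF P] discrete_place_local[OF P v] val_at_eq_ord[OF P v] by metis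

lemma val_at_local_ring_iff:
  assumes "P \<in> points C" "f \<noteq> 0"
  shows "f \<in> local_ring C P \<longleftrightarrow> 0 \<le> val_at C P f"
proof -
  obtain v where v: "v \<in> P" using proj_space_nonempty points_proj assms(1) by blast
  obtain t where t: "discrete_place (const C) (local_graph v) t"
     "val_at C P f = discrete_place.ord (local_graph v) t f" using point_place[OF assms(1) v] assms(2) by metis
  interpret PL: discrete_place "const C" "local_graph v" t by fact
  show ?thesis using PL.ord_regular_iff[OF assms(2)] t(2) local_ring_eq[OF assms(1) v] by simp
qed

lemma val_at_max_ideal_iff:
  assumes "P \<in> points C" "v \<in> P" "f \<noteq> 0"
  shows "(f, 0) \<in> local_graph v \<longleftrightarrow> 1 \<le> val_at C P f"
proof -
  obtain t where t: "discrete_place (const C) (local_graph v) t"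
     "val_at C P f = discrete_place.ord (local_graph v) t f" using point_place[OF assms(1,2)] assms(3) by metis
  interpret PL: discrete_place "const C" "local_graph v" t by fact
  show ?thesis using PL.ord_max_ideal_iff[OF assms(3)] t(2) by simp
qed

text \<open>
  The zero function has no factorization, so \<open>val_at\<close> takes the same unspecified value at every
  point; hence valuations that agree on nonzero functions are equal.
\<close>

lemma val_at_zero:
  assumes "P \<in> points C"
  shows "val_at C P 0 = (THE k. False)"
proof -
  obtain v where v: "v \<in> P" using proj_space_nonempty points_proj assms(1) by blast
  have "t \<noteq> 0" if "uniformizer C P t" for t
    using discrete_place.t_nonzero discrete_place_local[OF assms v that] by blast
  thus ?thesis unfolding val_at_def by (intro arg_cong[where f = The]) auto
qed

lemma generated_algebra_ratio:
  assumes j: "coord C j \<noteq> 0" and f: "cform d f"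
  shows "gen_val C f / coord C j ^ d \<in> generated_algebra ((\<lambda>i. coord C i / coord C j) ` {..ambient C})"
proof -
  let ?Z = "(\<lambda>i. coord C i / coord C j) ` {..ambient C}"
  have "gen_val C f = coord C j ^ d * mpoly_eval (const C) (\<lambda>i. coord C i / coord C j) f"
    using mpoly_eval_form_scale[OF f, of "const C" "coord C j" "\<lambda>i. coord C i / coord C j"] j
    by (simp add: gen_val_def)
  moreover have "mpoly_eval (const C) (\<lambda>i. coord C i / coord C j) f \<in> generated_algebra ?Z"
    unfolding mpoly_eval_def
  proof (intro generated_algebra_sum generated_algebra_mult generated_algebra.const generated_algebra_prod generated_algebra_power)
    fix u i assume "u \<in> keys f" "i \<in> keys u"
    hence "i \<le> ambient C" using f by (auto simp: is_form_def)
    hence "coord C i / coord C j * const C 1 \<in> generated_algebra ?Z"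
      by (intro generated_algebra.mult_gen generated_algebra.const) auto
    thus "coord C i / coord C j \<in> generated_algebra ?Z" by simp
  qed
  ultimately show ?thesis using j by simp
qed

lemma points_nonempty: "points C \<noteq> {}"
  using curve unfolding nonsingular_projective_curve_def zariski_irreducible_def by blast

lemma coordinate_nonzero: "\<exists>j\<le>ambient C. coord C j \<noteq> 0"
  using points_nonempty nonzero_coordinate proj_space_nonempty points_proj by blast

text \<open>
  The function field is generated by the ratios of the coordinates to one that does not vanish identically.
\<close>

lemma function_field_fin_gen:
  "\<exists>Z. finite Z \<and> (\<forall>h. \<exists>a\<in>generated_algebra Z. \<exists>b\<in>generated_algebra Z. b \<noteq> 0 \<and> h = a / b)"
proof -
  obtain j where j: "coord C j \<noteq> 0" using coordinate_nonzero by blast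
  let ?Z = "(\<lambda>i. coord C i / coord C j) ` {..ambient C}"
  have "\<exists>a\<in>generated_algebra ?Z. \<exists>b\<in>generated_algebra ?Z. b \<noteq> 0 \<and> h = a / b" for h
  proof -
    obtain d f g where h: "cform d f" "cform d g" "gen_val C g \<noteq> 0"
        "h = gen_val C f / gen_val C g"
      using function_fraction by blast
    show ?thesis
      by (rule bexI[OF _ generated_algebra_ratio[OF j h(1)]], rule bexI[OF _ generated_algebra_ratio[OF j h(2)]])
        (use h j in auto)
  qed
  thus ?thesis by (intro exI[of _ ?Z]) auto
qed

text \<open>
  Projectivity: dividing by a coordinate of largest pole order places all coordinate ratios in the valuation
  ring, and their values are the coordinates of a point. The equations of the curve hold at this point because
  they hold at the generic point.
\<close>

lemma valuation_ring_center:
  assumes max: "maximal_ring_graph G" and c: "\<And>c. (const C c, to_ac c) \<in> G"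
  shows "\<exists>P\<in>points C. local_ring C P \<subseteq> Domain G"
proof -
  have G: "ring_graph G" using max by (simp add: maximal_ring_graph_def)
  define S where "S = {i. i \<le> ambient C \<and> coord C i \<noteq> 0}"
  have dominant: "\<exists>j\<in>I. \<forall>i\<in>I. coord C i / coord C j \<in> Domain G"
    if "finite I" "I \<noteq> {}" "I \<subseteq> S" for I
    using that
  proof (induction I rule: finite_ne_induct)
    case (singleton j)
    thus ?case using ring_graphD(1)[OF G] by (auto simp: S_def)
  next
    case (insert k I)
    then obtain j where j: "j \<in> I" "\<And>i. i \<in> I \<Longrightarrow> coord C i / coord C j \<in> Domain G" by auto
    have nz: "coord C k \<noteq> 0" "coord C j \<noteq> 0" using insert.prems j(1) by (auto simp: S_def)
    hence "coord C k / coord C j \<in> Domain G \<or> inverse (coord C k / coord C j) \<in> Domain G"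
      using maximal_ring_graph_valuation[OF max, of "coord C k / coord C j"] by fastforce
    thus ?case
    proof
      assume "coord C k / coord C j \<in> Domain G"
      thus ?thesis using j by auto
    next
      assume "inverse (coord C k / coord C j) \<in> Domain G"
      hence jk: "coord C j / coord C k \<in> Domain G" by simp
      have "coord C i / coord C k \<in> Domain G" if "i \<in> I" for i
      proof -
        have "(coord C i / coord C j) * (coord C j / coord C k) \<in> Domain G"
          using j(2)[OF that] jk ring_graphD(6)[OF G] by blast
        thus ?thesis using nz by simp
      qed
      moreover have "coord C k / coord C k \<in> Domain G" using nz ring_graphD(1)[OF G] by auto
      ultimately show ?thesis by blast
    qed
  qed
  have "S \<noteq> {}" using coordinate_nonzero by (auto simp: S_def)
  moreover have "finite S" by (simp add: S_def)
  ultimately obtain j where j: "j \<in> S" "\<And>i. i \<in> S \<Longrightarrow> coord C i / coord C j \<in> Domain G"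
    using dominant[of S] by blast
  hence jn: "j \<le> ambient C" "coord C j \<noteq> 0" by (auto simp: S_def)
  define x where "x i = coord C i / coord C j" for i
  have "\<exists>c. (x i, c) \<in> G" if "i \<le> ambient C" for i
    using j(2)[of i] that ring_graphD(2)[OF G] by (cases "coord C i = 0") (auto simp: S_def x_def)
  then obtain w where w: "\<And>i. i \<le> ambient C \<Longrightarrow> (x i, w i) \<in> G" by metis
  define v where "v i = (if i \<le> ambient C then w i else 0)" for i
  have v: "(x i, v i) \<in> G" if "i \<le> ambient C" for i using w that by (simp add: v_def)
  have "(1, v j) \<in> G" using v[OF jn(1)] jn(2) by (simp add: x_def)
  hence vj: "v j = 1" using ring_graphD(8)[OF G ring_graphD(1)[OF G]] by metis
  define P where "P = {w. \<exists>c. c \<noteq> 0 \<and> w = (\<lambda>i. c * v i)}"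
  have vP: "v \<in> P" unfolding P_def by (auto intro!: exI[of _ 1])
  have PV: "P \<in> proj_space (ambient C)"
    unfolding proj_space_def P_def
  proof (rule quotient_point, intro CollectI conjI allI impI)
    show "\<exists>i. v i \<noteq> 0" using vj by (intro exI[of _ j]) simp
  qed (simp add: v_def)
  have form: "(gen_val C f / coord C j ^ d, ac_val v f) \<in> G" if f: "cform d f" for d f
  proof -
    have "gen_val C f = coord C j ^ d * mpoly_eval (const C) x f"
      using mpoly_eval_form_scale[OF f, of "const C" "coord C j" x] jn by (simp add: gen_val_def x_def)
    moreover have "(mpoly_eval (const C) x f, ac_val v f) \<in> G"
      by (rule mpoly_eval_graph[OF G c f v])
    ultimately show ?thesis using jn by simp
  qed
  have "P \<in> points C"
    unfolding points_def zero_locus_def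
  proof (intro CollectI conjI ballI PV)
    fix e assume e: "e \<in> equations C"
    obtain d where d: "cform d e" using e curve unfolding nonsingular_projective_curve_def by blast
    have "gen_val C e = 0" using gen_val_zero_iff[OF d] e by (auto simp: points_def zero_locus_def)
    hence "ac_val v e = 0" using form[OF d] ring_graphD(3)[OF G] by simp
    thus "vanishes_at to_ac e P" using vanishes_at_iff[OF PV vP d] by simp
  qed
  moreover have "local_ring C P \<subseteq> Domain G"
  proof
    fix a assume "a \<in> local_ring C P"
    then obtain d f g where a: "cform d f" "cform d g"
        "\<not> vanishes_at to_ac g P" "a = gen_val C f / gen_val C g"
      unfolding local_ring_def by blast
    have "ac_val v g \<noteq> 0" using a(3) vanishes_at_iff[OF PV vP a(2)] by simp
    from ring_graphD(6)[OF G form[OF a(1)] maximal_ring_graph_inverse[OF max form[OF a(2)] this]]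
    have "gen_val C f / coord C j ^ d * inverse (gen_val C g / coord C j ^ d) \<in> Domain G" by blast
    moreover have "gen_val C f / coord C j ^ d * inverse (gen_val C g / coord C j ^ d) = a"
      using jn a(4) by simp
    ultimately show "a \<in> Domain G" by simp
  qed
  ultimately show ?thesis by blast
qed

lemma transcendental_inverse:
  assumes f: "transcendental_over (const C) f" "f \<noteq> 0"
  shows "transcendental_over (const C) (inverse f)"
  unfolding transcendental_iff
proof (intro allI impI, rule ccontr)
  fix p assume p: "ev (inverse f) p = 0" "p \<noteq> 0"
  define d where "d = degree p"
  have deg: "degree (reflect_poly p) \<le> d" by (simp add: d_def degree_reflect_poly_le)
  have "ev f (reflect_poly p) = (\<Sum>i\<le>d. const C (coeff p (d - i)) * f ^ i)"
    unfolding ev_altdef[OF deg] by (intro sum.cong) (auto simp: coeff_reflect_poly d_def)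
  also have "\<dots> = (\<Sum>i\<le>d. const C (coeff p i) * f ^ (d - i))"
    by (rule sum.reindex_bij_witness[where i = "\<lambda>i. d - i" and j = "\<lambda>i. d - i"]) auto
  also have "\<dots> = f ^ d * ev (inverse f) p"
    unfolding ev_altdef[of p d, OF eq_refl[OF d_def[symmetric]]] sum_distrib_left
    using f(2) by (intro sum.cong) (auto simp: power_diff power_inverse field_class.field_divide_inverse mult_ac)
  finally have "ev f (reflect_poly p) = 0" using p(1) by simp
  hence "reflect_poly p = 0" using f(1) unfolding transcendental_iff by blast
  hence "coeff p (degree p) = 0" by (metis coeff_0 coeff_0_reflect_poly)
  thus False using p(2) by simp
qed

text \<open>
  If \<open>f\<close> is transcendental, \<open>1 / f \<mapsto> 0\<close> defines a homomorphism on
  \<open>\<bbbF>[1 / f]\<close>, given by taking constant terms. A valuation ring extending it contains the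
  local ring of its center and hence \<open>f\<close>, so \<open>1 = f (1 / f)\<close> would be sent to
  \<open>0\<close>.
\<close>

lemma regular_everywhere_algebraic:
  assumes f: "f \<noteq> 0" and reg: "\<And>P. P \<in> points C \<Longrightarrow> f \<in> local_ring C P"
  shows "\<not> transcendental_over (const C) f"
proof
  assume "transcendental_over (const C) f"
  hence y: "transcendental_over (const C) (inverse f)" using transcendental_inverse f by blast
  define G0 where "G0 = {(ev (inverse f) p, to_ac (poly p 0)) | p. True}"
  have G0I: "(ev (inverse f) p, to_ac (poly p 0)) \<in> G0" for p by (auto simp: G0_def)
  have "ring_graph G0"
    unfolding ring_graph_def
  proof (intro conjI allI impI)
    show "(1, 1) \<in> G0" using G0I[of 1] by simp
  next
    fix a p b q assume "(a, p) \<in> G0" "(b, q) \<in> G0"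
    then obtain r s where *: "a = ev (inverse f) r" "p = to_ac (poly r 0)"
        "b = ev (inverse f) s" "q = to_ac (poly s 0)" by (auto simp: G0_def)
    show "(a - b, p - q) \<in> G0" using G0I[of "r - s"] by (simp add: *)
    show "(a * b, p * q) \<in> G0" using G0I[of "r * s"] by (simp add: *)
  next
    fix p assume "(0, p) \<in> G0"
    then obtain r where "0 = ev (inverse f) r" "p = to_ac (poly r 0)" by (auto simp: G0_def)
    thus "p = 0" using y unfolding transcendental_iff by (metis poly_0 to_ac_0)
  qed
  then obtain G where G: "maximal_ring_graph G" "G0 \<subseteq> G" using maximal_ring_graph_exists by blast
  have rG: "ring_graph G" using G(1) by (simp add: maximal_ring_graph_def)
  have "(const C c, to_ac c) \<in> G" for c using G0I[of "[:c:]"] G(2) by auto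
  then obtain P where P: "P \<in> points C" "local_ring C P \<subseteq> Domain G"
    using valuation_ring_center[OF G(1)] by blast
  then obtain c where c: "(f, c) \<in> G" using reg by blast
  have "(inverse f, 0) \<in> G" using G0I[of "[:0, 1:]"] G(2) by auto
  from ring_graphD(6)[OF rG c this] have "(1, 0) \<in> G" using f by simp
  thus False using ring_graphD(8)[OF rG ring_graphD(1)[OF rG]] by force
qed

text \<open>
  Conjugate points have the same local ring and therefore the same valuation, so the set of valuations
  corresponds to the closed points.
\<close>

theorem function_field_places_val_at: "function_field_places (const C) places"
proof unfold_locales
  show "algebraic_over_gen (const C) a b" for a b by (rule alg_dep)
  show "\<exists>Z. finite Z \<and> (\<forall>h. \<exists>a\<in>generated_algebra Z. \<exists>b\<in>generated_algebra Z. b \<noteq> 0 \<and> h = a / b)"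
    by (rule function_field_fin_gen)
next
  fix f assume f: "f \<noteq> 0" "\<And>v. v \<in> places \<Longrightarrow> 0 \<le> v f"
  show "\<not> transcendental_over (const C) f"
    using f val_at_local_ring_iff by (intro regular_everywhere_algebraic) auto
next
  fix v assume "v \<in> places"
  then obtain P where P: "P \<in> points C" "v = val_at C P" by blast
  obtain x where x: "x \<in> P" using proj_space_nonempty points_proj P(1) by blast
  obtain t where t: "discrete_place (const C) (local_graph x) t"
    "\<And>f. f \<noteq> 0 \<Longrightarrow> val_at C P f = discrete_place.ord (local_graph x) t f"
    using point_place[OF P(1) x] by metis
  interpret PL: discrete_place "const C" "local_graph x" t by fact
  show "v (a * b) = v a + v b" if "a \<noteq> 0" "b \<noteq> 0" for a b
    using that by (simp add: P(2) t(2) PL.ord_mult)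
  show "min (v a) (v b) \<le> v (a + b)" if "a \<noteq> 0" "b \<noteq> 0" "a + b \<noteq> 0" for a b
    using that PL.ord_add by (simp add: P(2) t(2))
  show "v (const C c) = 0" if "c \<noteq> 0" for c
    using that by (simp add: P(2) t(2) PL.ord_const)
  show "\<exists>t. t \<noteq> 0 \<and> v t = 1"
    using PL.t_nonzero PL.ord_t by (intro exI[of _ t]) (simp add: P(2) t(2))
  fix u assume "u \<in> places" and eq: "\<And>f. f \<noteq> 0 \<Longrightarrow> v f = u f"
  then obtain P' where P': "P' \<in> points C" "u = val_at C P'" by blast
  show "v = u"
  proof
    fix f show "v f = u f" using eq[of f] val_at_zero[OF P(1)] val_at_zero[OF P'(1)] P(2) P'(2) by (cases "f = 0") auto
  qed
qed

lemma rational_residue: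
  assumes P: "P \<in> points C" "rational_point P" and f: "f = 0 \<or> 0 \<le> val_at C P f"
  shows "\<exists>c. f - const C c = 0 \<or> 1 \<le> val_at C P (f - const C c)"
proof (cases "f = 0")
  case True
  thus ?thesis by (intro exI[of _ 0]) simp
next
  case False
  obtain v where v: "v \<in> P" "\<And>i. v i \<in> range to_ac" using P(2) unfolding rational_point_def by blast
  have "f \<in> local_ring C P" using val_at_local_ring_iff[OF P(1) False] f False by simp
  then obtain p where p: "(f, p) \<in> local_graph v" using local_ring_eq[OF P(1) v(1)] by blast
  define q where "q i = of_ac (v i)" for i
  have q: "v i = to_ac (q i)" for i using to_ac_of_ac[OF v(2)] by (simp add: q_def)
  have val: "ac_val v g = to_ac (mpoly_eval id q g)" for g :: "'a mpoly"
    by (simp add: mpoly_eval_def to_ac_sum to_ac_prod q)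
  obtain c where c: "p = to_ac c"
    using p by (elim local_graphE[OF P(1) v(1)]) (metis val to_ac_divide)
  have "(f - const C c, p - to_ac c) \<in> local_graph v"
    using ring_graphD(4)[OF ring_graph_local[OF P(1) v(1)] p local_graph_const[OF P(1) v(1)]] .
  hence "(f - const C c, 0) \<in> local_graph v" by (simp add: c)
  thus ?thesis using val_at_max_ideal_iff[OF P(1) v(1)] by blast
qed

text \<open>
  The linear forms over \<open>\<bbbF>\<close> vanishing at a rational point have no other common zero. The
  ratio of such a form, nonzero at \<open>P'\<close>, to a coordinate nonzero at \<open>P\<close> has a zero
  at \<open>P\<close> but none at \<open>P'\<close>.
\<close>

lemma rational_point_separated:
  assumes P: "P \<in> points C" "rational_point P" and P': "P' \<in> points C" and ne: "P \<noteq> P'"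
  shows "val_at C P \<noteq> val_at C P'"
proof
  assume eq: "val_at C P = val_at C P'"
  obtain v where v: "v \<in> P" "\<And>i. v i \<in> range to_ac" using P(2) unfolding rational_point_def by blast
  obtain w where w: "w \<in> P'" using proj_space_nonempty points_proj P' by blast
  define q where "q i = of_ac (v i)" for i
  have q: "v i = to_ac (q i)" for i using to_ac_of_ac[OF v(2)] by (simp add: q_def)
  obtain j where j: "j \<le> ambient C" "v j \<noteq> 0" using nonzero_coordinate[OF P(1) v(1)] by blast
  define l :: "nat \<Rightarrow> 'a mpoly" where "l i = const_form (q j) * var_power i 1 - const_form (q i) * var_power j 1" for i
  have l_form: "cform 1 (l i)" if "i \<le> ambient C" for i
    using is_form_mult[OF const_form_form var_power_form[OF that, of 1], of "q j"]
      is_form_mult[OF const_form_form var_power_form[OF j(1), of 1], of "q i"]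
    by (auto simp: l_def intro: is_form_diff)
  have l_eval: "ac_val u (l i) = v j * u i - v i * u j" for u i
    unfolding l_def diff_conv_add_uminus[of "_ * _"] ac_hom_simps
    by (simp add: mpoly_eval_const_form mpoly_eval_var_power to_ac_hom q)
  have "\<exists>i\<le>ambient C. ac_val w (l i) \<noteq> 0"
  proof (rule ccontr)
    assume "\<not> ?thesis"
    hence 1: "v j * w i = v i * w j" if "i \<le> ambient C" for i using that by (simp add: l_eval)
    have wv: "w i = (w j / v j) * v i" for i
    proof (cases "i \<le> ambient C")
      case True
      thus ?thesis using 1[OF True] j(2) by (simp add: field_simps)
    next
      case False
      thus ?thesis using proj_space_member(3)[OF points_proj[OF P(1)] v(1)] proj_space_member(3)[OF points_proj[OF P'] w]
        by simp
    qed
    have "w j \<noteq> 0" using proj_space_member(1)[OF points_proj[OF P'] w] wv by fastforce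
    hence scale: "w j / v j \<noteq> 0" using j(2) by simp
    have "\<exists>c. c \<noteq> 0 \<and> w = (\<lambda>i. c * v i)"
      by (rule exI, rule conjI, rule scale, rule ext, rule wv)
    hence "w \<in> P" unfolding proj_space_member(2)[OF points_proj[OF P(1)] v(1)] by blast
    from proj_space_member(2)[OF points_proj[OF P(1)] this] have "P = P'"
      unfolding proj_space_member(2)[OF points_proj[OF P'] w, symmetric] .
    thus False using ne by simp
  qed
  then obtain i where i: "i \<le> ambient C" "ac_val w (l i) \<noteq> 0" by blast
  have lv: "ac_val v (l i) = 0" by (simp add: l_eval)
  have xv: "ac_val v (var_power j 1) \<noteq> 0" using j(2) by (simp add: mpoly_eval_var_power to_ac_hom)
  define f where "f = gen_val C (l i) / gen_val C (var_power j 1)"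
  have nz: "gen_val C (l i) \<noteq> 0" "gen_val C (var_power j 1) \<noteq> 0"
    using gen_val_nonzero[OF P' w l_form[OF i(1)] i(2)] gen_val_nonzero[OF P(1) v(1) var_power_form[OF j(1)] xv] by auto
  have f0: "f \<noteq> 0" using nz by (simp add: f_def)
  have "(f, 0) \<in> local_graph v"
    using local_graphI[OF P(1) v(1) l_form[OF i(1)] var_power_form[OF j(1)] xv] lv by (simp add: f_def)
  hence "1 \<le> val_at C P f" using val_at_max_ideal_iff[OF P(1) v(1) f0] by simp
  moreover have "inverse f \<in> local_ring C P'"
    using local_graphI[OF P' w var_power_form[OF j(1)] l_form[OF i(1)] i(2)] local_ring_eq[OF P' w] nz
    by (auto simp: f_def)
  hence "0 \<le> val_at C P' (inverse f)" using val_at_local_ring_iff[OF P'] f0 by simp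
  moreover have "val_at C P (inverse f) = - val_at C P f"
  proof -
    interpret function_field_places "const C" places by (rule function_field_places_val_at)
    show ?thesis using val_inverse[of "val_at C P" f] P(1) f0 by simp
  qed
  ultimately show False using eq by simp
qed

end

section \<open>Riemann-Roch spaces of tuples and the Weierstrass semigroup\<close>

lemma lookup_ones: "finite J \<Longrightarrow> lk (ones J) j = (if j \<in> J then 1 else 0)"
  by (simp add: ones_def lookup_sum lookup_single when_def)

lemma ones_insert: "finite J \<Longrightarrow> i \<notin> J \<Longrightarrow> ones (insert i J) = ones J + ones {i}"
  by (simp add: ones_def add.commute)

lemma sum_Pow_insert:
  assumes "finite B" "a \<notin> B"
  shows "(\<Sum>J\<in>Pow (insert a B). F J) = (\<Sum>J\<in>Pow B. F J) + (\<Sum>J\<in>Pow B. F (insert a J))"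
proof -
  have "Pow B \<inter> insert a ` Pow B = {}" using assms(2) by auto
  moreover have "inj_on (insert a) (Pow B)" using assms(2) by (auto simp: inj_on_def)
  ultimately show ?thesis
    unfolding Pow_insert using assms(1) by (simp add: sum.union_disjoint sum.reindex)
qed

lemma sum_Pow_sign:
  fixes A :: "'i set"
  assumes "finite A" "A \<noteq> {}"
  shows "(\<Sum>J\<in>Pow A. (-1) ^ card J :: int) = 0"
proof -
  obtain a where a: "a \<in> A" using assms by blast
  define B where "B = A - {a}"
  have A: "A = insert a B" "a \<notin> B" "finite B" using a assms by (auto simp: B_def)
  have "(-1) ^ card (insert a J) = - ((-1) ^ card J :: int)" if "J \<in> Pow B" for J
    using that A(2,3) finite_subset[of J B] by (subst card_insert_disjoint) auto
  thus ?thesis unfolding A(1) by (simp add: sum_Pow_insert[OF A(3,2)] sum_negf)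
qed

(* keeps the index sets in the form {1..m}, as in the definitions *)
declare One_nat_def [simp del]

locale pointed_curve = smooth_curve C for C :: "('a::{field,finite}, 'k::field) curve" +
  fixes m :: nat and Q :: "nat \<Rightarrow> 'a alg_closure ppoint"
  assumes m2: "2 \<le> m" and injQ: "inj_on Q {1..m}"
    and rationalQ: "j \<in> {1..m} \<Longrightarrow> Q j \<in> points C \<and> rational_point (Q j)"
    and card_field: "m \<le> card (UNIV :: 'a set)"
begin

definition vQ :: "nat \<Rightarrow> 'k \<Rightarrow> int" where "vQ j = val_at C (Q j)"

abbreviation "marked \<equiv> vQ ` {1..m}"

lemma Qp: "j \<in> {1..m} \<Longrightarrow> Q j \<in> points C" and Qr: "j \<in> {1..m} \<Longrightarrow> rational_point (Q j)"
  using rationalQ by auto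

lemma vQ_separated: "j \<in> {1..m} \<Longrightarrow> P \<in> points C \<Longrightarrow> val_at C P = vQ j \<longleftrightarrow> P = Q j"
  using rational_point_separated[OF Qp Qr] unfolding vQ_def by metis

lemma inj_vQ: "inj_on vQ {1..m}"
proof (rule inj_onI)
  fix i j assume ij: "i \<in> {1..m}" "j \<in> {1..m}" "vQ i = vQ j"
  hence "Q i = Q j" using vQ_separated[OF ij(2) Qp[OF ij(1)]] by (simp add: vQ_def)
  thus "i = j" by (rule inj_onD[OF injQ _ ij(1,2)])
qed

lemma vQ_eq_iff: "i \<in> {1..m} \<Longrightarrow> j \<in> {1..m} \<Longrightarrow> vQ i = vQ j \<longleftrightarrow> i = j"
  by (rule inj_on_eq_iff[OF inj_vQ])

sublocale function_field_places "const C" places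
  by (rule function_field_places_val_at)

sublocale rational_places "const C" places marked
proof unfold_locales
  show "finite (marked)" by simp
  show "marked \<noteq> {}" using m2 by simp
  show "marked \<subseteq> places" using Qp by (auto simp: vQ_def)
  fix v f assume "v \<in> marked" and f: "vge v 0 f"
  then obtain j where j: "j \<in> {1..m}" "v = vQ j" by blast
  show "\<exists>c. vge v 1 (f - const C c)"
    using rational_residue[OF Qp[OF j(1)] Qr[OF j(1)], of f] f unfolding vge_def j(2) vQ_def by simp
qed

lemma vQ_marked: "j \<in> {1..m} \<Longrightarrow> vQ j \<in> marked" by simp
lemma vQ_place: "j \<in> {1..m} \<Longrightarrow> vQ j \<in> places" using Qp by (simp add: vQ_def)

text \<open>
  The divisor \<open>\<Sum>\<^sub>j \<alpha>\<^sub>j Q\<^sub>j\<close>, as a function on valuations.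
\<close>

definition tuple_div :: "ituple \<Rightarrow> ('k \<Rightarrow> int) \<Rightarrow> int" where
  "tuple_div \<alpha> v = (\<Sum>j\<in>{1..m}. if v = vQ j then lk \<alpha> j else 0)"

lemma tuple_div_vQ: "j \<in> {1..m} \<Longrightarrow> tuple_div \<alpha> (vQ j) = lk \<alpha> j"
proof -
  assume j: "j \<in> {1..m}"
  have "tuple_div \<alpha> (vQ j) = (\<Sum>i\<in>{1..m}. if i = j then lk \<alpha> i else 0)"
    unfolding tuple_div_def using vQ_eq_iff[OF j] by (intro sum.cong) auto
  thus ?thesis using j by simp
qed

lemma tuple_div_other: "v \<notin> marked \<Longrightarrow> tuple_div \<alpha> v = 0"
  unfolding tuple_div_def by (intro sum.neutral) auto

lemma supported_tuple_div: "supported (tuple_div \<alpha>)"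
  unfolding supported_def using tuple_div_other by blast

lemma deg_tuple_div: "deg (tuple_div \<alpha>) = (\<Sum>j\<in>{1..m}. lk \<alpha> j)"
  unfolding deg_def by (subst sum.reindex[OF inj_vQ]) (simp add: tuple_div_vQ)

lemma tuple_div_le: "(\<And>j. j \<in> {1..m} \<Longrightarrow> lk \<alpha> j \<le> lk \<beta> j) \<Longrightarrow> tuple_div \<alpha> v \<le> tuple_div \<beta> v"
  unfolding tuple_div_def by (intro sum_mono) auto

definition L :: "ituple \<Rightarrow> 'k set" where "L \<alpha> = sections (tuple_div \<alpha>)"

lemma L_iff: "f \<in> L \<alpha> \<longleftrightarrow> (\<forall>j\<in>{1..m}. vge (vQ j) (- lk \<alpha> j) f) \<and>
    (\<forall>v\<in>places - marked. vge v 0 f)"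
proof -
  have "f \<in> L \<alpha> \<longleftrightarrow> (\<forall>v\<in>marked. vge v (- tuple_div \<alpha> v) f) \<and> (\<forall>v\<in>places - marked. vge v (- tuple_div \<alpha> v) f)"
    unfolding L_def sections_def using Q_subset by blast
  thus ?thesis by (simp add: tuple_div_vQ tuple_div_other)
qed

lemma L_mono: "(\<And>j. j \<in> {1..m} \<Longrightarrow> lk \<alpha> j \<le> lk \<beta> j) \<Longrightarrow> L \<alpha> \<subseteq> L \<beta>"
  unfolding L_def by (intro sections_mono tuple_div_le)

lemma subspace_L: "subspace (L \<alpha>)" unfolding L_def by (rule subspace_sections)

lemma riemann_roch_space_L:
  "riemann_roch_space C (\<Sum>i\<in>{1..m}. Poly_Mapping.single (Q i) (lk \<alpha> i)) = L \<alpha>"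
proof -
  have "lk (\<Sum>i\<in>{1..m}. Poly_Mapping.single (Q i) (lk \<alpha> i)) P = tuple_div \<alpha> (val_at C P)"
    if P: "P \<in> points C" for P
    unfolding tuple_div_def lookup_sum lookup_single when_def
    using vQ_separated[OF _ P] by (intro sum.cong) auto
  thus ?thesis unfolding riemann_roch_space_def L_def sections_def vge_def by auto
qed

lemma ell_eq: "ell C m Q \<alpha> = dim (L \<alpha>)"
  unfolding ell_def riemann_roch_space_L ..

text \<open>
  The pole of \<open>f\<close> at \<open>Q\<^sub>j\<close> has exactly the order allowed by
  \<open>\<alpha>\<close>.
\<close>

definition attains :: "nat \<Rightarrow> ituple \<Rightarrow> 'k \<Rightarrow> bool" where
  "attains j \<alpha> f \<longleftrightarrow> f \<noteq> 0 \<and> vQ j f = - lk \<alpha> j"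

lemma not_attains: "f \<in> L \<alpha> \<Longrightarrow> j \<in> {1..m} \<Longrightarrow> \<not> attains j \<alpha> f \<longleftrightarrow> vge (vQ j) (- lk \<alpha> j + 1) f"
  unfolding L_iff attains_def vge_def by fastforce

lemma L_minus_one:
  assumes i: "i \<in> {1..m}"
  shows "L (\<alpha> - ones {i}) = {f \<in> L \<alpha>. \<not> attains i \<alpha> f}"
proof -
  have "f \<in> L (\<alpha> - ones {i}) \<longleftrightarrow> f \<in> L \<alpha> \<and> vge (vQ i) (- lk \<alpha> i + 1) f" for f
  proof
    assume f: "f \<in> L (\<alpha> - ones {i})"
    have "L (\<alpha> - ones {i}) \<subseteq> L \<alpha>" by (rule L_mono) (simp add: lookup_minus lookup_ones)
    moreover have "vge (vQ i) (- lk (\<alpha> - ones {i}) i) f" using f i unfolding L_iff by blast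
    ultimately show "f \<in> L \<alpha> \<and> vge (vQ i) (- lk \<alpha> i + 1) f" using f by (auto simp: lookup_minus lookup_ones)
  next
    assume "f \<in> L \<alpha> \<and> vge (vQ i) (- lk \<alpha> i + 1) f"
    thus "f \<in> L (\<alpha> - ones {i})" unfolding L_iff by (auto simp: lookup_minus lookup_ones)
  qed
  thus ?thesis using not_attains[OF _ i] by blast
qed

lemma finite_span_L: "finite_span (L \<alpha>)"
  unfolding L_def by (rule finite_span_sections[OF supported_tuple_div])

text \<open>
  A section attaining the bound at \<open>Q\<^sub>i\<close> spans a complement of the sections that do not.
\<close>

lemma ell_diff_eq:
  assumes i: "i \<in> {1..m}"
  shows "ell_diff C m Q i \<beta> = (if \<exists>f\<in>L \<beta>. attains i \<beta> f then 1 else 0)"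
proof (cases "\<exists>f\<in>L \<beta>. attains i \<beta> f")
  case False
  hence "L (\<beta> - ones {i}) = L \<beta>" using L_minus_one[OF i, of \<beta>] by auto
  thus ?thesis using False by (simp add: ell_diff_def ell_eq)
next
  case True
  then obtain f where f: "f \<in> L \<beta>" "attains i \<beta> f" by blast
  let ?V = "L (\<beta> - ones {i})"
  have fV: "f \<notin> ?V" using L_minus_one[OF i] f by auto
  have "dim (L \<beta>) \<le> dim ?V + 1"
  proof -
    have "L \<beta> \<subseteq> span (?V \<union> {f})"
    proof
      fix g assume g: "g \<in> L \<beta>"
      have "vge (vQ i) (vQ i f) g" using g f(2) i unfolding L_iff attains_def by auto
      then obtain c where c: "vge (vQ i) (vQ i f + 1) (g - const C c * f)"
        using leading_coefficient[OF vQ_marked[OF i]] f(2) attains_def by blast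
      have "g - const C c * f \<in> L \<beta>" using g f(1) by (intro subspace_diff subspace_scale subspace_L)
      moreover have "vge (vQ i) (- lk \<beta> i + 1) (g - const C c * f)" using c f(2) by (simp add: attains_def)
      ultimately have "g - const C c * f \<in> ?V"
        using not_attains[of "g - const C c * f" \<beta> i] i unfolding L_minus_one[OF i] by blast
      hence "(g - const C c * f) + const C c * f \<in> span (?V \<union> {f})"
        by (intro span_add span_scale span_base) auto
      thus "g \<in> span (?V \<union> {f})" by simp
    qed
    from dim_le_dim_plus_card(2)[OF finite_span_L _ this] show ?thesis by simp
  qed
  moreover have "dim ?V + 1 \<le> dim (L \<beta>)"
  proof -
    obtain B where B: "B \<subseteq> ?V" "\<not> dependent B" "card B = dim ?V" "finite B"
      using finite_span_basis[OF finite_span_L] by metis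
    have sp: "span B \<subseteq> ?V" by (rule span_minimal[OF B(1) subspace_L])
    hence fB: "f \<notin> span B" "f \<notin> B" using fV B(1) by auto
    have ind: "\<not> dependent (insert f B)" using independent_insertI[OF fB(1) B(2)] .
    have "insert f B \<subseteq> L \<beta>" using f B(1) L_minus_one[OF i] by auto
    hence "dim (insert f B) \<le> dim (L \<beta>)" by (rule dim_mono[OF finite_span_L])
    moreover have "dim (insert f B) = card (insert f B)" by (rule dim_eq_card_independent[OF ind])
    ultimately show ?thesis using B fB by simp
  qed
  ultimately show ?thesis using f by (auto simp: ell_diff_def ell_eq)
qed

lemma semigroup_iff:
  "\<alpha> \<in> weierstrass_semigroup C m Q \<longleftrightarrow> \<alpha> \<in> Zm m \<and> (\<exists>f\<in>L \<alpha>. \<forall>j\<in>{1..m}. attains j \<alpha> f)"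
proof
  have lr: "lk (rho C m Q f) j = (if j \<in> {1..m} then - vQ j f else 0)" for f j
    by (simp add: rho_def lookup_sum lookup_single when_def vQ_def)
  have one: "1 \<in> {1..m}" using m2 by simp
  {
    assume "\<alpha> \<in> weierstrass_semigroup C m Q"
    then obtain f where f: "f \<in> regular_outside C m Q" "f \<noteq> 0" "\<alpha> = rho C m Q f"
      unfolding weierstrass_semigroup_def by blast
    have "f \<in> L \<alpha>"
      unfolding L_iff
    proof (intro conjI ballI)
      show "vge (vQ j) (- lk \<alpha> j) f" if "j \<in> {1..m}" for j using that by (simp add: f(3) lr)
      fix v assume v: "v \<in> places - marked"
      then obtain P where P: "P \<in> points C" "v = val_at C P" by blast
      hence "P \<notin> Q ` {1..m}" using v by (auto simp: vQ_def)
      hence "f \<in> local_ring C P" using f(1) P by (auto simp: regular_outside_def)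
      thus "vge v 0 f" using val_at_local_ring_iff[OF P(1) f(2)] P(2) by (simp add: vge_def)
    qed
    moreover have "\<alpha> \<in> Zm m" using f(3) lr by (auto simp: Zm_def in_keys_iff split: if_splits)
    moreover have "\<forall>j\<in>{1..m}. attains j \<alpha> f" using f by (simp add: attains_def lr)
    ultimately show "\<alpha> \<in> Zm m \<and> (\<exists>f\<in>L \<alpha>. \<forall>j\<in>{1..m}. attains j \<alpha> f)" by blast
  }
  {
    assume "\<alpha> \<in> Zm m \<and> (\<exists>f\<in>L \<alpha>. \<forall>j\<in>{1..m}. attains j \<alpha> f)"
    then obtain f where f: "\<alpha> \<in> Zm m" "f \<in> L \<alpha>" "\<And>j. j \<in> {1..m} \<Longrightarrow> attains j \<alpha> f" by blast
    have f0: "f \<noteq> 0" using f(3)[OF one] by (simp add: attains_def)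
    have "f \<in> regular_outside C m Q"
      unfolding regular_outside_def
    proof (intro CollectI ballI)
      fix P assume P: "P \<in> points C - Q ` {1..m}"
      hence "val_at C P \<notin> marked" using vQ_separated by blast
      hence "vge (val_at C P) 0 f" using f(2) P unfolding L_iff by blast
      thus "f \<in> local_ring C P" using val_at_local_ring_iff f0 P by (auto simp: vge_def)
    qed
    moreover have "\<alpha> = rho C m Q f"
    proof (rule poly_mapping_eqI)
      fix j show "lk \<alpha> j = lk (rho C m Q f) j"
        using f(1) f(3)[of j] by (auto simp: lr attains_def Zm_def in_keys_iff)
    qed
    ultimately show "\<alpha> \<in> weierstrass_semigroup C m Q"
      unfolding weierstrass_semigroup_def using f0 by blast
  }
qed

lemma nabla_nonempty:
  assumes i: "i \<in> {1..m}"
    and f: "f \<in> L (\<alpha> - ones {1..m} + ones {i})" "attains i \<alpha> f"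
  shows "nabla C m Q i \<alpha> \<noteq> {}"
proof -
  define \<beta> where "\<beta> = (\<Sum>j\<in>{1..m}. Poly_Mapping.single j (- vQ j f))"
  have \<beta>: "lk \<beta> j = (if j \<in> {1..m} then - vQ j f else 0)" for j
    by (simp add: \<beta>_def lookup_sum lookup_single when_def)
  have f0: "f \<noteq> 0" using f(2) by (simp add: attains_def)
  have bd: "vge (vQ j) (- lk \<alpha> j + 1) f" if "j \<in> {1..m} - {i}" for j
  proof -
    have "vge (vQ j) (- lk (\<alpha> - ones {1..m} + ones {i}) j) f" using f(1) that unfolding L_iff by blast
    thus ?thesis using that by (simp add: lookup_add lookup_minus lookup_ones)
  qed
  have "f \<in> L \<beta>" unfolding L_iff
  proof (intro conjI ballI)
    show "vge (vQ j) (- lk \<beta> j) f" if "j \<in> {1..m}" for j using that by (simp add: \<beta>)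
    show "vge v 0 f" if "v \<in> places - marked" for v using f(1) that unfolding L_iff by blast
  qed
  moreover have "\<beta> \<in> Zm m" by (auto simp: Zm_def in_keys_iff \<beta> split: if_splits)
  moreover have "\<forall>j\<in>{1..m}. attains j \<beta> f" using f0 by (simp add: attains_def \<beta>)
  ultimately have "\<beta> \<in> weierstrass_semigroup C m Q" using semigroup_iff by blast
  moreover have "lk \<beta> i = lk \<alpha> i" using f(2) i by (simp add: \<beta> attains_def)
  moreover have "lk \<beta> j < lk \<alpha> j" if "j \<in> {1..m} - {i}" for j
    using bd[OF that] f0 that by (simp add: \<beta> vge_def)
  ultimately have "\<beta> \<in> nabla C m Q i \<alpha>" by (simp add: nabla_def)
  thus ?thesis by blast
qed

lemma nabla_section:
  assumes i: "i \<in> {1..m}" and ne: "nabla C m Q i \<alpha> \<noteq> {}"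
  shows "\<exists>f\<in>L (\<alpha> - ones {1..m} + ones {i}). attains i \<alpha> f"
proof -
  obtain \<beta> where \<beta>: "\<beta> \<in> weierstrass_semigroup C m Q" "lk \<beta> i = lk \<alpha> i"
      "\<And>j. j \<in> {1..m} - {i} \<Longrightarrow> lk \<beta> j < lk \<alpha> j"
    using ne unfolding nabla_def by blast
  obtain f where f: "f \<in> L \<beta>" "\<And>j. j \<in> {1..m} \<Longrightarrow> attains j \<beta> f" using \<beta>(1) semigroup_iff by blast
  have "L \<beta> \<subseteq> L (\<alpha> - ones {1..m} + ones {i})"
  proof (rule L_mono)
    fix j assume j: "j \<in> {1..m}"
    show "lk \<beta> j \<le> lk (\<alpha> - ones {1..m} + ones {i}) j"
      using \<beta>(2) \<beta>(3)[of j] j by (cases "j = i") (auto simp: lookup_add lookup_minus lookup_ones)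
  qed
  moreover have "attains i \<alpha> f" using f(2)[OF i] \<beta>(2) by (simp add: attains_def)
  ultimately show ?thesis using f(1) by blast
qed

text \<open>
  Let \<open>g\<close> attain the bounds on \<open>S\<close> and \<open>h\<close> the bound at
  \<open>j\<close>. Unless one of them already attains all bounds on \<open>S \<union> {j}\<close>, consider
  \<open>g + c h\<close> for nonzero constants \<open>c\<close>. At each place of \<open>S\<close> at most one
  \<open>c\<close> cancels the leading terms, and at a place where \<open>h\<close> does not attain the bound
  none does; so at most \<open>card S - 1\<close> of the nonzero constants are bad, and there are at least
  \<open>card S\<close> of them.
\<close>

lemma attains_everywhere:
  assumes each: "\<And>j. j \<in> {1..m} \<Longrightarrow> \<exists>f\<in>L \<alpha>. attains j \<alpha> f"
    and S: "finite S" "S \<subseteq> {1..m}"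
  shows "S \<noteq> {} \<Longrightarrow> \<exists>f\<in>L \<alpha>. \<forall>j\<in>S. attains j \<alpha> f"
  using S
proof (induction S rule: finite_induct)
  case (insert j S)
  obtain h where h: "h \<in> L \<alpha>" "attains j \<alpha> h" using each insert.prems by blast
  show ?case
  proof (cases "\<forall>s\<in>S. attains s \<alpha> h")
    case True
    thus ?thesis using h by blast
  next
    case False
    then obtain s0 where s0: "s0 \<in> S" "\<not> attains s0 \<alpha> h" by blast
    then obtain g where g: "g \<in> L \<alpha>" "\<And>s. s \<in> S \<Longrightarrow> attains s \<alpha> g" using insert by auto
    show ?thesis
    proof (cases "attains j \<alpha> g")
      case True
      thus ?thesis using g by blast
    next
      case gj: False
      have jm: "j \<in> {1..m}" and Sm: "S \<subseteq> {1..m}" using insert.prems by auto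
      have comb: "g + const C c * h \<in> L \<alpha>" for c
        using g h by (intro subspace_add subspace_scale subspace_L)
      define bad where "bad s = {c. \<not> attains s \<alpha> (g + const C c * h)}" for s
      have bad_iff: "c \<in> bad s \<longleftrightarrow> vge (vQ s) (- lk \<alpha> s + 1) (g + const C c * h)" if "s \<in> S" for c s
        using not_attains[OF comb, of s c] that Sm by (auto simp: bad_def)
      have bad_unique: "c = c'" if s: "s \<in> S" and c: "c \<in> bad s" "c' \<in> bad s" for s c c'
      proof (rule ccontr)
        assume ne: "c \<noteq> c'"
        have sV: "vQ s \<in> places" using vQ_place s Sm by blast
        have "vge (vQ s) (- lk \<alpha> s + 1) ((g + const C c * h) - (g + const C c' * h))"
          using c unfolding bad_iff[OF s] by (rule vge_diff[OF sV])
        hence "vge (vQ s) (- lk \<alpha> s + 1) (const C (c - c') * h)" by (simp add: algebra_simps)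
        hence "vge (vQ s) (- lk \<alpha> s + 1) h"
          using ne vge_mult_cancel[OF sV, of "const C (c - c')"] val_const[OF sV, of "c - c'"]
          by (metis diff_zero eq_iff_diff_eq_0 iota_eq_0_iff)
        hence "vge (vQ s) (- lk \<alpha> s + 1) ((g + const C c * h) - const C c * h)"
          using c(1) unfolding bad_iff[OF s] by (intro vge_diff vge_scale sV)
        hence "vge (vQ s) (- lk \<alpha> s + 1) g" by simp
        thus False using not_attains[OF g(1), of s] g(2)[OF s] s Sm by blast
      qed
      have bad_s0: "bad s0 = {}"
      proof -
        have sm: "s0 \<in> {1..m}" using s0(1) Sm by blast
        have sV: "vQ s0 \<in> places" by (rule vQ_place[OF sm])
        have "c \<notin> bad s0" for c
        proof
          assume "c \<in> bad s0"
          moreover have "vge (vQ s0) (- lk \<alpha> s0 + 1) (const C c * h)"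
            using s0(2) not_attains[OF h(1) sm] by (intro vge_scale sV) simp
          ultimately have "vge (vQ s0) (- lk \<alpha> s0 + 1) ((g + const C c * h) - const C c * h)"
            unfolding bad_iff[OF s0(1)] by (rule vge_diff[OF sV])
          thus False using not_attains[OF g(1) sm] g(2)[OF s0(1)] by simp
        qed
        thus ?thesis by blast
      qed
      have card_bad: "card (bad s) \<le> 1" if "s \<in> S" for s
        using bad_unique[OF that] by (auto simp: One_nat_def card_le_Suc0_iff_eq)
      have "insert 0 (\<Union>s\<in>S. bad s) \<noteq> UNIV"
      proof
        assume eq: "insert 0 (\<Union>s\<in>S. bad s) = UNIV"
        have "(\<Union>s\<in>S. bad s) = (\<Union>s\<in>S - {s0}. bad s)" using bad_s0 by blast
        hence "card (UNIV :: 'a set) \<le> Suc (card (\<Union>s\<in>S - {s0}. bad s))"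
          using card_insert_le_m1[of "Suc (card (\<Union>s\<in>S. bad s))" "\<Union>s\<in>S. bad s" 0] eq by simp
        also have "card (\<Union>s\<in>S - {s0}. bad s) \<le> (\<Sum>s\<in>S - {s0}. card (bad s))"
          by (rule card_UN_le) (use insert in auto)
        also have "\<dots> \<le> (\<Sum>s\<in>S - {s0}. 1)" by (intro sum_mono card_bad) auto
        also have "\<dots> = card S - 1" using s0(1) insert.hyps by simp
        finally have "card (UNIV :: 'a set) \<le> Suc (card S - 1)" by simp
        also have "\<dots> = card S"
        proof -
          have "card S > 0" using s0(1) insert.hyps(1) by (auto simp: card_gt_0_iff)
          thus ?thesis by simp
        qed
        also have "\<dots> < card (insert j S)" using insert.hyps by simp
        also have "\<dots> \<le> card {1..m}" by (rule card_mono) (use insert.prems in auto)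
        finally show False using card_field by simp
      qed
      then obtain c where c: "c \<noteq> 0" "\<And>s. s \<in> S \<Longrightarrow> c \<notin> bad s" by blast
      have "attains j \<alpha> (g + const C c * h)"
      proof (rule ccontr)
        have jV: "vQ j \<in> places" by (rule vQ_place[OF jm])
        assume "\<not> ?thesis"
        hence 1: "vge (vQ j) (- lk \<alpha> j + 1) (g + const C c * h)" using not_attains[OF comb jm] by blast
        have 2: "vge (vQ j) (- lk \<alpha> j + 1) g" using gj not_attains[OF g(1) jm] by blast
        have "vge (vQ j) (- lk \<alpha> j + 1) (const C c * h)" using vge_diff[OF jV 1 2] by simp
        hence "vge (vQ j) (- lk \<alpha> j + 1) h"
          using c(1) vge_mult_cancel[OF jV, of "const C c"] val_const[OF jV c(1)] by simp
        thus False using not_attains[OF h(1) jm] h(2) by blast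
      qed
      moreover have "\<forall>s\<in>S. attains s \<alpha> (g + const C c * h)" using c(2) by (auto simp: bad_def)
      ultimately show ?thesis using comb by blast
    qed
  qed
qed simp

section \<open>The Poincare coefficients\<close>

text \<open>
  Each summand with the differences \<open>d\<^sub>i\<close> is a difference of two values of
  \<open>\<ell>\<close>, at subsets with and without \<open>i\<close>; together they run through all subsets.
\<close>

lemma poincare_coeff_symmetric:
  assumes i: "i \<in> {1..m}"
  shows "poincare_coeff C m Q i \<alpha> =
    (-1) ^ m * (\<Sum>J\<in>Pow {1..m}. (-1) ^ card J * int (ell C m Q (\<alpha> - ones {1..m} + ones J)))"
proof -
  let ?B = "{1..m} - {i}"
  let ?e = "\<lambda>J. int (ell C m Q (\<alpha> - ones {1..m} + ones J))"
  have I: "{1..m} = insert i ?B" using i by auto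
  have "(\<Sum>J\<in>Pow {1..m}. (-1) ^ card J * ?e J) =
      (\<Sum>J\<in>Pow ?B. (-1) ^ card J * ?e J) + (\<Sum>J\<in>Pow ?B. (-1) ^ card (insert i J) * ?e (insert i J))"
    using sum_Pow_insert[of ?B i "\<lambda>J. (-1) ^ card J * ?e J"] unfolding I[symmetric] by simp
  also have "(\<Sum>J\<in>Pow ?B. (-1) ^ card (insert i J) * ?e (insert i J)) =
      (\<Sum>J\<in>Pow ?B. - ((-1) ^ card J * ?e (insert i J)))"
  proof (rule sum.cong)
    fix J assume "J \<in> Pow ?B"
    hence "finite J" "i \<notin> J" using finite_subset[of J ?B] by auto
    thus "(-1) ^ card (insert i J) * ?e (insert i J) = - ((-1) ^ card J * ?e (insert i J))" by simp
  qed simp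
  also have "(\<Sum>J\<in>Pow ?B. (-1) ^ card J * ?e J) + (\<Sum>J\<in>Pow ?B. - ((-1) ^ card J * ?e (insert i J))) =
      - (\<Sum>J\<in>Pow ?B. (-1) ^ card J * ell_diff C m Q i (\<alpha> - ones {1..m} + ones J + ones {i}))"
    unfolding sum.distrib[symmetric] sum_negf[symmetric]
  proof (rule sum.cong)
    fix J assume "J \<in> Pow ?B"
    hence J: "finite J" "i \<notin> J" using finite_subset[of J ?B] by auto
    have 1: "\<alpha> - ones {1..m} + ones J + ones {i} = \<alpha> - ones {1..m} + ones (insert i J)"
      by (simp only: ones_insert[OF J] add.assoc)
    have 2: "\<alpha> - ones {1..m} + ones J + ones {i} - ones {i} = \<alpha> - ones {1..m} + ones J" by (rule add_diff_cancel)
    have arith: "s * a + - (s * b) = - (s * (b - a))" for s a b :: int by (simp add: algebra_simps)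
    show "(-1) ^ card J * ?e J + - ((-1) ^ card J * ?e (insert i J)) =
        - ((-1) ^ card J * ell_diff C m Q i (\<alpha> - ones {1..m} + ones J + ones {i}))"
      unfolding ell_diff_def 1 2[unfolded 1] by (rule arith)
  qed simp
  finally have "(\<Sum>J\<in>Pow {1..m}. (-1) ^ card J * ?e J) =
      - (\<Sum>J\<in>Pow ?B. (-1) ^ card J * ell_diff C m Q i (\<alpha> - ones {1..m} + ones J + ones {i}))" .
  moreover have "(-1 :: int) ^ m = - ((-1) ^ (m - 1))" using m2 by (cases m) auto
  ultimately show ?thesis unfolding poincare_coeff_def by simp
qed

lemma poincare_coeff_independent:
  "i \<in> {1..m} \<Longrightarrow> j \<in> {1..m} \<Longrightarrow> poincare_coeff C m Q i \<alpha> = poincare_coeff C m Q j \<alpha>"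
  by (simp only: poincare_coeff_symmetric)

text \<open>
  With \<open>m \<ge> 2\<close> there is an index other than \<open>i\<close>, so the signs of the subsets of
  the remaining indices cancel.
\<close>

lemma poincare_coeff_zero:
  assumes i: "i \<in> {1..m}" and const: "\<And>J. J \<subseteq> {1..m} - {i} \<Longrightarrow> ell_diff C m Q i (\<alpha> - ones {1..m} + ones J + ones {i}) = c"
  shows "poincare_coeff C m Q i \<alpha> = 0"
proof -
  have "{1..m} - {i} \<noteq> {}"
  proof
    assume "{1..m} - {i} = {}"
    hence "{1..m} \<subseteq> {i}" by blast
    hence "card {1..m} \<le> card {i}" by (intro card_mono) auto
    thus False using m2 by simp
  qed
  hence "(\<Sum>J\<in>Pow ({1..m} - {i}). (-1) ^ card J :: int) = 0" by (intro sum_Pow_sign) auto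
  moreover have "(\<Sum>J\<in>Pow ({1..m} - {i}). (-1) ^ card J * ell_diff C m Q i (\<alpha> - ones {1..m} + ones J + ones {i})) =
      (\<Sum>J\<in>Pow ({1..m} - {i}). (-1) ^ card J) * c"
    unfolding sum_distrib_right using const by (intro sum.cong) auto
  ultimately show ?thesis unfolding poincare_coeff_def by simp
qed

lemma lk_shift:
  assumes "j \<in> {1..m}" "J \<subseteq> {1..m} - {i}"
  shows "lk (\<alpha> - ones {1..m} + ones J + ones {i}) j = (if j = i \<or> j \<in> J then lk \<alpha> j else lk \<alpha> j - 1)"
proof -
  have "finite J" using assms(2) finite_subset by blast
  thus ?thesis using assms by (auto simp: lookup_add lookup_minus lookup_ones)
qed

text \<open>
  Along the tuples in the definition the \<open>k\<close>-th coordinate is constant. If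
  \<open>\<nabla>\<^sub>k(\<alpha>)\<close> is nonempty, a function attaining the bound at
  \<open>Q\<^sub>k\<close> for the smallest of these tuples does so for all of them, and all differences are
  \<open>1\<close>. If no section of \<open>\<alpha>\<close>, the largest of them, attains the bound at
  \<open>Q\<^sub>k\<close>, all differences are \<open>0\<close>. In both cases the coefficient vanishes,
  whichever \<open>k\<close> is used to compute it. So if it does not vanish, every single bound is attained,
  and then all of them are attained by one function, which means that \<open>\<alpha>\<close> lies in the
  semigroup.
\<close>

lemma poincare_coeff_nonzero_maximal:
  assumes i: "i \<in> {1..m}" and \<alpha>: "\<alpha> \<in> Zm m" and nz: "poincare_coeff C m Q i \<alpha> \<noteq> 0"
  shows "\<alpha> \<in> maximal_elements C m Q"
proof -
  have nz': "poincare_coeff C m Q k \<alpha> \<noteq> 0" if "k \<in> {1..m}" for k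
    using nz poincare_coeff_independent[OF i that] by simp
  have "nabla C m Q k \<alpha> = {}" if k: "k \<in> {1..m}" for k
  proof (rule ccontr)
    assume "nabla C m Q k \<alpha> \<noteq> {}"
    then obtain f where f: "f \<in> L (\<alpha> - ones {1..m} + ones {k})" "attains k \<alpha> f"
      using nabla_section[OF k] by blast
    have "ell_diff C m Q k (\<alpha> - ones {1..m} + ones J + ones {k}) = 1" if J: "J \<subseteq> {1..m} - {k}" for J
    proof -
      have "L (\<alpha> - ones {1..m} + ones {k}) \<subseteq> L (\<alpha> - ones {1..m} + ones J + ones {k})"
        using finite_subset[OF J] by (intro L_mono) (auto simp: lookup_add lookup_minus lookup_ones)
      moreover have "attains k (\<alpha> - ones {1..m} + ones J + ones {k}) f"
        using f(2) by (simp add: attains_def lk_shift[OF k J])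
      ultimately show ?thesis using f(1) ell_diff_eq[OF k] by auto
    qed
    thus False using poincare_coeff_zero[OF k] nz'[OF k] by blast
  qed
  moreover have "\<alpha> \<in> weierstrass_semigroup C m Q"
  proof -
    have "\<exists>f\<in>L \<alpha>. attains k \<alpha> f" if k: "k \<in> {1..m}" for k
    proof (rule ccontr)
      assume none: "\<not> ?thesis"
      have "ell_diff C m Q k (\<alpha> - ones {1..m} + ones J + ones {k}) = 0" if J: "J \<subseteq> {1..m} - {k}" for J
      proof -
        have "L (\<alpha> - ones {1..m} + ones J + ones {k}) \<subseteq> L \<alpha>"
          by (intro L_mono) (simp add: lk_shift[OF _ J])
        hence "\<not> (\<exists>f\<in>L (\<alpha> - ones {1..m} + ones J + ones {k}). attains k (\<alpha> - ones {1..m} + ones J + ones {k}) f)"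
          using none by (auto simp: attains_def lk_shift[OF k J])
        thus ?thesis using ell_diff_eq[OF k] by simp
      qed
      thus False using poincare_coeff_zero[OF k] nz'[OF k] by blast
    qed
    hence "\<exists>f\<in>L \<alpha>. \<forall>j\<in>{1..m}. attains j \<alpha> f"
      by (intro attains_everywhere) (use m2 in auto)
    thus ?thesis using semigroup_iff \<alpha> by blast
  qed
  ultimately show ?thesis by (auto simp: maximal_elements_def)
qed

section \<open>Periods and the lattice of principal tuples\<close>

text \<open>
  The least positive multiple exists because some multiple of \<open>Q\<^sub>i - Q\<^bsub>i +
  1\<^esub>\<close> is principal.
\<close>

lemma period_properties:
  assumes i: "i \<in> {1..m - 1}"
  shows "0 < period C Q i"
    "principal_divisor C (Poly_Mapping.single (Q i) (int (period C Q i)) - Poly_Mapping.single (Q (i + 1)) (int (period C Q i)))"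
proof -
  let ?P = "\<lambda>t. 0 < t \<and> principal_divisor C (Poly_Mapping.single (Q i) (int t) - Poly_Mapping.single (Q (i + 1)) (int t))"
  have ii: "i \<in> {1..m}" "i + 1 \<in> {1..m}" using i by auto
  have ne: "Q i \<noteq> Q (i + 1)" using inj_on_eq_iff[OF injQ ii] by simp
  have "vQ i \<noteq> vQ (i + 1)" using vQ_eq_iff[OF ii] by simp
  then obtain f t where f: "f \<noteq> 0" "0 < t" "vQ i f = t" "vQ (i + 1) f = - t"
      "\<And>v. v \<in> places - {vQ i, vQ (i + 1)} \<Longrightarrow> v f = 0"
    using two_point_principal[OF vQ_marked[OF ii(1)] vQ_marked[OF ii(2)]] by blast
  let ?D = "Poly_Mapping.single (Q i) t - Poly_Mapping.single (Q (i + 1)) t"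
  have "keys ?D \<subseteq> points C"
    using keys_diff[of "Poly_Mapping.single (Q i) t" "Poly_Mapping.single (Q (i + 1)) t"] Qp[OF ii(1)] Qp[OF ii(2)] by (auto split: if_splits)
  moreover have "lk ?D P = val_at C P f" if P: "P \<in> points C" for P
  proof -
    consider "P = Q i" | "P = Q (i + 1)" | "P \<noteq> Q i" "P \<noteq> Q (i + 1)" by blast
    thus ?thesis
    proof cases
      case 1
      thus ?thesis using ne f(3) by (simp add: lookup_minus lookup_single when_def vQ_def)
    next
      case 2
      thus ?thesis using ne f(4) by (simp add: lookup_minus lookup_single when_def vQ_def)
    next
      case 3
      hence "val_at C P f = 0" using vQ_separated[OF ii(1) P] vQ_separated[OF ii(2) P] P by (intro f(5)) auto
      thus ?thesis using 3 by (simp add: lookup_minus lookup_single when_def)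
    qed
  qed
  ultimately have "principal_divisor C ?D" unfolding principal_divisor_def using f(1) by blast
  hence "?P (nat t)" using f(2) by simp
  from LeastI[of ?P, OF this] show "0 < period C Q i"
    "principal_divisor C (Poly_Mapping.single (Q i) (int (period C Q i)) - Poly_Mapping.single (Q (i + 1)) (int (period C Q i)))"
    unfolding period_def[symmetric] by auto
qed

text \<open>
  By the choice of the periods the generators have such functions, and the quotient of two functions realizes
  the difference of their tuples.
\<close>

lemma Theta_function:
  assumes "\<eta> \<in> Theta C m Q"
  shows "\<exists>g. g \<noteq> 0 \<and> (\<forall>j\<in>{1..m}. vQ j g = lk \<eta> j) \<and> (\<forall>v\<in>places - marked. v g = 0)"
  using assms unfolding Theta_def
proof (induction rule: group_closure.induct)
  case (base s)
  show ?case
  proof (cases "s = 0")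
    case True
    have "v 1 = 0" if "v \<in> places" for v using that by simp
    thus ?thesis using True vQ_place by (intro exI[of _ 1]) auto
  next
    case False
    then obtain i where i: "i \<in> {1..m - 1}" "s = eta C Q i" using base by blast
    have ii: "i \<in> {1..m}" "i + 1 \<in> {1..m}" using i(1) by auto
    let ?t = "int (period C Q i)"
    obtain f where f: "f \<noteq> 0"
      "\<And>P. P \<in> points C \<Longrightarrow> lk (Poly_Mapping.single (Q i) ?t - Poly_Mapping.single (Q (i + 1)) ?t) P = val_at C P f"
      using period_properties(2)[OF i(1)] unfolding principal_divisor_def by blast
    have Qeq: "Q i = Q j \<longleftrightarrow> i = j" "Q (i + 1) = Q j \<longleftrightarrow> i + 1 = j" if "j \<in> {1..m}" for j
      using inj_on_eq_iff[OF injQ ii(1) that] inj_on_eq_iff[OF injQ ii(2) that] by simp_all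
    have 1: "vQ j f = lk s j" if "j \<in> {1..m}" for j
      using f(2)[OF Qp[OF that]] Qeq[OF that] by (simp add: vQ_def i(2) eta_def lookup_minus lookup_single when_def)
    have 2: "v f = 0" if v: "v \<in> places - marked" for v
    proof -
      obtain P where P: "P \<in> points C" "v = val_at C P" using v by blast
      have "P \<noteq> Q i" "P \<noteq> Q (i + 1)" using v P ii by (auto simp: vQ_def)
      thus ?thesis using f(2)[OF P(1)] P(2) by (simp add: lookup_minus lookup_single when_def)
    qed
    show ?thesis using f(1) 1 2 by blast
  qed
next
  case (diff s t)
  from diff.IH(1) obtain f where f: "f \<noteq> 0" "\<forall>j\<in>{1..m}. vQ j f = lk s j"
      "\<forall>v\<in>places - marked. v f = 0" by (elim exE conjE)
  from diff.IH(2) obtain g where g: "g \<noteq> 0" "\<forall>j\<in>{1..m}. vQ j g = lk t j"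
      "\<forall>v\<in>places - marked. v g = 0" by (elim exE conjE)
  have "vQ j (f / g) = lk (s - t) j" if "j \<in> {1..m}" for j
    using bspec[OF f(2) that] bspec[OF g(2) that] val_divide[OF vQ_place[OF that] f(1) g(1)] by (simp add: lookup_minus)
  moreover have "v (f / g) = 0" if "v \<in> places - marked" for v
    using bspec[OF f(3) that] bspec[OF g(3) that] val_divide[OF DiffD1[OF that] f(1) g(1)] by simp
  ultimately show ?case using f(1) g(1) by (intro exI[of _ "f / g"]) auto
qed

lemma ell_Theta_le:
  assumes "\<eta> \<in> Theta C m Q"
  shows "ell C m Q (\<alpha> + \<eta>) \<le> ell C m Q \<alpha>"
proof -
  obtain g where g: "g \<noteq> 0" "\<And>j. j \<in> {1..m} \<Longrightarrow> vQ j g = lk \<eta> j"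
      "\<And>v. v \<in> places - marked \<Longrightarrow> v g = 0"
    using Theta_function[OF assms] by blast
  show ?thesis unfolding ell_eq L_def
  proof (rule dim_sections_translate_le[OF g(1) finite_span_sections[OF supported_tuple_div]])
    fix v assume v: "v \<in> places"
    show "tuple_div (\<alpha> + \<eta>) v \<le> tuple_div \<alpha> v + v g"
    proof (cases "v \<in> marked")
      case True
      then obtain j where "j \<in> {1..m}" "v = vQ j" by blast
      thus ?thesis using g(2) by (simp add: tuple_div_vQ lookup_add)
    next
      case False
      thus ?thesis using g(3)[of v] v by (simp add: tuple_div_other)
    qed
  qed
qed

lemma ell_Theta:
  assumes "\<eta> \<in> Theta C m Q"
  shows "ell C m Q (\<alpha> + \<eta>) = ell C m Q \<alpha>"
proof -
  have "- \<eta> \<in> Theta C m Q" using assms by (simp add: Theta_def)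
  from ell_Theta_le[OF this, of "\<alpha> + \<eta>"] ell_Theta_le[OF assms, of \<alpha>] show ?thesis by simp
qed

lemma poincare_coeff_Theta:
  assumes "\<eta> \<in> Theta C m Q" "i \<in> {1..m}"
  shows "poincare_coeff C m Q i (\<alpha> + \<eta>) = poincare_coeff C m Q i \<alpha>"
proof -
  have "\<alpha> + \<eta> - ones {1..m} + ones J = (\<alpha> - ones {1..m} + ones J) + \<eta>" for J by simp
  thus ?thesis unfolding poincare_coeff_symmetric[OF assms(2)] by (simp only: ell_Theta[OF assms(1)])
qed

text \<open>
  The \<open>j\<close>-th coordinate of \<open>\<Sum>\<^sub>i k\<^sub>i \<eta>\<^sup>i\<close>, under the
  convention \<open>k\<^sub>0 = k\<^sub>m = 0\<close>, involves only \<open>k\<^sub>j\<close> and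
  \<open>k\<^bsub>j - 1\<^esub>\<close>.
\<close>

lemma Theta_normal_form:
  assumes "\<eta> \<in> Theta C m Q"
  shows "\<exists>k. k 0 = 0 \<and> k m = 0 \<and> (\<forall>j. lk \<eta> j = (if j \<in> {1..m}
     then k j * int (period C Q j) - k (j - 1) * int (period C Q (j - 1)) else 0))"
  using assms unfolding Theta_def
proof (induction rule: group_closure.induct)
  case (base s)
  show ?case
  proof (cases "s = 0")
    case True
    thus ?thesis by (intro exI[of _ "\<lambda>_. 0"]) auto
  next
    case False
    then obtain i where i: "i \<in> {1..m - 1}" "s = eta C Q i" using base by blast
    show ?thesis using i(1)
      by (intro exI[of _ "\<lambda>j. if j = i then 1 else 0"])
        (auto simp: i(2) eta_def lookup_minus lookup_single when_def)
  qed
next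
  case (diff s t)
  from diff.IH(1) obtain k where "k 0 = 0" "k m = 0" "\<forall>j. lk s j = (if j \<in> {1..m}
     then k j * int (period C Q j) - k (j - 1) * int (period C Q (j - 1)) else 0)" by (elim exE conjE)
  moreover from diff.IH(2) obtain l where "l 0 = 0" "l m = 0" "\<forall>j. lk t j = (if j \<in> {1..m}
     then l j * int (period C Q j) - l (j - 1) * int (period C Q (j - 1)) else 0)" by (elim exE conjE)
  ultimately show ?case by (intro exI[of _ "\<lambda>j. k j - l j"]) (simp add: lookup_minus algebra_simps)
qed

lemma Theta_subset_Zm: "\<eta> \<in> Theta C m Q \<Longrightarrow> \<eta> \<in> Zm m"
  using Theta_normal_form[of \<eta>] by (auto simp: Zm_def in_keys_iff split: if_splits)

lemma Zm_diff: "\<alpha> \<in> Zm m \<Longrightarrow> \<beta> \<in> Zm m \<Longrightarrow> \<alpha> - \<beta> \<in> Zm m"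
  and Zm_add: "\<alpha> \<in> Zm m \<Longrightarrow> \<beta> \<in> Zm m \<Longrightarrow> \<alpha> + \<beta> \<in> Zm m"
proof -
  have Zm: "\<gamma> \<in> Zm m \<longleftrightarrow> (\<forall>j. j \<notin> {1..m} \<longrightarrow> lk \<gamma> j = 0)" for \<gamma>
    unfolding Zm_def by (auto simp: in_keys_iff subset_iff)
  show "\<alpha> \<in> Zm m \<Longrightarrow> \<beta> \<in> Zm m \<Longrightarrow> \<alpha> - \<beta> \<in> Zm m" by (simp add: Zm lookup_minus)
  show "\<alpha> \<in> Zm m \<Longrightarrow> \<beta> \<in> Zm m \<Longrightarrow> \<alpha> + \<beta> \<in> Zm m" by (simp add: Zm lookup_add)
qed

text \<open>
  The coordinates are reduced one after the other by division with remainder; subtracting a multiple of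
  \<open>\<eta>\<^sup>i\<close> affects only the coordinates \<open>i\<close> and \<open>i + 1\<close>.
\<close>

lemma fundamental_representative:
  assumes "\<alpha> \<in> Zm m"
  shows "\<exists>\<eta>\<in>Theta C m Q. \<alpha> - \<eta> \<in> fund_region C m Q"
proof -
  have mult: "\<exists>\<zeta>\<in>Theta C m Q. \<forall>j. lk \<zeta> j = k * lk \<eta> j" if \<eta>: "\<eta> \<in> Theta C m Q" for k :: int and \<eta>
  proof (induction k rule: int_induct[where k = 0])
    case base
    show ?case by (rule bexI[of _ 0]) (auto simp: Theta_def)
  next
    case (step1 k)
    then obtain \<zeta> where "\<zeta> \<in> Theta C m Q" "\<forall>j. lk \<zeta> j = k * lk \<eta> j" by blast
    thus ?case using \<eta> group_closure_add[of \<zeta> _ \<eta>]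
      by (intro bexI[of _ "\<zeta> + \<eta>"]) (auto simp: Theta_def lookup_add algebra_simps)
  next
    case (step2 k)
    then obtain \<zeta> where "\<zeta> \<in> Theta C m Q" "\<forall>j. lk \<zeta> j = k * lk \<eta> j" by blast
    thus ?case using \<eta> group_closure.diff[of \<zeta> _ \<eta>]
      by (intro bexI[of _ "\<zeta> - \<eta>"]) (auto simp: Theta_def lookup_minus algebra_simps)
  qed
  have "r \<le> m - 1 \<Longrightarrow> \<exists>\<eta>\<in>Theta C m Q. \<forall>i\<in>{1..r}. 0 \<le> lk (\<alpha> - \<eta>) i \<and> lk (\<alpha> - \<eta>) i < int (period C Q i)" for r
  proof (induction r)
    case 0
    show ?case by (rule bexI[of _ 0]) (auto simp: Theta_def)
  next
    case (Suc r)
    then obtain \<eta> where \<eta>: "\<eta> \<in> Theta C m Q"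
      "\<And>i. i \<in> {1..r} \<Longrightarrow> 0 \<le> lk (\<alpha> - \<eta>) i \<and> lk (\<alpha> - \<eta>) i < int (period C Q i)" by auto
    have r: "Suc r \<in> {1..m - 1}" using Suc.prems by simp
    let ?a = "int (period C Q (Suc r))"
    have a: "0 < ?a" using period_properties(1)[OF r] by simp
    define k where "k = lk (\<alpha> - \<eta>) (Suc r) div ?a"
    have "eta C Q (Suc r) \<in> Theta C m Q" unfolding Theta_def using r by (intro group_closure.base) auto
    then obtain \<zeta> where \<zeta>: "\<zeta> \<in> Theta C m Q" "\<And>j. lk \<zeta> j = k * lk (eta C Q (Suc r)) j" using mult by blast
    have "lk (\<alpha> - (\<eta> + \<zeta>)) i = lk (\<alpha> - \<eta>) i" if "i \<in> {1..r}" for i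
      using that by (simp add: \<zeta>(2) lookup_minus lookup_add eta_def lookup_single when_def)
    moreover have "lk (\<alpha> - (\<eta> + \<zeta>)) (Suc r) = lk (\<alpha> - \<eta>) (Suc r) mod ?a"
      by (simp add: \<zeta>(2) lookup_minus lookup_add eta_def lookup_single when_def k_def minus_div_mult_eq_mod[symmetric])
    ultimately have "0 \<le> lk (\<alpha> - (\<eta> + \<zeta>)) i \<and> lk (\<alpha> - (\<eta> + \<zeta>)) i < int (period C Q i)"
      if "i \<in> {1..Suc r}" for i
      using that \<eta>(2)[of i] a by (cases "i = Suc r") auto
    moreover have "\<eta> + \<zeta> \<in> Theta C m Q" using \<eta>(1) \<zeta>(1) by (simp add: Theta_def group_closure_add)
    ultimately show ?case by blast
  qed
  from this[of "m - 1"] obtain \<eta> where "\<eta> \<in> Theta C m Q"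
     "\<forall>i\<in>{1..m - 1}. 0 \<le> lk (\<alpha> - \<eta>) i \<and> lk (\<alpha> - \<eta>) i < int (period C Q i)" by blast
  thus ?thesis using Zm_diff[OF assms Theta_subset_Zm] unfolding fund_region_def by blast
qed

lemma fundamental_unique:
  assumes "\<beta> \<in> fund_region C m Q" "\<gamma> \<in> fund_region C m Q" "\<beta> - \<gamma> \<in> Theta C m Q"
  shows "\<beta> = \<gamma>"
proof -
  obtain k where k: "k 0 = 0" "k m = 0" "\<And>j. lk (\<beta> - \<gamma>) j = (if j \<in> {1..m}
     then k j * int (period C Q j) - k (j - 1) * int (period C Q (j - 1)) else 0)"
    using Theta_normal_form[OF assms(3)] by blast
  have k0: "j \<le> m - 1 \<Longrightarrow> k j = 0" for j
  proof (induction j)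
    case (Suc j)
    have j: "Suc j \<in> {1..m - 1}" "Suc j \<in> {1..m}" using Suc.prems by auto
    let ?a = "int (period C Q (Suc j))"
    have "lk \<beta> (Suc j) - lk \<gamma> (Suc j) = k (Suc j) * ?a"
      using k(3)[of "Suc j"] j Suc by (simp add: lookup_minus)
    moreover have "0 \<le> lk \<beta> (Suc j)" "lk \<beta> (Suc j) < ?a" "0 \<le> lk \<gamma> (Suc j)" "lk \<gamma> (Suc j) < ?a"
      using assms(1,2) j(1) by (auto simp: fund_region_def)
    ultimately have "\<bar>k (Suc j) * ?a\<bar> < ?a" by linarith
    hence "\<bar>k (Suc j)\<bar> * ?a < 1 * ?a" by (simp add: abs_mult)
    hence "\<bar>k (Suc j)\<bar> < 1" by (rule mult_right_less_imp_less) simp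
    thus ?case by simp
  qed (use k in simp)
  have kz: "k j = 0" if "j \<le> m" for j using k0[of j] k(2) that by (cases "j = m") auto
  have "lk (\<beta> - \<gamma>) j = 0" for j using k(3)[of j] kz[of j] kz[of "j - 1"] by (cases "j \<le> m") auto
  thus ?thesis by (intro poly_mapping_eqI) (simp add: lookup_minus)
qed

text \<open>
  Consider the tuples \<open>(-1, \<dots>, -1, k)\<close>. Passing from \<open>k\<close> to \<open>k +
  1\<close> raises \<open>\<ell>\<close> by one exactly if some section attains the new bound at
  \<open>Q\<^sub>m\<close>; by Riemann's inequality this fails for finitely many \<open>k\<close> only. For
  large \<open>\<alpha>\<^sub>m\<close> the function obtained lies in
  \<open>\<nabla>\<^sub>m(\<alpha>)\<close> simultaneously for all \<open>\<alpha>\<close> with nonnegative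
  first coordinates.
\<close>

lemma eventually_attains:
  "\<exists>K. \<forall>\<alpha>. (\<forall>i\<in>{1..m - 1}. 0 \<le> lk \<alpha> i) \<longrightarrow> K < lk \<alpha> m \<longrightarrow> nabla C m Q m \<alpha> \<noteq> {}"
proof -
  have mm: "m \<in> {1..m}" using m2 by simp
  obtain c :: nat where c: "\<And>D. supported D \<Longrightarrow> deg D - int c \<le> int (dim (sections D))"
    using riemann_inequality by blast
  define \<gamma> where "\<gamma> k = Poly_Mapping.single m (int k) - ones {1..m - 1}" for k
  have \<gamma>: "lk (\<gamma> k) j = (if j = m then int k else if j \<in> {1..m - 1} then -1 else 0)" for k j
    using m2 by (auto simp: \<gamma>_def lookup_minus lookup_single lookup_ones when_def)
  have \<gamma>_step: "\<gamma> (Suc k) - ones {m} = \<gamma> k" for k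
    using m2 by (intro poly_mapping_eqI) (auto simp: \<gamma> lookup_minus lookup_ones)
  define A where "A = {k. \<not> (\<exists>f\<in>L (\<gamma> (Suc k)). attains m (\<gamma> (Suc k)) f)}"
  have step: "int (ell C m Q (\<gamma> (Suc k))) = int (ell C m Q (\<gamma> k)) + (if k \<in> A then 0 else 1)" for k
    using ell_diff_eq[OF mm, of "\<gamma> (Suc k)"] unfolding ell_diff_def \<gamma>_step
    by (cases "\<exists>f\<in>L (\<gamma> (Suc k)). attains m (\<gamma> (Suc k)) f") (simp_all add: A_def)
  have count: "int (ell C m Q (\<gamma> N)) + int (card (A \<inter> {..<N})) = int (ell C m Q (\<gamma> 0)) + int N" for N
  proof (induction N)
    case (Suc N)
    have "card (A \<inter> {..<Suc N}) = card (A \<inter> {..<N}) + (if N \<in> A then 1 else 0)"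
      by (auto simp: lessThan_Suc)
    thus ?case using Suc step[of N] by simp
  qed simp
  define B where "B = ell C m Q (\<gamma> 0) + c + m"
  have bound: "card (A \<inter> {..<N}) \<le> B" for N
  proof -
    have I: "{1..m} = insert m {1..m - 1}" using m2 by auto
    have "deg (tuple_div (\<gamma> N)) = lk (\<gamma> N) m + (\<Sum>j\<in>{1..m - 1}. lk (\<gamma> N) j)"
      unfolding deg_tuple_div by (subst I) (use m2 in simp)
    also have "lk (\<gamma> N) m = int N" by (simp add: \<gamma>)
    also have "(\<Sum>j\<in>{1..m - 1}. lk (\<gamma> N) j) = (\<Sum>j\<in>{1..m - 1}. -1)" by (rule sum.cong) (auto simp: \<gamma>)
    finally have "int N - int m \<le> deg (tuple_div (\<gamma> N))" by simp
    hence "int N - int m - int c \<le> int (ell C m Q (\<gamma> N))" using c[OF supported_tuple_div, of "\<gamma> N"] by (simp add: ell_eq L_def)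
    thus ?thesis using count[of N] by (simp add: B_def)
  qed
  have finA: "finite A"
  proof (rule ccontr)
    assume "infinite A"
    then obtain W where W: "finite W" "card W = Suc B" "W \<subseteq> A" using infinite_arbitrarily_large by blast
    have "W \<subseteq> A \<inter> {..<Suc (Max W)}" using W by (auto simp: less_Suc_eq_le)
    hence "card W \<le> card (A \<inter> {..<Suc (Max W)})" by (intro card_mono) auto
    thus False using bound[of "Suc (Max W)"] W(2) by simp
  qed
  define K where "K = int (Max (insert 0 A)) + 1"
  have "nabla C m Q m \<alpha> \<noteq> {}" if \<alpha>: "\<forall>i\<in>{1..m - 1}. 0 \<le> lk \<alpha> i" "K < lk \<alpha> m" for \<alpha>
  proof -
    define k where "k = nat (lk \<alpha> m) - 1"
    have k: "int (Suc k) = lk \<alpha> m" "Max (insert 0 A) < k" using \<alpha>(2) by (auto simp: k_def K_def)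
    have "k \<notin> A"
    proof
      assume "k \<in> A"
      hence "k \<le> Max (insert 0 A)" using finA by (intro Max_ge) auto
      thus False using k(2) by simp
    qed
    then obtain f where f: "f \<in> L (\<gamma> (Suc k))" "attains m (\<gamma> (Suc k)) f" by (auto simp: A_def)
    have "L (\<gamma> (Suc k)) \<subseteq> L (\<alpha> - ones {1..m} + ones {m})"
    proof (rule L_mono)
      fix j assume j: "j \<in> {1..m}"
      show "lk (\<gamma> (Suc k)) j \<le> lk (\<alpha> - ones {1..m} + ones {m}) j"
      proof (cases "j = m")
        case True
        thus ?thesis using k(1) j by (simp add: \<gamma> lookup_add lookup_minus lookup_ones del: of_nat_Suc)
      next
        case False
        hence "j \<in> {1..m - 1}" using j by auto
        hence "0 \<le> lk \<alpha> j" "lk (\<gamma> (Suc k)) j = -1" using \<alpha>(1) False by (auto simp: \<gamma>)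
        moreover have "lk (\<alpha> - ones {1..m} + ones {m}) j = lk \<alpha> j - 1"
          using j False by (simp add: lookup_add lookup_minus lookup_ones)
        ultimately show ?thesis by simp
      qed
    qed
    moreover have "attains m \<alpha> f" using f(2) k(1) by (simp add: attains_def \<gamma> del: of_nat_Suc)
    ultimately show ?thesis using nabla_nonempty[OF mm] f(1) by blast
  qed
  thus ?thesis by blast
qed

lemma finite_bounded_tuples: "finite {\<alpha> \<in> Zm m. \<forall>j\<in>{1..m}. \<bar>lk \<alpha> j\<bar> \<le> B}"
proof (rule finite_imageD)
  let ?S = "{\<alpha> \<in> Zm m. \<forall>j\<in>{1..m}. \<bar>lk \<alpha> j\<bar> \<le> B}"
  let ?r = "\<lambda>\<alpha>. restrict (lk \<alpha>) {1..m}"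
  have "?r ` ?S \<subseteq> PiE {1..m} (\<lambda>_. {-B..B})" by (auto simp: abs_le_iff)
  thus "finite (?r ` ?S)" by (rule finite_subset) (intro finite_PiE, auto)
  show "inj_on ?r ?S"
  proof (rule inj_onI, rule poly_mapping_eqI)
    fix \<alpha> \<beta> j assume ab: "\<alpha> \<in> ?S" "\<beta> \<in> ?S" "?r \<alpha> = ?r \<beta>"
    show "lk \<alpha> j = lk \<beta> j"
    proof (cases "j \<in> {1..m}")
      case True
      thus ?thesis using fun_cong[OF ab(3), of j] by simp
    next
      case False
      hence "j \<notin> keys \<alpha>" "j \<notin> keys \<beta>" using ab(1,2) by (auto simp: Zm_def)
      thus ?thesis by (simp add: in_keys_iff)
    qed
  qed
qed

text \<open>
  In the fundamental region all coordinates but the last are bounded by the periods. The last one is bounded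
  below because sections exist only in nonnegative degree, and above because
  \<open>\<nabla>\<^sub>m(\<alpha>)\<close> is empty.
\<close>

lemma finite_maximal_fundamental: "finite (maximal_elements C m Q \<inter> fund_region C m Q)"
proof -
  obtain K where K: "\<And>\<alpha>. (\<forall>i\<in>{1..m - 1}. 0 \<le> lk \<alpha> i) \<Longrightarrow> K < lk \<alpha> m \<Longrightarrow> nabla C m Q m \<alpha> \<noteq> {}"
    using eventually_attains by blast
  have mm: "m \<in> {1..m}" using m2 by simp
  have I: "{1..m} = insert m {1..m - 1}" using m2 by auto
  define S where "S = (\<Sum>i\<in>{1..m - 1}. int (period C Q i))"
  define B where "B = S + \<bar>K\<bar>"
  have "maximal_elements C m Q \<inter> fund_region C m Q \<subseteq> {\<alpha> \<in> Zm m. \<forall>j\<in>{1..m}. \<bar>lk \<alpha> j\<bar> \<le> B}"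
  proof
    fix \<alpha> assume \<alpha>: "\<alpha> \<in> maximal_elements C m Q \<inter> fund_region C m Q"
    have Z: "\<alpha> \<in> Zm m" and c: "\<And>i. i \<in> {1..m - 1} \<Longrightarrow> 0 \<le> lk \<alpha> i \<and> lk \<alpha> i < int (period C Q i)"
      using \<alpha> by (auto simp: fund_region_def)
    have "nabla C m Q m \<alpha> = {}" using \<alpha> mm unfolding maximal_elements_def by blast
    hence up: "lk \<alpha> m \<le> K" using K[of \<alpha>] c by force
    have "\<alpha> \<in> weierstrass_semigroup C m Q" using \<alpha> by (simp add: maximal_elements_def)
    then obtain f where "f \<in> L \<alpha>" "\<forall>j\<in>{1..m}. attains j \<alpha> f" unfolding semigroup_iff by blast
    hence f: "f \<in> L \<alpha>" "attains m \<alpha> f" using mm by blast+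
    have "0 \<le> deg (tuple_div \<alpha>)" using deg_nonneg[OF supported_tuple_div, of f \<alpha>] f by (simp add: L_def attains_def)
    hence "0 \<le> lk \<alpha> m + (\<Sum>i\<in>{1..m - 1}. lk \<alpha> i)" unfolding deg_tuple_div by (subst (asm) I) (use m2 in simp)
    moreover have "(\<Sum>i\<in>{1..m - 1}. lk \<alpha> i) \<le> S" unfolding S_def
      by (intro sum_mono) (use c in force)
    ultimately have lo: "- S \<le> lk \<alpha> m" by simp
    have S0: "0 \<le> S" unfolding S_def by (intro sum_nonneg) simp
    have "\<bar>lk \<alpha> j\<bar> \<le> B" if "j \<in> {1..m}" for j
    proof (cases "j = m")
      case True
      thus ?thesis using up lo S0 by (simp add: B_def)
    next
      case False
      hence j: "j \<in> {1..m - 1}" using that by auto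
      hence "int (period C Q j) \<le> S" unfolding S_def by (intro member_le_sum) auto
      hence "0 \<le> lk \<alpha> j" "lk \<alpha> j \<le> S" using c[OF j] by auto
      thus ?thesis by (simp add: B_def)
    qed
    thus "\<alpha> \<in> {\<alpha> \<in> Zm m. \<forall>j\<in>{1..m}. \<bar>lk \<alpha> j\<bar> \<le> B}" using Z by blast
  qed
  thus ?thesis by (rule finite_subset) (rule finite_bounded_tuples)
qed

lemma poincare_series_factorization:
  assumes i: "i \<in> {1..m}"
  shows "poincare_series C m Q i = series_times (theta_series C m Q) (poincare_poly C m Q i)"
proof
  fix \<alpha>
  let ?M = "maximal_elements C m Q \<inter> fund_region C m Q"
  let ?p = "poincare_coeff C m Q i"
  have fin: "finite ?M" by (rule finite_maximal_fundamental)
  have lkp: "lk (poincare_poly C m Q i) \<beta> = (if \<beta> \<in> ?M then ?p \<beta> else 0)" for \<beta>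
    using fin by (simp add: poincare_poly_def lookup_sum lookup_single when_def)
  have keys: "keys (poincare_poly C m Q i) \<subseteq> ?M" by (auto simp: in_keys_iff lkp split: if_splits)
  have "series_times (theta_series C m Q) (poincare_poly C m Q i) \<alpha> =
      (\<Sum>\<beta>\<in>?M. theta_series C m Q (\<alpha> - \<beta>) * lk (poincare_poly C m Q i) \<beta>)"
    unfolding series_times_def by (rule sum.mono_neutral_left[OF fin keys]) (auto simp: in_keys_iff)
  also have "\<dots> = (\<Sum>\<beta>\<in>?M. if \<alpha> - \<beta> \<in> Theta C m Q then ?p \<beta> else 0)"
    by (rule sum.cong) (auto simp: lkp theta_series_def)
  also have "\<dots> = poincare_series C m Q i \<alpha>"
  proof (cases "\<alpha> \<in> Zm m")
    case False
    have "\<alpha> - \<beta> \<notin> Theta C m Q" if "\<beta> \<in> ?M" for \<beta>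
      using Zm_add[OF Theta_subset_Zm, of "\<alpha> - \<beta>" \<beta>] that False by (auto simp: fund_region_def)
    thus ?thesis using False by (simp add: poincare_series_def)
  next
    case True
    obtain \<eta> where \<eta>: "\<eta> \<in> Theta C m Q" "\<alpha> - \<eta> \<in> fund_region C m Q"
      using fundamental_representative[OF True] by blast
    define \<beta> where "\<beta> = \<alpha> - \<eta>"
    have p: "?p \<alpha> = ?p \<beta>" using poincare_coeff_Theta[OF \<eta>(1) i, of \<beta>] by (simp add: \<beta>_def)
    have iff: "\<alpha> - \<gamma> \<in> Theta C m Q \<longleftrightarrow> \<gamma> = \<beta>" if "\<gamma> \<in> ?M" for \<gamma>
    proof
      assume "\<alpha> - \<gamma> \<in> Theta C m Q"
      hence "(\<alpha> - \<gamma>) - \<eta> \<in> Theta C m Q" using \<eta>(1) group_closure.diff unfolding Theta_def by blast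
      moreover have "(\<alpha> - \<gamma>) - \<eta> = \<beta> - \<gamma>" by (simp add: \<beta>_def)
      ultimately show "\<gamma> = \<beta>" using fundamental_unique[of \<beta> \<gamma>] \<eta>(2) that by (simp add: \<beta>_def)
    qed (use \<eta> in \<open>simp add: \<beta>_def\<close>)
    have "(\<Sum>\<gamma>\<in>?M. if \<alpha> - \<gamma> \<in> Theta C m Q then ?p \<gamma> else 0) = (\<Sum>\<gamma>\<in>?M. if \<gamma> = \<beta> then ?p \<gamma> else 0)"
      by (rule sum.cong) (auto simp: iff)
    also have "\<dots> = (if \<beta> \<in> ?M then ?p \<beta> else 0)" using fin by simp
    also have "\<dots> = ?p \<beta>"
      using poincare_coeff_nonzero_maximal[OF i, of \<beta>] \<eta>(2) by (auto simp: \<beta>_def fund_region_def)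
    finally show ?thesis using True p by (simp add: poincare_series_def)
  qed
  finally show "poincare_series C m Q i \<alpha> = series_times (theta_series C m Q) (poincare_poly C m Q i) \<alpha>" by simp
qed

end

theorem theorem4p2:
  fixes C :: "('a::{field,finite}, 'k::field) curve"
    and m :: nat
    and Q :: "nat \<Rightarrow> 'a alg_closure ppoint"
    and i :: nat
  assumes "nonsingular_projective_curve C"
    and "m \<ge> 2"
    and "inj_on Q {1..m}"
    and "\<forall>j\<in>{1..m}. Q j \<in> points C \<and> rational_point (Q j)"
    and "card (UNIV :: 'a set) \<ge> m"
    and "i \<in> {1..m}"
  shows "finite (maximal_elements C m Q \<inter> fund_region C m Q) \<and>
    poincare_series C m Q i = series_times (theta_series C m Q) (poincare_poly C m Q i)"
proof -
  interpret pointed_curve C m Q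
    by unfold_locales (use assms in auto)
  show ?thesis using finite_maximal_fundamental poincare_series_factorization[OF assms(6)] by blast
qed

end
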